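(* Let $\lambda>0$, $s\ge2$, and let $(Y_i)_{i=1}^s$ be i.i.d. from $P_0$. For any $0<\delta<\frac12$, $$P_0^s\left\{(Y_i)_{i=1}^s:\ \big\|\Sigma_{0,\lambda}^{-1/2}(\hat\Sigma_0-\Sigma_0)\Sigma_{0,\lambda}^{-1/2}\big\|_{\mathcal L^2(\mathscr H)}\le\frac{32\kappa\log\frac3\delta}{\lambda s}+\sqrt{\frac{16\kappa\,\mathcal N_1(\lambda)\log\frac2\delta}{\lambda s}}\right\}\ge1-2\delta .$$ Furthermore, if $C:=\sup_i\|\phi_i\|_\infty<\infty$, then $$P_0^s\left\{(Y_i)_{i=1}^s:\ \big\|\Sigma_{0,\lambda}^{-1/2}(\hat\Sigma_0-\Sigma_0)\Sigma_{0,\lambda}^{-1/2}\big\|_{\mathcal L^2(\mathscr H)}\le\frac{32C^2\mathcal N_1(\lambda)\log\frac3\delta}{s}+\sqrt{\frac{16C^2\mathcal N_1^2(\lambda)\log\frac2\delta}{s}}\right\}\ge1-2\delta .$$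
   Context: $(\mathcal X,\mathcal B)$ is a second countable space with its Borel $\sigma$-algebra; $\mathscr H$ is an RKHS of real functions on $\mathcal X$ with continuous reproducing kernel $K$, $\sup_xK(x,x)\le\kappa$. $P_0$ is a probability measure on $\mathcal X$, $\mu_0=\int K(\cdot,x)\,dP_0(x)$. $\mathfrak I:\mathscr H\to L^2(P_0)$, $f\mapsto[f-\mathbb E_{P_0}f]_\sim$, with adjoint $\mathfrak I^*$; $\mathcal T=\mathfrak I\mathfrak I^*=\sum_i\lambda_i\,\tilde\phi_i\otimes\tilde\phi_i$ on $L^2(P_0)$ (infinitely many positive decreasing eigenvalues $\lambda_i$, orthonormal $\tilde\phi_i$); $\phi_i=\lambda_i^{-1}\mathfrak I^*\tilde\phi_i\in\mathscr H$, $\|\phi_i\|_\infty=\sup_x|\phi_i(x)|$. $\Sigma_0=\mathfrak I^*\mathfrak I=\int(K(\cdot,x)-\mu_0)\otimes_{\mathscr H}(K(\cdot,x)-\mu_0)\,dP_0(x)$, $\Sigma_{0,\lambda}=\Sigma_0+\lambda I$, $\mathcal N_1(\lambda)=\mathrm{Tr}(\Sigma_{0,\lambda}^{-1/2}\Sigma_0\Sigma_{0,\lambda}^{-1/2})$. $\hat\Sigma_0=\frac1{2s(s-1)}\sum_{i\ne j}(K(\cdot,Y_i)-K(\cdot,Y_j))\otimes_{\mathscr H}(K(\cdot,Y_i)-K(\cdot,Y_j))$. $\|\cdot\|_{\mathcal L^2(\mathscr H)}$ is the Hilbert–Schmidt norm. *)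

theory Defs
  imports "HOL-Probability.Probability"
begin

section \<open>Bounded operators on a real Hilbert space\<close>

lift_definition rank_one :: "'h::real_inner \<Rightarrow> 'h \<Rightarrow> 'h \<Rightarrow>\<^sub>L 'h"
  is "\<lambda>u v f. (v \<bullet> f) *\<^sub>R u"
  by (intro bounded_linear_scaleR_left[THEN bounded_linear_compose] bounded_linear_inner_right)

definition positive_op :: "('h::real_inner \<Rightarrow>\<^sub>L 'h) \<Rightarrow> bool" where
  "positive_op A \<longleftrightarrow> (\<forall>x y. blinfun_apply A x \<bullet> y = x \<bullet> blinfun_apply A y)
     \<and> (\<forall>x. 0 \<le> blinfun_apply A x \<bullet> x)"

definition op_sqrt :: "('h::real_inner \<Rightarrow>\<^sub>L 'h) \<Rightarrow> 'h \<Rightarrow>\<^sub>L 'h" where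
  "op_sqrt A = (THE S. positive_op S \<and> S o\<^sub>L S = A)"

definition op_inverse :: "('h::real_inner \<Rightarrow>\<^sub>L 'h) \<Rightarrow> 'h \<Rightarrow>\<^sub>L 'h" where
  "op_inverse A = (THE B. A o\<^sub>L B = id_blinfun \<and> B o\<^sub>L A = id_blinfun)"

definition orthonormal_basis :: "'h::real_inner set \<Rightarrow> bool" where
  "orthonormal_basis B \<longleftrightarrow>
     pairwise orthogonal B \<and> (\<forall>e\<in>B. norm e = 1) \<and> closure (span B) = UNIV"

text \<open>Trace and Hilbert-Schmidt norm do not depend on the orthonormal basis, so one is chosen.
  The Hilbert-Schmidt norm of an operator that is not Hilbert-Schmidt is \<open>\<infinity>\<close>.\<close>

definition some_onb :: "'h::real_inner set" where
  "some_onb = (SOME B. orthonormal_basis B)"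

definition op_trace :: "('h::real_inner \<Rightarrow>\<^sub>L 'h) \<Rightarrow> real" where
  "op_trace A = (\<Sum>\<^sub>\<infinity>e\<in>some_onb. blinfun_apply A e \<bullet> e)"

definition hs_norm :: "('h::real_inner \<Rightarrow>\<^sub>L 'h) \<Rightarrow> ereal" where
  "hs_norm A =
     (if (\<lambda>e. (norm (blinfun_apply A e))\<^sup>2) summable_on some_onb
      then ereal (sqrt (\<Sum>\<^sub>\<infinity>e\<in>some_onb. (norm (blinfun_apply A e))\<^sup>2)) else \<infinity>)"

section \<open>Reproducing kernel Hilbert spaces\<close>

text \<open>A Hilbert space of functions on \<open>'x\<close> is a Hilbert space \<open>'h\<close> with an injective map
  \<open>fn\<close> sending each element to the function it is; \<open>fn\<close> is linear for the pointwise operations.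
  \<open>kernel_at fn K x\<close> is the function \<open>K(\<cdot>, x)\<close> as an element of \<open>'h\<close>.\<close>

definition rkhs :: "('h::{real_inner,banach} \<Rightarrow> 'x \<Rightarrow> real) \<Rightarrow> ('x \<Rightarrow> 'x \<Rightarrow> real) \<Rightarrow> bool" where
  "rkhs fn K \<longleftrightarrow> (\<forall>x. linear (\<lambda>f. fn f x)) \<and> inj fn
     \<and> (\<forall>x. \<exists>k. fn k = (\<lambda>y. K y x) \<and> (\<forall>f. fn f x = f \<bullet> k))"

definition kernel_at :: "('h \<Rightarrow> 'x \<Rightarrow> real) \<Rightarrow> ('x \<Rightarrow> 'x \<Rightarrow> real) \<Rightarrow> 'x \<Rightarrow> 'h" where
  "kernel_at fn K x = inv fn (\<lambda>y. K y x)"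

section \<open>The centred inclusion and its operators\<close>

text \<open>Elements of \<open>L\<^sup>2(P)\<close> are given by representatives; equality in \<open>L\<^sup>2(P)\<close> is
  equality almost everywhere.\<close>

definition L2_space :: "'x measure \<Rightarrow> ('x \<Rightarrow> real) set" where
  "L2_space P = {g \<in> borel_measurable P. integrable P (\<lambda>x. (g x)\<^sup>2)}"

definition L2_inner :: "'x measure \<Rightarrow> ('x \<Rightarrow> real) \<Rightarrow> ('x \<Rightarrow> real) \<Rightarrow> real" where
  "L2_inner P g h = (\<integral>x. g x * h x \<partial>P)"

definition centred :: "'x measure \<Rightarrow> ('h \<Rightarrow> 'x \<Rightarrow> real) \<Rightarrow> 'h \<Rightarrow> 'x \<Rightarrow> real" where
  "centred P fn f = (\<lambda>x. fn f x - (\<integral>y. fn f y \<partial>P))"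

definition centred_adj ::
    "'x measure \<Rightarrow> ('h::real_inner \<Rightarrow> 'x \<Rightarrow> real) \<Rightarrow> ('x \<Rightarrow> real) \<Rightarrow> 'h" where
  "centred_adj P fn g = (THE h. \<forall>f. f \<bullet> h = L2_inner P (centred P fn f) g)"

definition integral_op ::
    "'x measure \<Rightarrow> ('h::real_inner \<Rightarrow> 'x \<Rightarrow> real) \<Rightarrow> ('x \<Rightarrow> real) \<Rightarrow> 'x \<Rightarrow> real" where
  "integral_op P fn g = centred P fn (centred_adj P fn g)"

definition cov_op :: "'x measure \<Rightarrow> ('h::real_inner \<Rightarrow> 'x \<Rightarrow> real) \<Rightarrow> 'h \<Rightarrow>\<^sub>L 'h" where
  "cov_op P fn = Blinfun (\<lambda>f. centred_adj P fn (centred P fn f))"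

text \<open>\<open>\<T> = \<Sum>\<^sub>i l\<^sub>i \<psi>\<^sub>i \<otimes> \<psi>\<^sub>i\<close> with \<open>l\<^sub>i > 0\<close> decreasing and \<open>\<psi>\<^sub>i\<close> orthonormal; the
  series, applied to any \<open>g\<close>, converges in the norm of \<open>L\<^sup>2(P)\<close>.\<close>

definition eigen_decomp ::
    "'x measure \<Rightarrow> ('h::real_inner \<Rightarrow> 'x \<Rightarrow> real) \<Rightarrow> (nat \<Rightarrow> real) \<Rightarrow> (nat \<Rightarrow> 'x \<Rightarrow> real) \<Rightarrow> bool" where
  "eigen_decomp P fn l \<psi> \<longleftrightarrow>
     (\<forall>i. 0 < l i) \<and> decseq l
     \<and> (\<forall>i. \<psi> i \<in> L2_space P)
     \<and> (\<forall>i j. L2_inner P (\<psi> i) (\<psi> j) = (if i = j then 1 else 0))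
     \<and> (\<forall>g\<in>L2_space P.
          (\<lambda>n. \<integral>x. (integral_op P fn g x - (\<Sum>i<n. l i * L2_inner P (\<psi> i) g * \<psi> i x))\<^sup>2 \<partial>P)
            \<longlonglongrightarrow> 0)"

definition eig_fun ::
    "'x measure \<Rightarrow> ('h::real_inner \<Rightarrow> 'x \<Rightarrow> real) \<Rightarrow> (nat \<Rightarrow> real) \<Rightarrow> (nat \<Rightarrow> 'x \<Rightarrow> real) \<Rightarrow> nat \<Rightarrow> 'h" where
  "eig_fun P fn l \<psi> i = inverse (l i) *\<^sub>R centred_adj P fn (\<psi> i)"

definition cov_inv_sqrt ::
    "'x measure \<Rightarrow> ('h::real_inner \<Rightarrow> 'x \<Rightarrow> real) \<Rightarrow> real \<Rightarrow> 'h \<Rightarrow>\<^sub>L 'h" where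
  "cov_inv_sqrt P fn lam = op_sqrt (op_inverse (cov_op P fn + lam *\<^sub>R id_blinfun))"

definition N1 :: "'x measure \<Rightarrow> ('h::real_inner \<Rightarrow> 'x \<Rightarrow> real) \<Rightarrow> real \<Rightarrow> real" where
  "N1 P fn lam = op_trace (cov_inv_sqrt P fn lam o\<^sub>L cov_op P fn o\<^sub>L cov_inv_sqrt P fn lam)"

definition emp_cov ::
    "('h::real_inner \<Rightarrow> 'x \<Rightarrow> real) \<Rightarrow> ('x \<Rightarrow> 'x \<Rightarrow> real) \<Rightarrow> nat \<Rightarrow> (nat \<Rightarrow> 'x) \<Rightarrow> 'h \<Rightarrow>\<^sub>L 'h" where
  "emp_cov fn K s Y = (1 / (2 * real s * (real s - 1))) *\<^sub>R
     (\<Sum>i<s. \<Sum>j\<in>{..<s} - {i}.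
        rank_one (kernel_at fn K (Y i) - kernel_at fn K (Y j))
                 (kernel_at fn K (Y i) - kernel_at fn K (Y j)))"

definition whitened_error ::
    "'x measure \<Rightarrow> ('h::real_inner \<Rightarrow> 'x \<Rightarrow> real) \<Rightarrow> ('x \<Rightarrow> 'x \<Rightarrow> real) \<Rightarrow> real \<Rightarrow> nat \<Rightarrow> (nat \<Rightarrow> 'x) \<Rightarrow> 'h \<Rightarrow>\<^sub>L 'h"
  where
  "whitened_error P fn K lam s Y =
     cov_inv_sqrt P fn lam o\<^sub>L (emp_cov fn K s Y - cov_op P fn) o\<^sub>L cov_inv_sqrt P fn lam"

end

theory Submission
  imports Defs
begin

text \<open>Write \<open>k\<^sub>x = K(\<cdot>, x)\<close> and let \<open>e\<^sub>i = \<surd>\<lambda>\<^sub>i \<phi>\<^sub>i\<close>, which are orthonormal eigenvectors of \<open>\<Sigma>\<^sub>0\<close> in the RKHS, with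
  \<open>\<Sigma>\<^sub>0 = 0\<close> on their orthogonal complement. Almost surely the sample lies in the support of \<open>P\<^sub>0\<close>, and there
  the differences \<open>k\<^sub>x - k\<^sub>y\<close> are in the closed span of the \<open>e\<^sub>i\<close>. Hence the squared Hilbert-Schmidt norm of the
  whitened error is the increasing limit of the sums of squares of its first \<open>n \<times> n\<close> entries, and it suffices
  to bound these finite truncations with constants independent of \<open>n\<close>.

  The matrix of entries is a U-statistic of the kernel \<open>h = d \<otimes> d / 2\<close>, where \<open>d\<close> is the whitened difference
  \<open>k\<^sub>x - k\<^sub>y\<close>, with \<open>E \<parallel>h\<parallel> \<le> N\<^sub>1\<close> and \<open>\<parallel>h\<parallel> \<le> M\<close>, where \<open>M = 2 \<kappa> / \<lambda>\<close> or \<open>M = 2 C\<^sup>2 N\<^sub>1\<close>. Averaging over the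
  permutations of the sample reduces it to a sum of \<open>\<lfloor>s / 2\<rfloor> \<ge> s / 3\<close> independent centred terms, bounded by
  \<open>2 M\<close> and of variance at most \<open>M N\<^sub>1\<close>. For these, \<open>E cosh (t \<parallel>S\<parallel>)\<close> is estimated term by term in the manner of
  Pinelis, which gives a dimension-free Bernstein inequality.\<close>

section \<open>A Bernstein inequality for vector-valued U-statistics\<close>

text \<open>Hilbert-Schmidt operators never become a type of random vectors: a truncation is a real
  family indexed by \<open>{..<n} \<times> {..<n}\<close> with Euclidean norm \<open>L2_set\<close>,
  so all integrands are real functions on a finite product. The price is that no constant may depend
  on \<open>n\<close>. This rules out union bounds over entries and is why the exponential moment of
  the norm itself is followed. The norm is not smooth at 0, but its cosh is a power series in the
  squared norm. When an increment is added, the first-order term is therefore linear in the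
  increment and integrates to 0. Passing from cosh back to exp costs a factor 2, which is the 2 in
  the failure probability \<open>2 * \<delta>\<close>. Two facts about the spaces shape the rest.
  The eigenvectors need not span the RKHS, so each diagonal operator carries a separate scalar on
  their orthogonal complement. The Hilbert-Schmidt norm is computed in an arbitrary basis
  \<open>some_onb\<close> unrelated to the eigenvectors, so bounds have to be carried from one
  system to the other.\<close>

lemma cosh_sqrt_sums:
  fixes r :: real
  assumes "0 \<le> r"
  shows "(\<lambda>n. r ^ n / fact (2 * n)) sums cosh (sqrt r)"
proof -
  let ?f = "\<lambda>n. if even n then (sqrt r) ^ n /\<^sub>R fact n else 0"
  have "strict_mono (\<lambda>n::nat. 2 * n)"
    by (simp add: strict_mono_def)
  moreover have "?f n = 0" if "n \<notin> range (\<lambda>n. 2 * n)" for n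
    using that by (auto elim!: evenE)
  ultimately have "(\<lambda>n. ?f (2 * n)) sums cosh (sqrt r)"
    using cosh_converges[of "sqrt r"] by (subst sums_mono_reindex) auto
  moreover have "?f (2 * n) = r ^ n / fact (2 * n)" for n
  proof -
    have "sqrt r ^ (2 * n) = r ^ n"
      using assms by (subst power_mult) simp
    then show ?thesis by (simp add: divide_inverse)
  qed
  ultimately show ?thesis by simp
qed

text \<open>The square root is concave, so no composition rule applies. Convexity comes from the
  series in \<open>r\<close>, whose coefficients are nonnegative and whose powers are convex on the
  half line.\<close>

lemma convex_on_cosh_sqrt: "convex_on {0..} (\<lambda>r::real. cosh (sqrt r))"
proof (intro convex_onI)
  fix t x y :: real
  assume t: "0 < t" "t < 1" and xy: "x \<in> {0..}" "y \<in> {0..}"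
  have pw: "((1 - t) * x + t * y) ^ n \<le> (1 - t) * x ^ n + t * y ^ n" for n
    using convex_onD[OF convex_power_even, of n t x y] convex_onD[OF convex_power_odd, of n t x y] t xy
    by (cases "even n") auto
  have nn: "0 \<le> (1 - t) * x + t * y"
    using t xy by (auto intro!: add_nonneg_nonneg mult_nonneg_nonneg)
  have "(\<lambda>n. (1 - t) * (x ^ n / fact (2 * n)) + t * (y ^ n / fact (2 * n)))
      sums ((1 - t) * cosh (sqrt x) + t * cosh (sqrt y))"
    using xy by (intro sums_add sums_mult cosh_sqrt_sums) auto
  moreover have "(\<lambda>n. ((1 - t) * x + t * y) ^ n / fact (2 * n)) sums cosh (sqrt ((1 - t) * x + t * y))"
    using nn by (rule cosh_sqrt_sums)
  moreover have "((1 - t) * x + t * y) ^ n / fact (2 * n)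
      \<le> (1 - t) * (x ^ n / fact (2 * n)) + t * (y ^ n / fact (2 * n))" for n
    using divide_right_mono[OF pw[of n], of "fact (2 * n)"] by (simp add: add_divide_distrib)
  ultimately show "cosh (sqrt ((1 - t) *\<^sub>R x + t *\<^sub>R y)) \<le> (1 - t) * cosh (sqrt x) + t * cosh (sqrt y)"
    by (simp only: real_scaleR_def) (rule sums_le)
qed simp

lemma sinh_ge_self:
  fixes x :: real
  assumes "0 \<le> x"
  shows "x \<le> sinh x"
proof -
  have "\<exists>y. ((\<lambda>x. sinh x - x) has_real_derivative y) (at u) \<and> 0 \<le> y" if "0 \<le> u" for u :: real
    using cosh_real_ge_1[of u]
    by (intro exI[of _ "cosh u - 1"] conjI) (auto intro!: derivative_eq_intros)
  then have "sinh 0 - 0 \<le> sinh x - x"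
    by (rule DERIV_nonneg_imp_nondecreasing[OF assms])
  then show ?thesis by simp
qed

text \<open>With \<open>p = \<parallel>x\<parallel>\<close>, \<open>q = \<parallel>y\<parallel>\<close>, \<open>c = \<langle>x, y\<rangle>\<close> this bounds \<open>cosh \<parallel>x + y\<parallel>\<close>. The left side is convex
  in \<open>c\<close> and the right side affine, so only the collinear cases \<open>c = \<plusminus> p q\<close> have to be checked.\<close>

lemma cosh_sqrt_add_le:
  fixes p q c :: real
  assumes p: "0 \<le> p" and q: "0 \<le> q" and c: "\<bar>c\<bar> \<le> p * q"
  shows "cosh (sqrt (p\<^sup>2 + q\<^sup>2 + 2 * c)) \<le> cosh p * (exp q - q) + c * (sinh p / p)"
proof (cases "p * q = 0")
  case True
  \<comment> \<open>At \<open>p = 0\<close> the quotient \<open>sinh p / p\<close> is 0 and not its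
    limit 1. This does no harm because its factor \<open>c\<close> vanishes.\<close>
  then have "c = 0" using c by linarith
  have "cosh p * 1 \<le> cosh p * (exp q - q)"
    using exp_ge_add_one_self[of q] by (intro mult_left_mono) (auto simp: algebra_simps)
  moreover have "cosh q \<le> exp q - q"
    using sinh_ge_self[OF q] cosh_plus_sinh[of q] by linarith
  ultimately show ?thesis
    using True \<open>c = 0\<close> p q by auto
next
  case False
  then have pq: "0 < p * q" and p0: "0 < p"
    using p q by (auto simp: less_le)
  \<comment> \<open>The weight that writes \<open>c\<close> as a convex combination of
    \<open>p * q\<close> and \<open>- (p * q)\<close>. The same weight combines
    \<open>(p + q)\<^sup>2\<close> and \<open>(p - q)\<^sup>2\<close> to the argument of the
    root.\<close>
  define u where "u = (p * q - c) / (2 * (p * q))"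
  have u: "0 \<le> u" "u \<le> 1"
    using c pq by (auto simp: u_def field_simps)
  have c_eq: "c = (1 - u) * (p * q) + u * (- (p * q))"
  proof -
    have "u * (2 * (p * q)) = p * q - c"
      using pq by (auto simp: u_def)
    then show ?thesis by algebra
  qed
  have sq: "(p + q)\<^sup>2 = p\<^sup>2 + q\<^sup>2 + 2 * (p * q)" "(p - q)\<^sup>2 = p\<^sup>2 + q\<^sup>2 - 2 * (p * q)"
    by (simp_all add: power2_eq_square algebra_simps)
  have "(1 - u) * (p + q)\<^sup>2 + u * (p - q)\<^sup>2 = p\<^sup>2 + q\<^sup>2 + 2 * ((1 - u) * (p * q) + u * (- (p * q)))"
    unfolding sq by algebra
  then have "cosh (sqrt (p\<^sup>2 + q\<^sup>2 + 2 * c)) = cosh (sqrt ((1 - u) *\<^sub>R (p + q)\<^sup>2 + u *\<^sub>R (p - q)\<^sup>2))"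
    unfolding c_eq[symmetric] by simp
  also have "\<dots> \<le> (1 - u) * cosh (sqrt ((p + q)\<^sup>2)) + u * cosh (sqrt ((p - q)\<^sup>2))"
    by (rule convex_onD[OF convex_on_cosh_sqrt]) (use u in auto)
  also have "\<dots> = (1 - u) * cosh (p + q) + u * cosh (p - q)"
    using p q by simp
  \<comment> \<open>The two collinear cases: after the addition formulas each reduces to
    \<open>sinh q \<ge> q\<close>.\<close>
  also have "\<dots> \<le> (1 - u) * (cosh p * (exp q - q) + q * sinh p) + u * (cosh p * (exp q - q) - q * sinh p)"
  proof (intro add_mono mult_left_mono)
    have sq0: "0 \<le> sinh q - q" using sinh_ge_self[OF q] by simp
    have ps: "0 \<le> sinh p" using p by simp
    have e: "exp q = cosh q + sinh q" by (simp add: cosh_plus_sinh)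
    have "sinh p * (sinh q - q) \<le> cosh p * (sinh q - q)"
      using sq0 sinh_le_cosh_real[of p] by (intro mult_right_mono) auto
    then show "cosh (p + q) \<le> cosh p * (exp q - q) + q * sinh p"
      by (simp add: cosh_add e algebra_simps)
    have "0 \<le> (cosh p + sinh p) * (sinh q - q)"
      using sq0 ps by simp
    then show "cosh (p - q) \<le> cosh p * (exp q - q) - q * sinh p"
      by (simp add: cosh_diff e algebra_simps)
  qed (use u in auto)
  also have "\<dots> = cosh p * (exp q - q) + c * (sinh p / p)"
  proof -
    have "q * sinh p = (p * q) * (sinh p / p)"
      using p0 by simp
    then show ?thesis
      unfolding c_eq[THEN arg_cong, of "\<lambda>c. c * (sinh p / p)"] by algebra
  qed
  finally show ?thesis .
qed

text \<open>Lagrange's remainder is at most \<open>exp q * q\<^sup>2 / 2\<close>, and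
  \<open>1 - q \<le> exp (- q)\<close> replaces the exponential by \<open>1 / (1 - q)\<close>. This
  rational form is what produces the Bernstein denominator.\<close>

lemma exp_minus_affine_le:
  fixes q :: real
  assumes "0 \<le> q" "q < 1"
  shows "exp q - q \<le> 1 + q\<^sup>2 / (2 * (1 - q))"
proof -
  obtain t where t: "\<bar>t\<bar> \<le> \<bar>q\<bar>" "exp q = (\<Sum>m<2. q ^ m / fact m) + exp t / fact 2 * q ^ 2"
    using Maclaurin_exp_le[of q 2] by auto
  have "exp t \<le> exp q"
    using t(1) assms by simp
  also have "exp q \<le> 1 / (1 - q)"
    using exp_ge_add_one_self[of "- q"] assms by (simp add: exp_minus field_simps)
  finally have "exp t * (q\<^sup>2 / 2) \<le> 1 / (1 - q) * (q\<^sup>2 / 2)"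
    by (intro mult_right_mono) auto
  then show ?thesis
    using t(2) by (simp add: numeral_2_eq_2 algebra_simps)
qed

section \<open>Exponential moments of norms of sums\<close>

lemma borel_measurable_cosh [measurable (raw)]:
  fixes f :: "'a \<Rightarrow> real"
  assumes "f \<in> borel_measurable M"
  shows "(\<lambda>x. cosh (f x)) \<in> borel_measurable M"
  using assms unfolding cosh_def by measurable

lemma borel_measurable_L2_set:
  assumes "\<And>a. a \<in> A \<Longrightarrow> f a \<in> borel_measurable M"
  shows "(\<lambda>x. L2_set (\<lambda>a. f a x) A) \<in> borel_measurable M"
  unfolding L2_set_def using assms by measurable

lemma L2_set_add_power2:
  "(L2_set (\<lambda>a. f a + g a) A)\<^sup>2 = (L2_set f A)\<^sup>2 + (L2_set g A)\<^sup>2 + 2 * (\<Sum>a\<in>A. f a * g a)"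
proof -
  have sq: "(L2_set h A)\<^sup>2 = (\<Sum>a\<in>A. (h a)\<^sup>2)" for h :: "'a \<Rightarrow> real"
    by (simp add: L2_set_def sum_nonneg)
  show ?thesis
    unfolding sq power2_sum by (simp add: sum.distrib sum_distrib_left mult.assoc)
qed

lemma abs_sum_mult_le_L2_set: "\<bar>\<Sum>a\<in>A. f a * g a\<bar> \<le> L2_set f A * L2_set g A"
proof -
  have "\<bar>\<Sum>a\<in>A. f a * g a\<bar> \<le> (\<Sum>a\<in>A. \<bar>f a\<bar> * \<bar>g a\<bar>)"
    using sum_abs[of "\<lambda>a. f a * g a" A] by (simp add: abs_mult)
  also have "\<dots> \<le> L2_set f A * L2_set g A"
    by (rule L2_set_mult_ineq)
  finally show ?thesis .
qed

lemma L2_set_sum_le: "L2_set (\<lambda>a. \<Sum>i\<in>F. f i a) A \<le> (\<Sum>i\<in>F. L2_set (f i) A)"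
proof (induction F rule: infinite_finite_induct)
  case (insert i F)
  then show ?case
    using L2_set_triangle_ineq[of "f i" "\<lambda>a. \<Sum>i\<in>F. f i a" A] by simp
qed (simp_all add: L2_set_0')

text \<open>The last sum is linear in \<open>X\<close> with coefficients depending on
  \<open>S\<close> alone, so it disappears once a centred \<open>X\<close> is integrated. Only the
  quadratic term is left.\<close>

lemma cosh_L2_set_add_le:
  fixes S X :: "'a \<Rightarrow> real"
  assumes t: "0 \<le> t" and X: "L2_set X A \<le> B" and tB: "t * B < 1"
  shows "cosh (t * L2_set (\<lambda>a. S a + X a) A)
    \<le> cosh (t * L2_set S A) * (1 + t\<^sup>2 / (2 * (1 - t * B)) * (\<Sum>a\<in>A. (X a)\<^sup>2))
      + (\<Sum>a\<in>A. t\<^sup>2 * (sinh (t * L2_set S A) / (t * L2_set S A)) * S a * X a)"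
proof -
  define p q c where "p = t * L2_set S A" and "q = t * L2_set X A"
    and "c = t\<^sup>2 * (\<Sum>a\<in>A. S a * X a)"
  have pq: "0 \<le> p" "0 \<le> q"
    using t by (auto simp: p_def q_def)
  have qB: "q \<le> t * B"
    unfolding q_def using X t by (rule mult_left_mono)
  have "\<bar>c\<bar> \<le> t\<^sup>2 * (L2_set S A * L2_set X A)"
    unfolding c_def abs_mult using abs_sum_mult_le_L2_set[of S X A]
    by (simp add: mult_left_mono)
  then have c: "\<bar>c\<bar> \<le> p * q"
    by (simp add: p_def q_def power2_eq_square ac_simps)
  have "p\<^sup>2 + q\<^sup>2 + 2 * c = (t * L2_set (\<lambda>a. S a + X a) A)\<^sup>2"
    unfolding p_def q_def c_def power_mult_distrib L2_set_add_power2 by (simp add: algebra_simps)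
  then have "cosh (t * L2_set (\<lambda>a. S a + X a) A) = cosh (sqrt (p\<^sup>2 + q\<^sup>2 + 2 * c))"
    using t by simp
  also have "\<dots> \<le> cosh p * (exp q - q) + c * (sinh p / p)"
    by (rule cosh_sqrt_add_le[OF pq c])
  also have "\<dots> \<le> cosh p * (1 + q\<^sup>2 / (2 * (1 - t * B))) + c * (sinh p / p)"
  proof -
    have "exp q - q \<le> 1 + q\<^sup>2 / (2 * (1 - q))"
      using qB tB pq by (intro exp_minus_affine_le) auto
    also have "\<dots> \<le> 1 + q\<^sup>2 / (2 * (1 - t * B))"
      using qB tB pq by (intro add_left_mono divide_left_mono) auto
    finally show ?thesis
      by (intro add_right_mono mult_left_mono) auto
  qed
  also have "q\<^sup>2 / (2 * (1 - t * B)) = t\<^sup>2 / (2 * (1 - t * B)) * (\<Sum>a\<in>A. (X a)\<^sup>2)"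
    by (simp add: q_def L2_set_def power_mult_distrib sum_nonneg)
  also have "c * (sinh p / p) = (\<Sum>a\<in>A. t\<^sup>2 * (sinh p / p) * S a * X a)"
    unfolding c_def sum_distrib_left sum_distrib_right by (intro sum.cong refl) simp
  finally show ?thesis
    unfolding p_def .
qed

lemma (in prob_space) nn_integral_cosh_L2_set_add_le:
  fixes X :: "'i \<Rightarrow> 'a \<Rightarrow> real"
  assumes X[measurable]: "\<And>a. a \<in> A \<Longrightarrow> X a \<in> borel_measurable M" and A: "finite A"
    and mean: "\<And>a. a \<in> A \<Longrightarrow> expectation (X a) = 0"
    and B: "\<And>z. z \<in> space M \<Longrightarrow> L2_set (\<lambda>a. X a z) A \<le> B"
    and v: "expectation (\<lambda>z. \<Sum>a\<in>A. (X a z)\<^sup>2) \<le> v"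
    and t: "0 \<le> t" "t * B < 1"
  shows "(\<integral>\<^sup>+z. ennreal (cosh (t * L2_set (\<lambda>a. S a + X a z) A)) \<partial>M)
    \<le> ennreal (cosh (t * L2_set S A) * (1 + t\<^sup>2 * v / (2 * (1 - t * B))))"
proof -
  define c where "c = t\<^sup>2 / (2 * (1 - t * B))"
  define b where "b = t\<^sup>2 * (sinh (t * L2_set S A) / (t * L2_set S A))"
  define g where "g z = cosh (t * L2_set S A) * (1 + c * (\<Sum>a\<in>A. (X a z)\<^sup>2)) + (\<Sum>a\<in>A. b * S a * X a z)" for z
  have le: "cosh (t * L2_set (\<lambda>a. S a + X a z) A) \<le> g z" if "z \<in> space M" for z
    unfolding g_def b_def c_def by (rule cosh_L2_set_add_le[OF t(1) B[OF that] t(2)])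
  have Xb: "\<bar>X a z\<bar> \<le> B" if "z \<in> space M" "a \<in> A" for a z
    using member_le_L2_set[OF A that(2), of "\<lambda>a. \<bar>X a z\<bar>"] B[OF that(1)]
    by (simp add: L2_set_def)
  have int_X: "integrable M (X a)" if "a \<in> A" for a
    using Xb that by (intro integrable_const_bound[where B=B]) auto
  have int_X2: "integrable M (\<lambda>z. (X a z)\<^sup>2)" if "a \<in> A" for a
    using Xb that power_mono[OF Xb, of _ a 2]
    by (intro integrable_const_bound[where B="B\<^sup>2"]) auto
  have int_g: "integrable M g"
    unfolding g_def using int_X int_X2 by auto
  have "(\<integral>\<^sup>+z. ennreal (cosh (t * L2_set (\<lambda>a. S a + X a z) A)) \<partial>M) \<le> (\<integral>\<^sup>+z. ennreal (g z) \<partial>M)"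
    using le by (intro nn_integral_mono ennreal_leI) auto
  also have "\<dots> = ennreal (\<integral>z. g z \<partial>M)"
  proof (rule nn_integral_eq_integral[OF int_g])
    show "AE z in M. 0 \<le> g z"
      using le order_trans[OF cosh_real_nonneg] by (intro AE_I2) blast
  qed
  also have "(\<integral>z. g z \<partial>M) = cosh (t * L2_set S A) * (1 + c * expectation (\<lambda>z. \<Sum>a\<in>A. (X a z)\<^sup>2))"
    unfolding g_def using int_X int_X2 mean by (simp add: prob_space)
  also have "\<dots> \<le> cosh (t * L2_set S A) * (1 + c * v)"
    using v t by (intro mult_left_mono add_left_mono) (auto simp: c_def)
  finally show ?thesis
    by (simp add: c_def ennreal_leI)
qed

text \<open>Integrating out the two coordinates of the last pair leaves the same claim on a smaller
  index set, hence the induction over arbitrary \<open>I\<close>. Injectivity of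
  \<open>\<pi>\<close> keeps these coordinates out of the earlier terms. \<open>I\<close> may exceed
  the indices in use, as it does for a sample of odd size.\<close>

lemma (in prob_space) nn_integral_cosh_pairs_le:
  fixes \<xi> :: "'i \<Rightarrow> 'a \<times> 'a \<Rightarrow> real" and \<pi> :: "nat \<Rightarrow> 'j"
  assumes \<xi>[measurable]: "\<And>a. a \<in> A \<Longrightarrow> \<xi> a \<in> borel_measurable (M \<Otimes>\<^sub>M M)" and A: "finite A"
    and mean: "\<And>a. a \<in> A \<Longrightarrow> integral\<^sup>L (M \<Otimes>\<^sub>M M) (\<xi> a) = 0"
    and B: "\<And>z. z \<in> space (M \<Otimes>\<^sub>M M) \<Longrightarrow> L2_set (\<lambda>a. \<xi> a z) A \<le> B"
    and v: "(\<integral>z. (\<Sum>a\<in>A. (\<xi> a z)\<^sup>2) \<partial>(M \<Otimes>\<^sub>M M)) \<le> v"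
    and t: "0 \<le> t" "t * B < 1"
    and "finite I" "inj_on \<pi> {..<2 * m}" "\<pi> ` {..<2 * m} \<subseteq> I"
  shows "(\<integral>\<^sup>+Y. ennreal (cosh (t * L2_set (\<lambda>a. \<Sum>k<m. \<xi> a (Y (\<pi> (2 * k)), Y (\<pi> (2 * k + 1)))) A))
      \<partial>(\<Pi>\<^sub>M i\<in>I. M)) \<le> ennreal ((1 + t\<^sup>2 * v / (2 * (1 - t * B))) ^ m)"
  using assms(8-10)
proof (induction m arbitrary: I)
  case 0
  interpret I: prob_space "\<Pi>\<^sub>M i\<in>I. M"
    by (intro prob_space_PiM prob_space_axioms)
  show ?case
    by (simp add: L2_set_0' I.emeasure_space_1)
next
  case (Suc m)
  let ?p = "\<pi> (2 * m)" and ?q = "\<pi> (2 * m + 1)"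
  let ?S = "\<lambda>Y a. \<Sum>k<m. \<xi> a (Y (\<pi> (2 * k)), Y (\<pi> (2 * k + 1)))"
  let ?\<rho> = "1 + t\<^sup>2 * v / (2 * (1 - t * B))"
  let ?f = "\<lambda>Y. ennreal (cosh (t * L2_set (?S Y) A))"
  define I' where "I' = I - {?p, ?q}"
  interpret P: pair_prob_space M M
    by unfold_locales
  interpret product_sigma_finite "\<lambda>_::'j. M"
    by unfold_locales
  have pq: "?p \<in> I" "?q \<in> I" "?p \<noteq> ?q"
    using Suc.prems inj_onD[OF Suc.prems(2), of "2 * m" "2 * m + 1"] by auto
  have I: "I = insert ?p (insert ?q I')" "?q \<notin> I'" "?p \<notin> insert ?q I'" "finite I'"
    using pq Suc.prems(1) by (auto simp: I'_def)
  have k: "\<pi> k \<in> I'" if "k < 2 * m" for k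
  proof -
    have "\<pi> k \<noteq> ?p" "\<pi> k \<noteq> ?q"
      using that inj_onD[OF Suc.prems(2), of k "2 * m"] inj_onD[OF Suc.prems(2), of k "2 * m + 1"] by auto
    moreover have "\<pi> k \<in> I"
      using that Suc.prems(3) by (auto simp: image_subset_iff)
    ultimately show ?thesis by (simp add: I'_def)
  qed
  have meas: "(\<lambda>Y. \<xi> a (Y i, Y j)) \<in> borel_measurable (\<Pi>\<^sub>M i\<in>J. M)" if "a \<in> A" "i \<in> J" "j \<in> J" for a i j J
    using that by (intro measurable_compose[OF _ \<xi>] measurable_Pair measurable_component_singleton)
  have meas_f: "?f \<in> borel_measurable (\<Pi>\<^sub>M i\<in>J. M)" if "I' \<subseteq> J" for J
    using k that
    by (intro measurable_compose[OF _ measurable_ennreal] borel_measurable_cosh borel_measurable_times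
      borel_measurable_const borel_measurable_L2_set borel_measurable_sum meas) auto
  have meas_F: "(\<lambda>Y. ennreal (cosh (t * L2_set (\<lambda>a. ?S Y a + \<xi> a (Y ?p, Y ?q)) A))) \<in> borel_measurable (\<Pi>\<^sub>M i\<in>I. M)"
    using k pq I(1)
    by (intro measurable_compose[OF _ measurable_ennreal] borel_measurable_cosh borel_measurable_times
      borel_measurable_const borel_measurable_L2_set borel_measurable_sum borel_measurable_add meas)
      auto
  have upd: "?S (Y(?q := y, ?p := x)) a = ?S Y a" for Y x y a
  proof (intro sum.cong refl)
    fix k' assume "k' \<in> {..<m}"
    then have "\<pi> (2 * k') \<noteq> ?p" "\<pi> (2 * k') \<noteq> ?q" "\<pi> (2 * k' + 1) \<noteq> ?p" "\<pi> (2 * k' + 1) \<noteq> ?q"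
      using k[of "2 * k'"] k[of "2 * k' + 1"] by (auto simp: I'_def)
    then show "\<xi> a ((Y(?q := y, ?p := x)) (\<pi> (2 * k')), (Y(?q := y, ?p := x)) (\<pi> (2 * k' + 1)))
        = \<xi> a (Y (\<pi> (2 * k')), Y (\<pi> (2 * k' + 1)))"
      by simp
  qed
  let ?G = "\<lambda>Y z. ennreal (cosh (t * L2_set (\<lambda>a. ?S Y a + \<xi> a z) A))"
  have "(\<integral>\<^sup>+Y. ennreal (cosh (t * L2_set (\<lambda>a. \<Sum>k<Suc m. \<xi> a (Y (\<pi> (2 * k)), Y (\<pi> (2 * k + 1)))) A)) \<partial>(\<Pi>\<^sub>M i\<in>I. M))
      = (\<integral>\<^sup>+Y. ?G Y (Y ?p, Y ?q) \<partial>(\<Pi>\<^sub>M i\<in>insert ?p (insert ?q I'). M))"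
    using I(1) by simp
  also have "\<dots> = (\<integral>\<^sup>+Y. (\<integral>\<^sup>+x. ?G (Y(?p := x)) ((Y(?p := x)) ?p, (Y(?p := x)) ?q) \<partial>M) \<partial>(\<Pi>\<^sub>M i\<in>insert ?q I'. M))"
    using meas_F I by (intro product_nn_integral_insert) auto
  also have "\<dots> = (\<integral>\<^sup>+Y. (\<integral>\<^sup>+y. (\<integral>\<^sup>+x. ?G (Y(?q := y, ?p := x)) ((Y(?q := y, ?p := x)) ?p, (Y(?q := y, ?p := x)) ?q) \<partial>M) \<partial>M) \<partial>(\<Pi>\<^sub>M i\<in>I'. M))"
  proof (intro product_nn_integral_insert)
    have "(\<lambda>(Y, x). Y(?p := x)) \<in> (\<Pi>\<^sub>M i\<in>insert ?q I'. M) \<Otimes>\<^sub>M M \<rightarrow>\<^sub>M (\<Pi>\<^sub>M i\<in>I. M)"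
      using measurable_add_dim[of ?p "insert ?q I'" "\<lambda>_. M"] I(1) by simp
    from measurable_compose[OF this meas_F]
    show "(\<lambda>Y. \<integral>\<^sup>+x. ?G (Y(?p := x)) ((Y(?p := x)) ?p, (Y(?p := x)) ?q) \<partial>M) \<in> borel_measurable (\<Pi>\<^sub>M i\<in>insert ?q I'. M)"
      by (intro borel_measurable_nn_integral) (simp add: case_prod_unfold)
  qed (use I in auto)
  also have "\<dots> = (\<integral>\<^sup>+Y. (\<integral>\<^sup>+y. (\<integral>\<^sup>+x. ?G Y (x, y) \<partial>M) \<partial>M) \<partial>(\<Pi>\<^sub>M i\<in>I'. M))"
    using pq by (simp only: upd) simp
  also have "\<dots> = (\<integral>\<^sup>+Y. (\<integral>\<^sup>+z. ?G Y z \<partial>(M \<Otimes>\<^sub>M M)) \<partial>(\<Pi>\<^sub>M i\<in>I'. M))"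
  proof (intro nn_integral_cong P.nn_integral_snd)
    fix Y
    show "?G Y \<in> borel_measurable (M \<Otimes>\<^sub>M M)"
      by (intro measurable_compose[OF _ measurable_ennreal] borel_measurable_cosh borel_measurable_times
        borel_measurable_const borel_measurable_L2_set borel_measurable_add \<xi>)
  qed
  also have "\<dots> \<le> (\<integral>\<^sup>+Y. ?f Y * ennreal ?\<rho> \<partial>(\<Pi>\<^sub>M i\<in>I'. M))"
  proof (intro nn_integral_mono)
    fix Y
    have "(\<integral>\<^sup>+z. ?G Y z \<partial>(M \<Otimes>\<^sub>M M)) \<le> ennreal (cosh (t * L2_set (?S Y) A) * ?\<rho>)"
      using mean v B t A by (intro P.nn_integral_cosh_L2_set_add_le \<xi>) auto
    then show "(\<integral>\<^sup>+z. ?G Y z \<partial>(M \<Otimes>\<^sub>M M)) \<le> ?f Y * ennreal ?\<rho>"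
      by (simp add: ennreal_mult')
  qed
  also have "\<dots> = (\<integral>\<^sup>+Y. ?f Y \<partial>(\<Pi>\<^sub>M i\<in>I'. M)) * ennreal ?\<rho>"
    by (intro nn_integral_multc meas_f) simp
  also have "\<dots> \<le> ennreal (?\<rho> ^ m) * ennreal ?\<rho>"
    using Suc.prems(2) I(4) k
    by (intro mult_right_mono Suc.IH) (auto intro: inj_on_subset)
  also have "\<dots> = ennreal (?\<rho> ^ Suc m)"
  proof -
    have "0 \<le> v"
      using v by (rule order_trans[rotated]) (auto intro!: Bochner_Integration.integral_nonneg sum_nonneg)
    then have "0 \<le> ?\<rho>"
      using t by auto
    then show ?thesis
      by (simp add: ennreal_mult' mult.commute)
  qed
  finally show ?case .
qed

section \<open>Averaging over permutations\<close>

lemma sum_permutes_pair_eq: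
  fixes g :: "'a \<Rightarrow> 'a \<Rightarrow> real"
  assumes "a \<in> I" "b \<in> I" "a \<noteq> b" "c \<in> I" "d \<in> I" "c \<noteq> d"
  shows "(\<Sum>\<pi> | \<pi> permutes I. g (\<pi> c) (\<pi> d)) = (\<Sum>\<pi> | \<pi> permutes I. g (\<pi> a) (\<pi> b))"
proof -
  \<comment> \<open>The first transposition sends \<open>a\<close> to \<open>c\<close>. The second
    sends the new position of \<open>b\<close>, which is not \<open>c\<close>, to \<open>d\<close>,
    and leaves \<open>c\<close> alone.\<close>
  define \<sigma> where "\<sigma> = Transposition.transpose (Transposition.transpose a c b) d \<circ> Transposition.transpose a c"
  have "Transposition.transpose a c b \<in> I"
    using assms by (auto simp: Transposition.transpose_def)
  then have \<sigma>: "\<sigma> permutes I"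
    unfolding \<sigma>_def using assms by (intro permutes_compose permutes_swap_id)
  have "\<sigma> a = c" "\<sigma> b = d"
    using assms by (auto simp: \<sigma>_def Transposition.transpose_def)
  then show ?thesis
    using sum_permutations_compose_right[OF \<sigma>, of "\<lambda>\<pi>. g (\<pi> a) (\<pi> b)"] by simp
qed

text \<open>The sum over permutations is the same for every ordered pair of positions, so it may be
  summed over all pairs. After exchanging the sums, each permutation merely reindexes the full
  double sum.\<close>

lemma sum_permutes_pair:
  fixes g :: "'a \<Rightarrow> 'a \<Rightarrow> real"
  assumes I: "finite I" and ab: "a \<in> I" "b \<in> I" "a \<noteq> b"
  shows "real (card I) * (real (card I) - 1) * (\<Sum>\<pi> | \<pi> permutes I. g (\<pi> a) (\<pi> b))
    = fact (card I) * (\<Sum>i\<in>I. \<Sum>j\<in>I - {i}. g i j)"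
proof -
  have inv: "(\<Sum>i\<in>I. \<Sum>j\<in>I - {i}. g (\<pi> i) (\<pi> j)) = (\<Sum>i\<in>I. \<Sum>j\<in>I - {i}. g i j)"
    if \<pi>: "\<pi> permutes I" for \<pi>
  proof -
    have "(\<Sum>j\<in>I - {i}. g (\<pi> i) (\<pi> j)) = (\<Sum>j\<in>I - {\<pi> i}. g (\<pi> i) j)" if "i \<in> I" for i
    proof (rule sum.reindex_bij_betw)
      show "bij_betw \<pi> (I - {i}) (I - {\<pi> i})"
        using permutes_image[OF \<pi>] permutes_inj[OF \<pi>]
        by (auto simp: bij_betw_def inj_on_def image_set_diff)
    qed
    then have "(\<Sum>i\<in>I. \<Sum>j\<in>I - {i}. g (\<pi> i) (\<pi> j)) = (\<Sum>i\<in>I. \<Sum>j\<in>I - {\<pi> i}. g (\<pi> i) j)"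
      by simp
    also have "\<dots> = (\<Sum>i\<in>I. \<Sum>j\<in>I - {i}. g i j)"
      by (rule sum.reindex_bij_betw[OF permutes_imp_bij[OF \<pi>]])
    finally show ?thesis .
  qed
  have "real (card I) * (real (card I) - 1) * (\<Sum>\<pi> | \<pi> permutes I. g (\<pi> a) (\<pi> b))
      = (\<Sum>i\<in>I. \<Sum>j\<in>I - {i}. \<Sum>\<pi> | \<pi> permutes I. g (\<pi> a) (\<pi> b))"
  proof -
    have "real (card (I - {i})) = real (card I) - 1" if "i \<in> I" for i
      using that I card_gt_0_iff[of I] by (subst card_Diff_singleton) (auto simp: of_nat_diff Suc_leI)
    then show ?thesis by simp
  qed
  also have "\<dots> = (\<Sum>i\<in>I. \<Sum>j\<in>I - {i}. \<Sum>\<pi> | \<pi> permutes I. g (\<pi> i) (\<pi> j))"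
    using ab by (intro sum.cong refl sum_permutes_pair_eq) auto
  also have "\<dots> = (\<Sum>\<pi> | \<pi> permutes I. \<Sum>i\<in>I. \<Sum>j\<in>I - {i}. g (\<pi> i) (\<pi> j))"
    by (simp only: sum.swap[of _ "{\<pi>. \<pi> permutes I}"])
  also have "\<dots> = fact (card I) * (\<Sum>i\<in>I. \<Sum>j\<in>I - {i}. g i j)"
    using inv card_permutations[OF refl I] by simp
  finally show ?thesis .
qed

lemma convex_on_cosh_mult: "convex_on UNIV (\<lambda>x::real. cosh (t * x))"
proof (rule f''_ge0_imp_convex)
  show "((\<lambda>x. cosh (t * x)) has_real_derivative t * sinh (t * x)) (at x)" for x :: real
    by (auto intro!: derivative_eq_intros)
  show "((\<lambda>x. t * sinh (t * x)) has_real_derivative t * (t * cosh (t * x))) (at x)" for x :: real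
    by (auto intro!: derivative_eq_intros)
qed (simp_all flip: mult.assoc)

text \<open>Hoeffding's device: a U-statistic is the average over all permutations of the sample of sums of
  independent terms, each formed from disjoint pairs.\<close>

lemma (in prob_space) nn_integral_cosh_U_statistic_le:
  fixes \<xi> :: "'i \<Rightarrow> 'a \<times> 'a \<Rightarrow> real" and s :: nat
  assumes \<xi>[measurable]: "\<And>a. a \<in> A \<Longrightarrow> \<xi> a \<in> borel_measurable (M \<Otimes>\<^sub>M M)" and A: "finite A"
    and mean: "\<And>a. a \<in> A \<Longrightarrow> integral\<^sup>L (M \<Otimes>\<^sub>M M) (\<xi> a) = 0"
    and B: "\<And>z. z \<in> space (M \<Otimes>\<^sub>M M) \<Longrightarrow> L2_set (\<lambda>a. \<xi> a z) A \<le> B"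
    and v: "(\<integral>z. (\<Sum>a\<in>A. (\<xi> a z)\<^sup>2) \<partial>(M \<Otimes>\<^sub>M M)) \<le> v"
    and t: "0 \<le> t" "t * B < 1" and s: "2 \<le> s"
  shows "(\<integral>\<^sup>+Y. ennreal (cosh (real (s div 2) * t *
        L2_set (\<lambda>a. (\<Sum>i<s. \<Sum>j\<in>{..<s} - {i}. \<xi> a (Y i, Y j)) / (real s * (real s - 1))) A))
      \<partial>(\<Pi>\<^sub>M i\<in>{..<s}. M)) \<le> ennreal ((1 + t\<^sup>2 * v / (2 * (1 - t * B))) ^ (s div 2))"
proof -
  define m where "m = s div 2"
  have m: "0 < m" "2 * m \<le> s"
    using s by (auto simp: m_def)
  define PS where "PS = {\<pi>. \<pi> permutes {..<s}}"
  have PS: "finite PS" "card PS = fact s" "PS \<noteq> {}"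
    using card_permutations[of "{..<s}" s] finite_permutations[of "{..<s}"] permutes_id[of "{..<s}"]
    by (auto simp: PS_def intro: permutes_id)
  let ?U = "\<lambda>Y a. (\<Sum>i<s. \<Sum>j\<in>{..<s} - {i}. \<xi> a (Y i, Y j)) / (real s * (real s - 1))"
  let ?V = "\<lambda>\<pi> Y a. \<Sum>k<m. \<xi> a (Y (\<pi> (2 * k)), Y (\<pi> (2 * k + 1)))"
  let ?\<rho> = "(1 + t\<^sup>2 * v / (2 * (1 - t * B))) ^ m"
  \<comment> \<open>Each of the \<open>m\<close> pairs of positions averages to the whole
    U-statistic, which explains the factor \<open>m\<close>.\<close>
  have U: "real m * ?U Y a = (\<Sum>\<pi>\<in>PS. ?V \<pi> Y a / fact s)" for Y a
  proof -
    have "(\<Sum>\<pi>\<in>PS. \<xi> a (Y (\<pi> (2 * k)), Y (\<pi> (2 * k + 1))) / fact s) = ?U Y a" if "k < m" for k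
    proof -
      have "real s * (real s - 1) * (\<Sum>\<pi>\<in>PS. \<xi> a (Y (\<pi> (2 * k)), Y (\<pi> (2 * k + 1))))
          = fact s * (\<Sum>i<s. \<Sum>j\<in>{..<s} - {i}. \<xi> a (Y i, Y j))"
        using sum_permutes_pair[of "{..<s}" "2 * k" "2 * k + 1" "\<lambda>i j. \<xi> a (Y i, Y j)"] that m
        by (simp add: PS_def)
      then show ?thesis
        using s by (simp add: field_simps flip: sum_divide_distrib)
    qed
    then have "real m * ?U Y a = (\<Sum>k<m. \<Sum>\<pi>\<in>PS. \<xi> a (Y (\<pi> (2 * k)), Y (\<pi> (2 * k + 1))) / fact s)"
      by simp
    also have "\<dots> = (\<Sum>\<pi>\<in>PS. ?V \<pi> Y a / fact s)"
      by (subst sum.swap) (simp add: sum_divide_distrib)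
    finally show ?thesis .
  qed
  have le: "cosh (real m * t * L2_set (?U Y) A) \<le> (\<Sum>\<pi>\<in>PS. 1 / fact s * cosh (t * L2_set (?V \<pi> Y) A))" for Y
  proof -
    have "real m * L2_set (?U Y) A = L2_set (\<lambda>a. \<Sum>\<pi>\<in>PS. ?V \<pi> Y a / fact s) A"
      unfolding U[symmetric] by (rule L2_set_right_distrib) simp
    also have "\<dots> \<le> (\<Sum>\<pi>\<in>PS. L2_set (\<lambda>a. ?V \<pi> Y a / fact s) A)"
      by (rule L2_set_sum_le)
    also have "\<dots> = (\<Sum>\<pi>\<in>PS. (1 / fact s) *\<^sub>R L2_set (?V \<pi> Y) A)"
      by (simp add: L2_set_right_distrib[of "1 / fact s", simplified])
    finally have "t * (real m * L2_set (?U Y) A) \<le> t * (\<Sum>\<pi>\<in>PS. (1 / fact s) *\<^sub>R L2_set (?V \<pi> Y) A)"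
      using t(1) by (rule mult_left_mono)
    then have "cosh (real m * t * L2_set (?U Y) A) \<le> cosh (t * (\<Sum>\<pi>\<in>PS. (1 / fact s) *\<^sub>R L2_set (?V \<pi> Y) A))"
      using t(1) by (subst cosh_real_nonneg_le_iff) (auto simp: ac_simps intro!: mult_nonneg_nonneg sum_nonneg)
    \<comment> \<open>Jensen's inequality with uniform weights. The permuted sums are dependent on
      each other, but only their individual moments are needed.\<close>
    also have "\<dots> \<le> (\<Sum>\<pi>\<in>PS. 1 / fact s * cosh (t * L2_set (?V \<pi> Y) A))"
      using PS by (intro convex_on_sum[OF _ _ convex_on_cosh_mult]) auto
    finally show ?thesis .
  qed
  have meas: "(\<lambda>Y. \<xi> a (Y i, Y j)) \<in> borel_measurable (\<Pi>\<^sub>M i\<in>{..<s}. M)" if "a \<in> A" "i < s" "j < s" for a i j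
    using that by (intro measurable_compose[OF _ \<xi>] measurable_Pair measurable_component_singleton) auto
  have \<pi>: "\<pi> k < s" if "\<pi> \<in> PS" "k < s" for \<pi> k
    using permutes_in_image[of \<pi> "{..<s}" k] that by (simp add: PS_def)
  have meas_V: "(\<lambda>Y. cosh (t * L2_set (?V \<pi> Y) A)) \<in> borel_measurable (\<Pi>\<^sub>M i\<in>{..<s}. M)" if "\<pi> \<in> PS" for \<pi>
    using m \<pi>[OF that]
    by (intro borel_measurable_cosh borel_measurable_times borel_measurable_const
      borel_measurable_L2_set borel_measurable_sum meas) auto
  have "(\<integral>\<^sup>+Y. ennreal (cosh (real m * t * L2_set (?U Y) A)) \<partial>(\<Pi>\<^sub>M i\<in>{..<s}. M))
      \<le> (\<integral>\<^sup>+Y. (\<Sum>\<pi>\<in>PS. ennreal (1 / fact s) * ennreal (cosh (t * L2_set (?V \<pi> Y) A))) \<partial>(\<Pi>\<^sub>M i\<in>{..<s}. M))"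
  proof (intro nn_integral_mono)
    fix Y
    have "ennreal (cosh (real m * t * L2_set (?U Y) A))
        \<le> ennreal (\<Sum>\<pi>\<in>PS. 1 / fact s * cosh (t * L2_set (?V \<pi> Y) A))"
      by (intro ennreal_leI le)
    also have "\<dots> = (\<Sum>\<pi>\<in>PS. ennreal (1 / fact s) * ennreal (cosh (t * L2_set (?V \<pi> Y) A)))"
      by (subst sum_ennreal[symmetric]) (auto simp: ennreal_mult'[symmetric])
    finally show "ennreal (cosh (real m * t * L2_set (?U Y) A))
        \<le> (\<Sum>\<pi>\<in>PS. ennreal (1 / fact s) * ennreal (cosh (t * L2_set (?V \<pi> Y) A)))" .
  qed
  also have "\<dots> = (\<Sum>\<pi>\<in>PS. \<integral>\<^sup>+Y. ennreal (1 / fact s) * ennreal (cosh (t * L2_set (?V \<pi> Y) A)) \<partial>(\<Pi>\<^sub>M i\<in>{..<s}. M))"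
    using meas_V by (intro nn_integral_sum) auto
  also have "\<dots> = (\<Sum>\<pi>\<in>PS. ennreal (1 / fact s) * (\<integral>\<^sup>+Y. ennreal (cosh (t * L2_set (?V \<pi> Y) A)) \<partial>(\<Pi>\<^sub>M i\<in>{..<s}. M)))"
    using meas_V by (intro sum.cong refl nn_integral_cmult) auto
  also have "\<dots> \<le> (\<Sum>\<pi>\<in>PS. ennreal (1 / fact s) * ennreal ?\<rho>)"
  proof (intro sum_mono mult_left_mono nn_integral_cosh_pairs_le[OF \<xi> A mean B v t])
    fix \<pi> assume "\<pi> \<in> PS"
    then show "inj_on \<pi> {..<2 * m}" "\<pi> ` {..<2 * m} \<subseteq> {..<s}"
      using \<pi> m by (auto simp: PS_def permutes_inj_on)
  qed auto
  also have "\<dots> = ennreal (\<Sum>\<pi>\<in>PS. 1 / fact s * ?\<rho>)"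
  proof -
    interpret P: pair_prob_space M M
      by unfold_locales
    have "0 \<le> v"
      using v by (rule order_trans[rotated]) (auto intro!: Bochner_Integration.integral_nonneg sum_nonneg)
    then have "0 \<le> ?\<rho>"
      using t by auto
    then show ?thesis
      by (subst sum_ennreal[symmetric]) (auto simp: ennreal_mult'[symmetric])
  qed
  also have "(\<Sum>\<pi>\<in>PS. 1 / fact s * ?\<rho>) = ?\<rho>"
    using PS by simp
  finally show ?thesis
    by (simp add: m_def)
qed

text \<open>Markov's inequality for cosh of the norm, with the moment bound above and
  \<open>1 + x \<le> exp x\<close>.\<close>

lemma (in prob_space) U_statistic_Bernstein:
  fixes \<xi> :: "'i \<Rightarrow> 'a \<times> 'a \<Rightarrow> real" and s :: nat
  assumes \<xi>[measurable]: "\<And>a. a \<in> A \<Longrightarrow> \<xi> a \<in> borel_measurable (M \<Otimes>\<^sub>M M)" and A: "finite A"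
    and mean: "\<And>a. a \<in> A \<Longrightarrow> integral\<^sup>L (M \<Otimes>\<^sub>M M) (\<xi> a) = 0"
    and B: "\<And>z. z \<in> space (M \<Otimes>\<^sub>M M) \<Longrightarrow> L2_set (\<lambda>a. \<xi> a z) A \<le> B"
    and v: "(\<integral>z. (\<Sum>a\<in>A. (\<xi> a z)\<^sup>2) \<partial>(M \<Otimes>\<^sub>M M)) \<le> v" "0 < v"
    and s: "2 \<le> s" and \<epsilon>: "0 \<le> \<epsilon>"
  shows "measure (\<Pi>\<^sub>M i\<in>{..<s}. M) {Y \<in> space (\<Pi>\<^sub>M i\<in>{..<s}. M).
      \<epsilon> < L2_set (\<lambda>a. (\<Sum>i<s. \<Sum>j\<in>{..<s} - {i}. \<xi> a (Y i, Y j)) / (real s * (real s - 1))) A}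
    \<le> 2 * exp (- (real (s div 2) * \<epsilon>\<^sup>2 / (2 * (v + B * \<epsilon>))))"
proof -
  define m where "m = s div 2"
  let ?P = "\<Pi>\<^sub>M i\<in>{..<s}. M"
  let ?U = "\<lambda>Y. L2_set (\<lambda>a. (\<Sum>i<s. \<Sum>j\<in>{..<s} - {i}. \<xi> a (Y i, Y j)) / (real s * (real s - 1))) A"
  interpret P: prob_space ?P
    by (intro prob_space_PiM prob_space_axioms)
  interpret MM: pair_prob_space M M
    by unfold_locales
  have "0 \<le> B"
    using MM.not_empty B order_trans[OF L2_set_nonneg] by blast
  define w where "w = v + B * \<epsilon>"
  \<comment> \<open>Bernstein's choice of parameter. It gives \<open>1 - t * B = v / w\<close>, so
    that the moment exponent becomes \<open>\<epsilon>\<^sup>2 / (2 * w)\<close> per pair.\<close>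
  define t where "t = \<epsilon> / w"
  have w: "0 < w"
    using v \<open>0 \<le> B\<close> \<epsilon> by (simp add: w_def add_pos_nonneg)
  have t: "0 \<le> t" "t * B < 1"
    using w \<epsilon> v by (auto simp: t_def w_def field_simps)
  have tB: "1 - t * B = v / w"
    using w by (simp add: t_def w_def field_simps)
  have tv: "t\<^sup>2 * v / (2 * (1 - t * B)) = \<epsilon>\<^sup>2 / (2 * w)"
    using w v unfolding tB by (simp add: t_def field_simps power2_eq_square)
  have mt: "0 \<le> real m * t" using t by simp
  have meas: "(\<lambda>Y. \<xi> a (Y i, Y j)) \<in> borel_measurable ?P" if "a \<in> A" "i < s" "j < s" for a i j
    using that by (intro measurable_compose[OF _ \<xi>] measurable_Pair measurable_component_singleton) auto
  have [measurable]: "?U \<in> borel_measurable ?P"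
    by (intro borel_measurable_L2_set borel_measurable_divide borel_measurable_sum borel_measurable_const meas) auto
  let ?E = "{Y \<in> space ?P. \<epsilon> < ?U Y}"
  have "ennreal (cosh (real m * t * \<epsilon>)) * emeasure ?P ?E
      = (\<integral>\<^sup>+Y. ennreal (cosh (real m * t * \<epsilon>)) * indicator ?E Y \<partial>?P)"
    by (intro nn_integral_cmult_indicator[symmetric]) measurable
  also have "\<dots> \<le> (\<integral>\<^sup>+Y. ennreal (cosh (real m * t * ?U Y)) \<partial>?P)"
    using mt \<epsilon>
    by (intro nn_integral_mono)
      (auto split: split_indicator intro!: ennreal_leI mult_left_mono simp: cosh_real_nonneg_le_iff)
  also have "\<dots> \<le> ennreal ((1 + \<epsilon>\<^sup>2 / (2 * w)) ^ m)"
    unfolding m_def tv[symmetric] by (rule nn_integral_cosh_U_statistic_le[OF \<xi> A mean B v(1) t s])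
  finally have "cosh (real m * t * \<epsilon>) * measure ?P ?E \<le> (1 + \<epsilon>\<^sup>2 / (2 * w)) ^ m"
    using w by (simp add: P.emeasure_eq_measure ennreal_mult'[symmetric])
  also have "\<dots> \<le> exp (\<epsilon>\<^sup>2 / (2 * w)) ^ m"
    using w exp_ge_add_one_self[of "\<epsilon>\<^sup>2 / (2 * w)"] by (intro power_mono) auto
  also have "\<dots> = exp (real m * \<epsilon>\<^sup>2 / (2 * w))"
    by (simp flip: exp_of_nat_mult)
  finally have *: "cosh (real m * t * \<epsilon>) * measure ?P ?E \<le> exp (real m * \<epsilon>\<^sup>2 / (2 * w))" .
  \<comment> \<open>The gain in the exponent is twice the loss from the moment bound; one half
    cancels the loss and the other half is the tail.\<close>
  have mte: "real m * t * \<epsilon> = real m * \<epsilon>\<^sup>2 / (2 * w) + real m * \<epsilon>\<^sup>2 / (2 * w)"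
    using w by (simp add: t_def field_simps power2_eq_square)
  have "exp (real m * t * \<epsilon>) / 2 * measure ?P ?E \<le> cosh (real m * t * \<epsilon>) * measure ?P ?E"
    by (intro mult_right_mono) (auto simp: cosh_def)
  with * have "exp (real m * t * \<epsilon>) / 2 * measure ?P ?E \<le> exp (real m * \<epsilon>\<^sup>2 / (2 * w))"
    by (rule order_trans[rotated])
  then have "exp (real m * \<epsilon>\<^sup>2 / (2 * w)) * (exp (real m * \<epsilon>\<^sup>2 / (2 * w)) * measure ?P ?E)
      \<le> exp (real m * \<epsilon>\<^sup>2 / (2 * w)) * 2"
    unfolding mte exp_add by (simp add: mult.assoc)
  then have "exp (real m * \<epsilon>\<^sup>2 / (2 * w)) * measure ?P ?E \<le> 2"
    by (subst (asm) mult_le_cancel_left_pos) auto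
  then show ?thesis
    by (simp add: exp_minus field_simps m_def w_def)
qed

section \<open>Projections and orthonormal bases in Hilbert spaces\<close>

lemma subspace_closure:
  fixes S :: "'h::real_normed_vector set"
  assumes S: "subspace S"
  shows "subspace (closure S)"
proof (rule subspaceI)
  show "0 \<in> closure S"
    using subspace_0[OF S] closure_subset by blast
  show "x + y \<in> closure S" if "x \<in> closure S" "y \<in> closure S" for x y
  proof -
    obtain f g where "\<And>n. f n \<in> S" "f \<longlonglongrightarrow> x" "\<And>n. g n \<in> S" "g \<longlonglongrightarrow> y"
      using \<open>x \<in> closure S\<close> \<open>y \<in> closure S\<close> by (auto simp: closure_sequential)
    then show ?thesis
      unfolding closure_sequential using subspace_add[OF S]
      by (intro exI[of _ "\<lambda>n. f n + g n"]) (auto intro: tendsto_add)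
  qed
  show "c *\<^sub>R x \<in> closure S" if "x \<in> closure S" for c x
  proof -
    obtain f where "\<And>n. f n \<in> S" "f \<longlonglongrightarrow> x"
      using \<open>x \<in> closure S\<close> by (auto simp: closure_sequential)
    then show ?thesis
      unfolding closure_sequential using subspace_scale[OF S]
      by (intro exI[of _ "\<lambda>n. c *\<^sub>R f n"]) (auto intro: tendsto_intros)
  qed
qed

text \<open>A minimising sequence is Cauchy by the parallelogram law, and its limit is the nearest
  point.\<close>

lemma closed_subspace_projection:
  fixes S :: "'h::{real_inner,banach} set"
  assumes cl: "closed S" and S: "subspace S"
  obtains p where "p \<in> S" "\<And>y. y \<in> S \<Longrightarrow> (x - p) \<bullet> y = 0"
proof -
  define d where "d = Inf ((\<lambda>y. (norm (x - y))\<^sup>2) ` S)"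
  have bdd: "bdd_below ((\<lambda>y. (norm (x - y))\<^sup>2) ` S)"
    by (rule bdd_belowI2[of _ 0]) simp
  have d_le: "d \<le> (norm (x - y))\<^sup>2" if "y \<in> S" for y
    unfolding d_def using that bdd by (rule cINF_lower[rotated])
  have "\<exists>y\<in>S. (norm (x - y))\<^sup>2 < d + inverse (real (Suc n))" for n
    using cInf_lessD[of "(\<lambda>y. (norm (x - y))\<^sup>2) ` S" "d + inverse (real (Suc n))"] subspace_0[OF S]
    by (auto simp: d_def[symmetric])
  then obtain y where y: "\<And>n. y n \<in> S" "\<And>n. (norm (x - y n))\<^sup>2 < d + inverse (real (Suc n))"
    by metis
  have par: "(norm (y m - y n))\<^sup>2 \<le> 2 * inverse (real (Suc m)) + 2 * inverse (real (Suc n))" for m n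
  proof -
    \<comment> \<open>The midpoint is in \<open>S\<close> and hence no closer to \<open>x\<close>
      than the infimum, which forces \<open>y m\<close> and \<open>y n\<close> together.\<close>
    have "(1/2) *\<^sub>R (y m + y n) \<in> S"
      using y(1) S by (intro subspace_scale subspace_add)
    then have "4 * d \<le> 4 * (norm (x - (1/2) *\<^sub>R (y m + y n)))\<^sup>2"
      using d_le by simp
    also have "\<dots> = (norm ((x - y m) + (x - y n)))\<^sup>2"
      by (simp add: power2_norm_eq_inner algebra_simps inner_commute)
    finally have "4 * d \<le> (norm ((x - y m) + (x - y n)))\<^sup>2" .
    moreover have "(norm (y m - y n))\<^sup>2 + (norm ((x - y m) + (x - y n)))\<^sup>2
        = 2 * (norm (x - y m))\<^sup>2 + 2 * (norm (x - y n))\<^sup>2"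
      by (simp add: power2_norm_eq_inner algebra_simps inner_commute)
    ultimately show ?thesis
      using y(2)[of m] y(2)[of n] by linarith
  qed
  have "Cauchy y"
  proof (rule CauchyI)
    fix \<epsilon> :: real assume "0 < \<epsilon>"
    then obtain N where N: "inverse (real (Suc N)) < \<epsilon>\<^sup>2 / 4"
      using reals_Archimedean[of "\<epsilon>\<^sup>2 / 4"] by auto
    have "norm (y m - y n) < \<epsilon>" if "m \<ge> N" "n \<ge> N" for m n
    proof -
      have inv: "inverse (real (Suc k)) \<le> inverse (real (Suc N))" if "k \<ge> N" for k
        using that by (intro le_imp_inverse_le) auto
      then have "(norm (y m - y n))\<^sup>2 < \<epsilon>\<^sup>2"
        using par[of m n] N inv[OF that(1)] inv[OF that(2)] by linarith
      then show ?thesis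
        using \<open>0 < \<epsilon>\<close> by (simp add: power2_less_imp_less)
    qed
    then show "\<exists>M. \<forall>m\<ge>M. \<forall>n\<ge>M. norm (y m - y n) < \<epsilon>"
      by blast
  qed
  then obtain p where p: "y \<longlonglongrightarrow> p"
    using Cauchy_convergent convergent_def by blast
  have "p \<in> S"
    using cl y(1) p closed_sequentially by blast
  have "(\<lambda>n. (norm (x - y n))\<^sup>2) \<longlonglongrightarrow> (norm (x - p))\<^sup>2"
    by (intro tendsto_intros p)
  moreover have "(\<lambda>n. d + inverse (real (Suc n))) \<longlonglongrightarrow> d + 0"
    by (intro tendsto_intros LIMSEQ_inverse_real_of_nat)
  ultimately have "(norm (x - p))\<^sup>2 \<le> d + 0"
    by (rule LIMSEQ_le) (use y(2) in \<open>blast intro: less_imp_le\<close>)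
  then have min: "(norm (x - p))\<^sup>2 \<le> d"
    by simp
  have "(x - p) \<bullet> y = 0" if "y \<in> S" for y
  proof (cases "y = 0")
    case False
    \<comment> \<open>The minimiser of the distance from \<open>x\<close> along the line
      \<open>p + t y\<close>. As \<open>p\<close> is already nearest, it must be 0.\<close>
    define t where "t = ((x - p) \<bullet> y) / (y \<bullet> y)"
    have ty: "t * (y \<bullet> y) = (x - p) \<bullet> y"
      using False by (simp add: t_def)
    have "p + t *\<^sub>R y \<in> S"
      using \<open>p \<in> S\<close> that S by (intro subspace_add subspace_scale)
    then have "(norm (x - p))\<^sup>2 \<le> (norm (x - (p + t *\<^sub>R y)))\<^sup>2"
      using min d_le order_trans by blast
    also have "\<dots> = (norm (x - p))\<^sup>2 - 2 * t * ((x - p) \<bullet> y) + t * (t * (y \<bullet> y))"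
      by (simp add: power2_norm_eq_inner algebra_simps inner_commute)
    finally have "t * ((x - p) \<bullet> y) \<le> 0"
      unfolding ty by simp
    then have "t * (t * (y \<bullet> y)) \<le> 0"
      unfolding ty .
    then have "t\<^sup>2 * (y \<bullet> y) \<le> 0"
      by (simp add: power2_eq_square mult.assoc)
    moreover have "0 < y \<bullet> y"
      using False by simp
    ultimately have "t\<^sup>2 \<le> 0"
      by (simp add: mult_le_0_iff)
    then show ?thesis
      using ty by simp
  qed simp
  with \<open>p \<in> S\<close> show ?thesis
    by (rule that)
qed

text \<open>Existence and uniqueness are both stated because \<open>centred_adj\<close> is a
  definite description. The representing vector is a multiple of a vector orthogonal to the
  kernel.\<close>

theorem Riesz_representation:
  fixes \<phi> :: "'h::{real_inner,banach} \<Rightarrow> real"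
  assumes "bounded_linear \<phi>"
  shows "\<exists>!h. \<forall>f. f \<bullet> h = \<phi> f"
proof -
  interpret bounded_linear \<phi> by fact
  have "\<exists>h. \<forall>f. f \<bullet> h = \<phi> f"
  proof (cases "\<forall>f. \<phi> f = 0")
    case True
    then show ?thesis by (intro exI[of _ 0]) simp
  next
    case False
    then obtain x where x: "\<phi> x \<noteq> 0" by blast
    let ?S = "{f. \<phi> f = 0}"
    have "subspace ?S"
      by (auto intro!: subspaceI simp: zero add scale)
    moreover have "closed ?S"
      by (intro closed_Collect_eq continuous_on continuous_on_id continuous_on_const)
    ultimately obtain p where p: "\<phi> p = 0" "\<And>y. \<phi> y = 0 \<Longrightarrow> (x - p) \<bullet> y = 0"
      using closed_subspace_projection[of ?S x] by auto
    define z where "z = x - p"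
    have z: "\<phi> z \<noteq> 0" "z \<noteq> 0"
      using x p(1) zero by (auto simp: z_def diff)
    have "f \<bullet> ((\<phi> z / (z \<bullet> z)) *\<^sub>R z) = \<phi> f" for f
    proof -
      have "\<phi> (f - (\<phi> f / \<phi> z) *\<^sub>R z) = 0"
        using z by (simp add: diff scale)
      then have "z \<bullet> (f - (\<phi> f / \<phi> z) *\<^sub>R z) = 0"
        unfolding z_def by (rule p(2))
      then show ?thesis
        using z by (simp add: inner_diff_right inner_commute field_simps)
    qed
    then show ?thesis by blast
  qed
  moreover have "h = h'" if "\<forall>f. f \<bullet> h = \<phi> f" "\<forall>f. f \<bullet> h' = \<phi> f" for h h'
    using that by (metis inner_commute vector_eq_rdot)
  ultimately show ?thesis by blast
qed

section \<open>Orthonormal expansions\<close>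

lemma inner_orthonormal_sum:
  fixes F :: "'h::real_inner set"
  assumes "finite F" "pairwise orthogonal F" "\<And>e. e \<in> F \<Longrightarrow> norm e = 1" "e \<in> F"
  shows "(\<Sum>e'\<in>F. c e' *\<^sub>R e') \<bullet> e = c e"
proof -
  have "(\<Sum>e'\<in>F. c e' *\<^sub>R e') \<bullet> e = (\<Sum>e'\<in>F. if e' = e then c e else 0)"
    unfolding inner_sum_left
  proof (intro sum.cong refl)
    fix e' assume "e' \<in> F"
    then show "(c e' *\<^sub>R e') \<bullet> e = (if e' = e then c e else 0)"
      using assms pairwiseD[OF assms(2), of e' e] by (auto simp: orthogonal_def dot_square_norm)
  qed
  then show ?thesis
    using assms by simp
qed

text \<open>Some finite combination of elements of \<open>B\<close> is close to \<open>u\<close>. A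
  partial sum over any larger finite set is an orthogonal projection and therefore at least as
  close. Unordered summation allows \<open>B\<close> to be uncountable.\<close>

lemma orthonormal_expansion_has_sum:
  fixes B :: "'h::real_inner set"
  assumes orth: "pairwise orthogonal B" and nrm: "\<And>e. e \<in> B \<Longrightarrow> norm e = 1"
    and u: "u \<in> closure (span B)"
  shows "((\<lambda>e. (u \<bullet> e) *\<^sub>R e) has_sum u) B"
  unfolding has_sum_def tendsto_iff eventually_finite_subsets_at_top
proof (intro allI impI)
  fix \<epsilon> :: real assume "0 < \<epsilon>"
  with u obtain y where y: "y \<in> span B" "dist y u < \<epsilon>"
    unfolding closure_approachable by blast
  then obtain X r where X: "finite X" "X \<subseteq> B" "y = (\<Sum>a\<in>X. r a *\<^sub>R a)"
    by (auto simp: span_explicit)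
  have "dist (\<Sum>e\<in>Y. (u \<bullet> e) *\<^sub>R e) u < \<epsilon>" if Y: "finite Y" "X \<subseteq> Y" "Y \<subseteq> B" for Y
  proof -
    let ?p = "\<Sum>e\<in>Y. (u \<bullet> e) *\<^sub>R e"
    have orthY: "orthogonal (u - ?p) e" if "e \<in> Y" for e
    proof -
      have "?p \<bullet> e = u \<bullet> e"
        using Y that nrm pairwise_subset[OF orth Y(3)] by (intro inner_orthonormal_sum) auto
      then show ?thesis
        by (simp add: orthogonal_def inner_diff_left)
    qed
    have "?p - y \<in> span Y"
      unfolding X(3) using Y(2) by (intro span_diff span_sum span_scale) (auto intro: span_base)
    then have "orthogonal (u - ?p) (?p - y)"
      using orthY by (rule orthogonal_to_span)
    then have "(norm ((u - ?p) + (?p - y)))\<^sup>2 = (norm (u - ?p))\<^sup>2 + (norm (?p - y))\<^sup>2"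
      by (rule norm_add_Pythagorean)
    then have "(norm (u - ?p))\<^sup>2 \<le> (norm (u - y))\<^sup>2"
      by simp
    then have "norm (u - ?p) \<le> norm (u - y)"
      by (rule power2_le_imp_le) simp
    then show ?thesis
      using y(2) by (simp add: dist_norm norm_minus_commute)
  qed
  then show "\<exists>X. finite X \<and> X \<subseteq> B \<and>
      (\<forall>Y. finite Y \<and> X \<subseteq> Y \<and> Y \<subseteq> B \<longrightarrow> dist (\<Sum>e\<in>Y. (u \<bullet> e) *\<^sub>R e) u < \<epsilon>)"
    using X by blast
qed

lemma orthonormal_basis_has_sum:
  fixes B :: "'h::real_inner set"
  assumes "orthonormal_basis B"
  shows "((\<lambda>e. (u \<bullet> e) * (v \<bullet> e)) has_sum (u \<bullet> v)) B"
proof -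
  have "((\<lambda>e. (u \<bullet> e) *\<^sub>R e) has_sum u) B"
    using assms by (intro orthonormal_expansion_has_sum) (auto simp: orthonormal_basis_def)
  then have "((\<lambda>e. v \<bullet> ((u \<bullet> e) *\<^sub>R e)) has_sum (v \<bullet> u)) B"
    by (rule has_sum_bounded_linear[OF bounded_linear_inner_right])
  then show ?thesis
    by (simp add: inner_commute)
qed

lemma Bessel_inequality:
  fixes F :: "'h::real_inner set"
  assumes F: "finite F" "pairwise orthogonal F" "\<And>e. e \<in> F \<Longrightarrow> norm e = 1"
  shows "(\<Sum>e\<in>F. (u \<bullet> e)\<^sup>2) \<le> (norm u)\<^sup>2"
proof -
  let ?p = "\<Sum>e\<in>F. (u \<bullet> e) *\<^sub>R e"
  have pp: "?p \<bullet> ?p = (\<Sum>e\<in>F. (u \<bullet> e)\<^sup>2)"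
    unfolding inner_sum_right[of ?p] using inner_orthonormal_sum[OF F] by (simp add: power2_eq_square)
  have up: "u \<bullet> ?p = (\<Sum>e\<in>F. (u \<bullet> e)\<^sup>2)"
    by (simp add: inner_sum_right power2_eq_square)
  have "0 \<le> (norm (u - ?p))\<^sup>2"
    by simp
  also have "\<dots> = (norm u)\<^sup>2 - 2 * (u \<bullet> ?p) + ?p \<bullet> ?p"
    unfolding power2_norm_eq_inner by (simp add: inner_diff_left inner_diff_right inner_commute)
  finally show ?thesis
    by (simp add: pp up)
qed

text \<open>Guarantees that the choice in \<open>some_onb\<close> yields a basis. If the closed span
  of a maximal orthonormal set missed a vector, the normalised residual of its projection could be
  adjoined.\<close>

theorem orthonormal_basis_exists:
  "\<exists>B :: 'h::{real_inner,banach} set. orthonormal_basis B"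
proof -
  let ?A = "{B :: 'h set. pairwise orthogonal B \<and> (\<forall>e\<in>B. norm e = 1)}"
  have "\<exists>M\<in>?A. \<forall>X\<in>?A. M \<subseteq> X \<longrightarrow> X = M"
  proof (rule subset_Zorn')
    fix C assume C: "subset.chain ?A C"
    then have "C \<subseteq> ?A" by (simp add: subset.chain_def)
    moreover have "pairwise orthogonal (\<Union>C)"
    proof (rule pairwiseI)
      fix x y assume xy: "x \<in> \<Union>C" "y \<in> \<Union>C" "x \<noteq> y"
      then obtain X Y where XY: "X \<in> C" "Y \<in> C" "x \<in> X" "y \<in> Y" by blast
      then have "X \<subseteq> Y \<or> Y \<subseteq> X"
        using C by (auto simp: subset_chain_def)
      then obtain Z where "Z \<in> C" "x \<in> Z" "y \<in> Z"
        using XY by blast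
      then show "orthogonal x y"
        using \<open>C \<subseteq> ?A\<close> xy(3) by (auto simp: pairwise_def)
    qed
    ultimately show "\<Union>C \<in> ?A" by auto
  qed
  then obtain B where "B \<in> ?A" and max_A: "\<forall>X\<in>?A. B \<subseteq> X \<longrightarrow> X = B" ..
  then have B: "pairwise orthogonal B" "\<forall>e\<in>B. norm e = 1"
    by auto
  have max: "X = B" if "pairwise orthogonal X" "\<forall>e\<in>X. norm e = 1" "B \<subseteq> X" for X
    using max_A that by simp
  have "x \<in> closure (span B)" for x
  proof (rule ccontr)
    assume x: "x \<notin> closure (span B)"
    obtain p where p: "p \<in> closure (span B)" "\<And>y. y \<in> closure (span B) \<Longrightarrow> (x - p) \<bullet> y = 0"
      using closed_subspace_projection[of "closure (span B)" x] subspace_closure[OF subspace_span]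
      by blast
    have BS: "B \<subseteq> closure (span B)"
      using span_superset closure_subset by blast
    define z where "z = (1 / norm (x - p)) *\<^sub>R (x - p)"
    have "x \<noteq> p" using x p(1) by blast
    then have z: "norm z = 1"
      by (simp add: z_def)
    have "z \<bullet> e = 0" if "e \<in> B" for e
      using p(2)[of e] BS that by (auto simp: z_def)
    then have "pairwise orthogonal (insert z B)"
      using B(1) by (auto simp: pairwise_insert orthogonal_def inner_commute)
    then have "z \<in> B"
      using max[of "insert z B"] z B(2) by auto
    with \<open>\<And>e. e \<in> B \<Longrightarrow> z \<bullet> e = 0\<close> have "z \<bullet> z = 0" by blast
    with z show False by simp
  qed
  with B show ?thesis
    unfolding orthonormal_basis_def by blast
qed

lemma orthonormal_basis_some_onb:
  "orthonormal_basis (some_onb :: 'h::{real_inner,banach} set)"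
  unfolding some_onb_def using orthonormal_basis_exists by (rule someI_ex)

section \<open>Operators that are diagonal in an orthonormal sequence\<close>

lemma bounded_range_if_le:
  fixes b :: "nat \<Rightarrow> real"
  assumes "\<And>i. 0 \<le> b i" "\<And>i. b i \<le> \<beta>"
  shows "bounded (range b)"
  unfolding bounded_iff using assms by (intro exI[of _ \<beta>]) auto

lemma bounded_range_mult:
  fixes b b' :: "nat \<Rightarrow> real"
  assumes "bounded (range b)" "bounded (range b')"
  shows "bounded (range (\<lambda>i. b i * b' i))"
proof -
  obtain \<beta> \<beta>' where "\<And>i. \<bar>b i\<bar> \<le> \<beta>" "\<And>i. \<bar>b' i\<bar> \<le> \<beta>'"
    using assms by (auto simp: bounded_iff)
  then have "\<bar>b i * b' i\<bar> \<le> \<beta> * \<beta>'" for i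
    unfolding abs_mult by (intro mult_mono) (auto intro: order_trans[OF abs_ge_zero])
  then show ?thesis
    by (auto simp: bounded_iff)
qed

text \<open>Completeness is not demanded: the covariance operator may have a nontrivial kernel,
  which is the complement of its eigenvectors.\<close>

locale orthonormal_seq =
  fixes e :: "nat \<Rightarrow> 'h::{real_inner,banach}"
  assumes inner_e: "e i \<bullet> e j = (if i = j then 1 else 0)"
begin

lemma norm_e: "norm (e i) = 1"
  by (simp add: norm_eq_sqrt_inner inner_e)

lemma inj_e: "inj e"
  by (rule injI) (metis inner_e zero_neq_one)

lemma norm_sum_e: "finite F \<Longrightarrow> (norm (\<Sum>i\<in>F. c i *\<^sub>R e i))\<^sup>2 = (\<Sum>i\<in>F. (c i)\<^sup>2)"
  unfolding power2_norm_eq_inner inner_sum_left inner_sum_right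
  by (simp add: inner_e power2_eq_square if_distrib[of "\<lambda>x. _ * x"] cong: if_cong)

lemma sum_inner_e_le:
  assumes "finite F"
  shows "(\<Sum>i\<in>F. (u \<bullet> e i)\<^sup>2) \<le> (norm u)\<^sup>2"
proof -
  have "(\<Sum>i\<in>F. (u \<bullet> e i)\<^sup>2) = (\<Sum>x\<in>e ` F. (u \<bullet> x)\<^sup>2)"
    by (simp add: sum.reindex inj_on_subset[OF inj_e])
  also have "\<dots> \<le> (norm u)\<^sup>2"
    using assms by (intro Bessel_inequality) (auto simp: norm_e pairwise_def orthogonal_def inner_e)
  finally show ?thesis .
qed

lemma summable_inner_e: "summable (\<lambda>i. (u \<bullet> e i)\<^sup>2)"
  by (rule summableI_nonneg_bounded[where x="(norm u)\<^sup>2"]) (auto intro: sum_inner_e_le)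

text \<open>By orthonormality the squared norm of a block is a block of a scalar series, which
  Bessel's inequality makes Cauchy.\<close>

lemma summable_diag:
  assumes a: "bounded (range a)"
  shows "summable (\<lambda>i. (a i * (u \<bullet> e i)) *\<^sub>R e i)"
  unfolding summable_Cauchy
proof (intro allI impI)
  obtain \<alpha> where \<alpha>: "\<And>i. \<bar>a i\<bar> \<le> \<alpha>"
    using a by (auto simp: bounded_iff)
  fix \<epsilon> :: real assume "0 < \<epsilon>"
  have "summable (\<lambda>i. \<alpha>\<^sup>2 * (u \<bullet> e i)\<^sup>2)"
    by (intro summable_mult summable_inner_e)
  then have "\<exists>N. \<forall>m\<ge>N. \<forall>n. norm (\<Sum>i\<in>{m..<n}. \<alpha>\<^sup>2 * (u \<bullet> e i)\<^sup>2) < \<epsilon>\<^sup>2"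
    unfolding summable_Cauchy using \<open>0 < \<epsilon>\<close> by simp
  then obtain N where N: "\<And>m n. m \<ge> N \<Longrightarrow> norm (\<Sum>i\<in>{m..<n}. \<alpha>\<^sup>2 * (u \<bullet> e i)\<^sup>2) < \<epsilon>\<^sup>2"
    by blast
  have "norm (\<Sum>i\<in>{m..<n}. (a i * (u \<bullet> e i)) *\<^sub>R e i) < \<epsilon>" if "m \<ge> N" for m n
  proof -
    have "(norm (\<Sum>i\<in>{m..<n}. (a i * (u \<bullet> e i)) *\<^sub>R e i))\<^sup>2 = (\<Sum>i\<in>{m..<n}. (a i)\<^sup>2 * (u \<bullet> e i)\<^sup>2)"
      by (simp add: norm_sum_e power_mult_distrib)
    also have "\<dots> \<le> (\<Sum>i\<in>{m..<n}. \<alpha>\<^sup>2 * (u \<bullet> e i)\<^sup>2)"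
      using power_mono[OF \<alpha>, of _ 2] by (intro sum_mono mult_right_mono) auto
    also have "\<dots> < \<epsilon>\<^sup>2"
      using N[OF that, of n] by (simp add: sum_nonneg)
    finally show ?thesis
      by (rule power_less_imp_less_base) (use \<open>0 < \<epsilon>\<close> in simp)
  qed
  then show "\<exists>N. \<forall>m\<ge>N. \<forall>n. norm (\<Sum>i\<in>{m..<n}. (a i * (u \<bullet> e i)) *\<^sub>R e i) < \<epsilon>"
    by blast
qed

definition diag :: "(nat \<Rightarrow> real) \<Rightarrow> 'h \<Rightarrow> 'h" where
  "diag a u = (\<Sum>i. (a i * (u \<bullet> e i)) *\<^sub>R e i)"

lemma inner_diag_sums:
  assumes a: "bounded (range a)"
  shows "(\<lambda>i. a i * (u \<bullet> e i) * (v \<bullet> e i)) sums (diag a u \<bullet> v)"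
  using bounded_linear.sums[OF bounded_linear_inner_left summable_sums[OF summable_diag[OF a]], of u v]
  by (simp add: diag_def inner_commute)

lemma inner_diag_e:
  assumes a: "bounded (range a)"
  shows "diag a u \<bullet> e j = a j * (u \<bullet> e j)"
proof -
  have "(\<lambda>i. a i * (u \<bullet> e i) * (e j \<bullet> e i)) sums (diag a u \<bullet> e j)"
    by (rule inner_diag_sums[OF a])
  moreover have "(\<lambda>i. a i * (u \<bullet> e i) * (e j \<bullet> e i)) = (\<lambda>i. if i = j then a i * (u \<bullet> e i) else 0)"
    by (auto simp: inner_e)
  ultimately show ?thesis
    using sums_single[of j "\<lambda>i. a i * (u \<bullet> e i)"] by (simp add: sums_unique2)
qed

lemma inner_diag_orthogonal:
  assumes a: "bounded (range a)" and g: "\<And>i. g \<bullet> e i = 0"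
  shows "diag a u \<bullet> g = 0"
  using inner_diag_sums[OF a, of u g] sums_unique2[OF sums_zero] by (simp add: g)

lemma bounded_linear_diag:
  assumes a: "bounded (range a)"
  shows "bounded_linear (diag a)"
proof -
  obtain \<alpha> where \<alpha>: "\<And>i. \<bar>a i\<bar> \<le> \<alpha>"
    using a by (auto simp: bounded_iff)
  show ?thesis
  proof (rule bounded_linear_intro[where K=\<alpha>])
    show "diag a (u + v) = diag a u + diag a v" for u v
      unfolding diag_def
      by (subst suminf_add[OF summable_diag[OF a] summable_diag[OF a]])
        (simp add: inner_add_left algebra_simps)
    show "diag a (r *\<^sub>R u) = r *\<^sub>R diag a u" for r u
      unfolding diag_def by (subst suminf_scaleR_right[OF summable_diag[OF a]]) (simp add: ac_simps)
    show "norm (diag a u) \<le> norm u * \<alpha>" for u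
    proof -
      have "0 \<le> \<alpha>"
        using \<alpha>[of 0] by simp
      have "(\<lambda>i. (a i * (u \<bullet> e i))\<^sup>2) sums (norm (diag a u))\<^sup>2"
        using inner_diag_sums[OF a, of u "diag a u"]
        unfolding power2_norm_eq_inner by (simp add: inner_diag_e[OF a] power2_eq_square ac_simps)
      moreover have "(\<lambda>i. \<alpha>\<^sup>2 * (u \<bullet> e i)\<^sup>2) sums (\<alpha>\<^sup>2 * (\<Sum>i. (u \<bullet> e i)\<^sup>2))"
        by (intro sums_mult summable_sums summable_inner_e)
      moreover have "(a i * (u \<bullet> e i))\<^sup>2 \<le> \<alpha>\<^sup>2 * (u \<bullet> e i)\<^sup>2" for i
        using power_mono[OF \<alpha>[of i], of 2] by (simp add: power_mult_distrib mult_right_mono)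
      ultimately have "(norm (diag a u))\<^sup>2 \<le> \<alpha>\<^sup>2 * (\<Sum>i. (u \<bullet> e i)\<^sup>2)"
        by (rule sums_le[rotated])
      also have "\<dots> \<le> \<alpha>\<^sup>2 * (norm u)\<^sup>2"
        by (intro mult_left_mono suminf_le_const summable_inner_e sum_inner_e_le) auto
      finally have "(norm (diag a u))\<^sup>2 \<le> (norm u * \<alpha>)\<^sup>2"
        by (simp add: power_mult_distrib mult.commute)
      then show ?thesis
        by (rule power2_le_imp_le) (simp add: \<open>0 \<le> \<alpha>\<close>)
    qed
  qed
qed

text \<open>Coordinates alone do not separate vectors when the sequence is incomplete. The second
  premise is used for \<open>u - v\<close>, which the first makes orthogonal to every
  \<open>e j\<close>.\<close>

lemma vector_eqI:
  assumes "\<And>j. u \<bullet> e j = v \<bullet> e j" and "\<And>g. (\<And>j. g \<bullet> e j = 0) \<Longrightarrow> u \<bullet> g = v \<bullet> g"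
  shows "u = v"
proof -
  have "u \<bullet> (u - v) = v \<bullet> (u - v)"
    by (rule assms(2)) (simp add: inner_diff_left assms(1))
  then have "(u - v) \<bullet> (u - v) = 0"
    by (simp add: inner_diff_left)
  then show ?thesis by simp
qed

text \<open>\<open>diag (\<lambda>_. 1)\<close> is the projection onto the closed span of the
  sequence, and the premise says that \<open>u\<close> is fixed by it.\<close>

lemma parseval_sums:
  assumes "\<And>g. (\<And>j. g \<bullet> e j = 0) \<Longrightarrow> u \<bullet> g = 0"
  shows "(\<lambda>i. (u \<bullet> e i)\<^sup>2) sums (norm u)\<^sup>2"
proof -
  have bd: "bounded (range (\<lambda>_::nat. 1::real))" by simp
  have "diag (\<lambda>_. 1) u = u"
    using inner_diag_e[OF bd, of u] inner_diag_orthogonal[OF bd, of _ u] assms by (intro vector_eqI) auto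
  then show ?thesis
    using inner_diag_sums[OF bd, of u u] unfolding power2_norm_eq_inner by (simp add: power2_eq_square)
qed

text \<open>\<open>diag_op c b\<close> multiplies \<open>e i\<close> by \<open>b i\<close> and the orthogonal complement of all \<open>e i\<close> by \<open>c\<close>;
  it is only meaningful for bounded \<open>b\<close>.\<close>

definition diag_op :: "real \<Rightarrow> (nat \<Rightarrow> real) \<Rightarrow> 'h \<Rightarrow>\<^sub>L 'h" where
  "diag_op c b = Blinfun (\<lambda>u. c *\<^sub>R u + diag (\<lambda>i. b i - c) u)"

context
  fixes c :: real and b :: "nat \<Rightarrow> real"
  assumes b: "bounded (range b)"
begin

lemma inner_diag_op_e: "blinfun_apply (diag_op c b) u \<bullet> e j = b j * (u \<bullet> e j)"
  and inner_diag_op_orthogonal: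
    "(\<And>i. g \<bullet> e i = 0) \<Longrightarrow> blinfun_apply (diag_op c b) u \<bullet> g = c * (u \<bullet> g)"
  and diag_op_sums: "(\<lambda>i. (b i - c) * (u \<bullet> e i) * (v \<bullet> e i)) sums (blinfun_apply (diag_op c b) u \<bullet> v - c * (u \<bullet> v))"
proof -
  have bd: "bounded (range (\<lambda>i. b i - c))"
    using b by (intro bounded_minus_comp) auto
  have app: "blinfun_apply (diag_op c b) u = c *\<^sub>R u + diag (\<lambda>i. b i - c) u" for u
    unfolding diag_op_def
    by (subst bounded_linear_Blinfun_apply)
      (auto intro!: bounded_linear_add bounded_linear_scaleR_right bounded_linear_diag[OF bd])
  show "blinfun_apply (diag_op c b) u \<bullet> e j = b j * (u \<bullet> e j)"
    by (simp add: app inner_add_left inner_diag_e[OF bd] algebra_simps)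
  show "blinfun_apply (diag_op c b) u \<bullet> g = c * (u \<bullet> g)" if "\<And>i. g \<bullet> e i = 0"
    by (simp add: app inner_add_left inner_diag_orthogonal[OF bd that])
  show "(\<lambda>i. (b i - c) * (u \<bullet> e i) * (v \<bullet> e i)) sums (blinfun_apply (diag_op c b) u \<bullet> v - c * (u \<bullet> v))"
    using inner_diag_sums[OF bd, of u v] by (simp add: app inner_add_left)
qed

lemma diag_op_self_adjoint: "blinfun_apply (diag_op c b) u \<bullet> v = u \<bullet> blinfun_apply (diag_op c b) v"
proof -
  have "(\<lambda>i. (b i - c) * (u \<bullet> e i) * (v \<bullet> e i)) sums (blinfun_apply (diag_op c b) v \<bullet> u - c * (v \<bullet> u))"
    using diag_op_sums[of v u] by (simp add: ac_simps)
  then have "blinfun_apply (diag_op c b) u \<bullet> v - c * (u \<bullet> v) = blinfun_apply (diag_op c b) v \<bullet> u - c * (v \<bullet> u)"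
    using diag_op_sums[of u v] sums_unique2 by blast
  then show ?thesis
    by (simp add: inner_commute)
qed

text \<open>The device by which the covariance, its regularisation and the square roots are
  identified: each is checked on the \<open>e j\<close> and on their complement.\<close>

lemma diag_op_eqI:
  assumes "\<And>u j. blinfun_apply A u \<bullet> e j = b j * (u \<bullet> e j)"
    and "\<And>u g. (\<And>i. g \<bullet> e i = 0) \<Longrightarrow> blinfun_apply A u \<bullet> g = c * (u \<bullet> g)"
  shows "A = diag_op c b"
  by (intro blinfun_eqI vector_eqI) (simp_all add: assms inner_diag_op_e inner_diag_op_orthogonal)

end

lemma diag_op_compose:
  assumes b: "bounded (range b)" and b': "bounded (range b')"
  shows "diag_op c b o\<^sub>L diag_op c' b' = diag_op (c * c') (\<lambda>i. b i * b' i)"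
  by (rule diag_op_eqI[OF bounded_range_mult[OF b b']])
    (simp_all add: inner_diag_op_e[OF b] inner_diag_op_e[OF b'] inner_diag_op_orthogonal[OF b]
      inner_diag_op_orthogonal[OF b'])

lemma positive_diag_op:
  assumes "bounded (range b)" "0 \<le> c" "\<And>i. 0 \<le> b i"
  shows "positive_op (diag_op c b)"
  unfolding positive_op_def
proof (intro conjI allI)
  show "blinfun_apply (diag_op c b) x \<bullet> y = x \<bullet> blinfun_apply (diag_op c b) y" for x y
    by (rule diag_op_self_adjoint[OF assms(1)])
  obtain \<beta> where \<beta>: "\<And>i. \<bar>b i\<bar> \<le> \<beta>"
    using assms(1) by (auto simp: bounded_iff)
  have sb: "bounded (range (\<lambda>i. sqrt (b i)))"
    unfolding bounded_iff using \<beta> assms(3) by (intro exI[of _ "sqrt \<beta>"]) auto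
  \<comment> \<open>As the square of a self-adjoint operator, its quadratic form is a squared
    norm.\<close>
  have "diag_op c b = diag_op (sqrt c) (\<lambda>i. sqrt (b i)) o\<^sub>L diag_op (sqrt c) (\<lambda>i. sqrt (b i))"
    using assms by (simp add: diag_op_compose[OF sb sb])
  then show "0 \<le> blinfun_apply (diag_op c b) x \<bullet> x" for x
    by (simp add: diag_op_self_adjoint[OF sb, of "sqrt c" "blinfun_apply (diag_op (sqrt c) (\<lambda>i. sqrt (b i))) x" x])
qed

lemma op_inverse_diag_op:
  assumes b: "bounded (range b)" and b': "bounded (range (\<lambda>i. inverse (b i)))"
    and "c \<noteq> 0" "\<And>i. b i \<noteq> 0"
  shows "op_inverse (diag_op c b) = diag_op (inverse c) (\<lambda>i. inverse (b i))"
proof -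
  have id: "id_blinfun = diag_op 1 (\<lambda>_. 1)"
    by (rule diag_op_eqI) auto
  have inv: "diag_op c b o\<^sub>L diag_op (inverse c) (\<lambda>i. inverse (b i)) = id_blinfun"
    "diag_op (inverse c) (\<lambda>i. inverse (b i)) o\<^sub>L diag_op c b = id_blinfun"
    using assms by (simp_all add: diag_op_compose id)
  show ?thesis
    unfolding op_inverse_def
  proof (rule the_equality)
    fix B assume B: "diag_op c b o\<^sub>L B = id_blinfun \<and> B o\<^sub>L diag_op c b = id_blinfun"
    have "B = B o\<^sub>L (diag_op c b o\<^sub>L diag_op (inverse c) (\<lambda>i. inverse (b i)))"
      by (simp add: inv blinfun_eqI)
    also have "\<dots> = (B o\<^sub>L diag_op c b) o\<^sub>L diag_op (inverse c) (\<lambda>i. inverse (b i))"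
      by (rule blinfun_eqI) simp
    also have "\<dots> = diag_op (inverse c) (\<lambda>i. inverse (b i))"
      using B by (simp add: blinfun_eqI)
    finally show "B = diag_op (inverse c) (\<lambda>i. inverse (b i))" .
  qed (use inv in auto)
qed

end

text \<open>This determines a positive square root on every eigenvector, hence makes the square root of a diagonal
  operator unique without any commutation argument.\<close>

lemma positive_op_eigenvector:
  assumes "positive_op S" "blinfun_apply S (blinfun_apply S v) = (\<alpha> * \<alpha>) *\<^sub>R v" "0 < \<alpha>"
  shows "blinfun_apply S v = \<alpha> *\<^sub>R v"
proof -
  define w where "w = blinfun_apply S v - \<alpha> *\<^sub>R v"
  have "blinfun_apply S w = - (\<alpha> *\<^sub>R w)"
    using assms(2) by (simp add: w_def blinfun.diff_right blinfun.scaleR_right algebra_simps)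
  then have "0 \<le> - (\<alpha> * (w \<bullet> w))"
    using assms(1) by (metis inner_minus_left inner_scaleR_left positive_op_def)
  then have "w \<bullet> w \<le> 0"
    using assms(3) by (simp add: mult_le_0_iff)
  then have "w = 0"
    using inner_gt_zero_iff[of w] by linarith
  then show ?thesis
    by (simp add: w_def)
qed

context orthonormal_seq
begin

lemma op_sqrt_diag_op:
  assumes b: "bounded (range b)" and c: "0 < c" and pos: "\<And>i. 0 < b i"
  shows "op_sqrt (diag_op c b) = diag_op (sqrt c) (\<lambda>i. sqrt (b i))"
proof -
  obtain \<beta> where \<beta>: "\<And>i. \<bar>b i\<bar> \<le> \<beta>"
    using b by (auto simp: bounded_iff)
  have sb: "bounded (range (\<lambda>i. sqrt (b i)))"
    unfolding bounded_iff using \<beta> less_imp_le[OF pos] by (intro exI[of _ "sqrt \<beta>"]) auto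
  show ?thesis
    unfolding op_sqrt_def
  proof (rule the_equality)
    show "positive_op (diag_op (sqrt c) (\<lambda>i. sqrt (b i))) \<and>
        diag_op (sqrt c) (\<lambda>i. sqrt (b i)) o\<^sub>L diag_op (sqrt c) (\<lambda>i. sqrt (b i)) = diag_op c b"
      using c pos by (auto intro!: positive_diag_op[OF sb] simp: diag_op_compose[OF sb sb] less_imp_le)
    fix S assume "positive_op S \<and> S o\<^sub>L S = diag_op c b"
    then have S: "positive_op S" "\<And>u. blinfun_apply S (blinfun_apply S u) = blinfun_apply (diag_op c b) u"
      by (auto simp flip: blinfun_apply_blinfun_compose)
    have sym: "blinfun_apply S u \<bullet> v = u \<bullet> blinfun_apply S v" for u v
      using S(1) by (simp add: positive_op_def)
    have Se: "blinfun_apply S (e j) = sqrt (b j) *\<^sub>R e j" for j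
    proof (rule positive_op_eigenvector[OF S(1)])
      have "blinfun_apply (diag_op c b) (e j) = b j *\<^sub>R e j"
        by (rule vector_eqI, simp_all add: inner_diag_op_e[OF b] inner_diag_op_orthogonal[OF b] inner_e)
          (metis inner_commute)
      then show "blinfun_apply S (blinfun_apply S (e j)) = (sqrt (b j) * sqrt (b j)) *\<^sub>R e j"
        using pos[of j] by (simp add: S(2))
    qed (use pos in auto)
    have Sg: "blinfun_apply S g = sqrt c *\<^sub>R g" if g: "\<And>i. g \<bullet> e i = 0" for g
    proof (rule positive_op_eigenvector[OF S(1)])
      have "blinfun_apply (diag_op c b) g = c *\<^sub>R g"
        by (rule vector_eqI)
          (auto simp: inner_diag_op_e[OF b] inner_diag_op_orthogonal[OF b] g)
      then show "blinfun_apply S (blinfun_apply S g) = (sqrt c * sqrt c) *\<^sub>R g"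
        using c by (simp add: S(2))
    qed (use c in auto)
    show "S = diag_op (sqrt c) (\<lambda>i. sqrt (b i))"
      by (rule diag_op_eqI[OF sb]) (simp_all add: sym Se Sg)
  qed
qed

end

section \<open>Trace and Hilbert-Schmidt norm\<close>

lemma has_sum_finite_sum:
  fixes f :: "'i \<Rightarrow> 'a \<Rightarrow> 'b::topological_comm_monoid_add"
  assumes "finite I" "\<And>i. i \<in> I \<Longrightarrow> (f i has_sum S i) A"
  shows "((\<lambda>x. \<Sum>i\<in>I. f i x) has_sum (\<Sum>i\<in>I. S i)) A"
  using assms
proof (induction I rule: finite_induct)
  case (insert i I)
  then show ?case by (simp add: has_sum_add)
qed simp

lemma finite_some_onb_subset:
  fixes F :: "'h::{real_inner,banach} set"
  assumes "F \<subseteq> some_onb"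
  shows "pairwise orthogonal F" "\<And>f. f \<in> F \<Longrightarrow> norm f = 1"
proof -
  have "pairwise orthogonal (some_onb :: 'h set)" "\<forall>f\<in>some_onb. norm (f :: 'h) = 1"
    using orthonormal_basis_some_onb[where 'h='h] by (auto simp: orthonormal_basis_def)
  then show "pairwise orthogonal F" "\<And>f. f \<in> F \<Longrightarrow> norm f = 1"
    using assms pairwise_subset by blast+
qed

lemma hs_norm_eq_if_has_sum:
  assumes "((\<lambda>f. (norm (blinfun_apply D f))\<^sup>2) has_sum S) some_onb"
  shows "hs_norm D = ereal (sqrt S)"
  using has_sum_imp_summable[OF assms] infsumI[OF assms] by (simp add: hs_norm_def)

text \<open>Expand the square and apply Parseval in \<open>some_onb\<close> to each term. The total
  is a polynomial in inner products of the \<open>v a\<close>, with no trace of the basis, which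
  makes its dependence on the sample visibly measurable.\<close>

lemma norm_rank_one_sum_minus_has_sum:
  fixes W :: "'h::{real_inner,banach} \<Rightarrow>\<^sub>L 'h" and v :: "'i \<Rightarrow> 'h"
  assumes A: "finite A"
    and W: "\<And>x y. blinfun_apply W x \<bullet> y = x \<bullet> blinfun_apply W y"
    and sum_W: "((\<lambda>f. (norm (blinfun_apply W f))\<^sup>2) has_sum T) some_onb"
  shows "((\<lambda>f. (norm (r *\<^sub>R (\<Sum>a\<in>A. (v a \<bullet> f) *\<^sub>R v a) - blinfun_apply W f))\<^sup>2) has_sum
    (r\<^sup>2 * (\<Sum>a\<in>A. \<Sum>b\<in>A. (v a \<bullet> v b) * (v a \<bullet> v b))
      - 2 * r * (\<Sum>a\<in>A. v a \<bullet> blinfun_apply W (v a)) + T)) some_onb"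
proof -
  note parseval = orthonormal_basis_has_sum[OF orthonormal_basis_some_onb]
  have eq: "(norm (r *\<^sub>R (\<Sum>a\<in>A. (v a \<bullet> f) *\<^sub>R v a) - blinfun_apply W f))\<^sup>2
      = r\<^sup>2 * (\<Sum>a\<in>A. \<Sum>b\<in>A. (v a \<bullet> v b) * ((v a \<bullet> f) * (v b \<bullet> f)))
        - 2 * r * (\<Sum>a\<in>A. (v a \<bullet> f) * (blinfun_apply W (v a) \<bullet> f)) + (norm (blinfun_apply W f))\<^sup>2" for f
  proof -
    let ?g = "\<Sum>a\<in>A. (v a \<bullet> f) *\<^sub>R v a"
    have "?g \<bullet> ?g = (\<Sum>a\<in>A. \<Sum>b\<in>A. (v a \<bullet> v b) * ((v a \<bullet> f) * (v b \<bullet> f)))"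
      unfolding inner_sum_left inner_sum_right
      by (intro sum.cong refl) (simp add: inner_commute[of "v b" "v a" for a b] ac_simps)
    moreover have "?g \<bullet> blinfun_apply W f = (\<Sum>a\<in>A. (v a \<bullet> f) * (blinfun_apply W (v a) \<bullet> f))"
      unfolding inner_sum_left by (simp add: W)
    moreover have "(norm (r *\<^sub>R g - h))\<^sup>2 = r\<^sup>2 * (g \<bullet> g) - 2 * r * (g \<bullet> h) + (norm h)\<^sup>2" for g h :: 'h
      unfolding power2_norm_eq_inner using inner_commute[of h g]
      by (simp add: inner_diff_left inner_diff_right power2_eq_square right_diff_distrib)
    ultimately show ?thesis by simp
  qed
  have "((\<lambda>f. \<Sum>a\<in>A. \<Sum>b\<in>A. (v a \<bullet> v b) * ((v a \<bullet> f) * (v b \<bullet> f))) has_sum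
      (\<Sum>a\<in>A. \<Sum>b\<in>A. (v a \<bullet> v b) * (v a \<bullet> v b))) some_onb"
    using A by (intro has_sum_finite_sum has_sum_cmult_right parseval)
  moreover have "((\<lambda>f. \<Sum>a\<in>A. (v a \<bullet> f) * (blinfun_apply W (v a) \<bullet> f)) has_sum
      (\<Sum>a\<in>A. v a \<bullet> blinfun_apply W (v a))) some_onb"
    using A by (intro has_sum_finite_sum parseval)
  ultimately have "((\<lambda>f. r\<^sup>2 * (\<Sum>a\<in>A. \<Sum>b\<in>A. (v a \<bullet> v b) * ((v a \<bullet> f) * (v b \<bullet> f)))
        + (- 2 * r) * (\<Sum>a\<in>A. (v a \<bullet> f) * (blinfun_apply W (v a) \<bullet> f)) + (norm (blinfun_apply W f))\<^sup>2) has_sum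
      (r\<^sup>2 * (\<Sum>a\<in>A. \<Sum>b\<in>A. (v a \<bullet> v b) * (v a \<bullet> v b))
        + (- 2 * r) * (\<Sum>a\<in>A. v a \<bullet> blinfun_apply W (v a)) + T)) some_onb"
    by (intro has_sum_add has_sum_cmult_right sum_W)
  then show ?thesis
    unfolding eq by simp
qed

context orthonormal_seq
begin

text \<open>The norm is defined through \<open>some_onb\<close>, the bounds are given in
  \<open>e\<close>. Premise \<open>ran\<close> makes Parseval valid in \<open>e\<close> on the range
  of \<open>D\<close>; self-adjointness then exchanges the two systems, and Bessel's inequality
  removes the sum over \<open>some_onb\<close>.\<close>

lemma hs_norm_le_if_truncations_le:
  assumes sym: "\<And>x y. blinfun_apply D x \<bullet> y = x \<bullet> blinfun_apply D y"
    and ran: "\<And>x g. (\<And>i. g \<bullet> e i = 0) \<Longrightarrow> blinfun_apply D x \<bullet> g = 0"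
    and le: "\<And>n. (\<Sum>p<n. \<Sum>q<n. (blinfun_apply D (e p) \<bullet> e q)\<^sup>2) \<le> \<epsilon>\<^sup>2" and \<epsilon>: "0 \<le> \<epsilon>"
  shows "hs_norm D \<le> ereal \<epsilon>"
proof -
  have parseval: "(\<lambda>i. (blinfun_apply D x \<bullet> e i)\<^sup>2) sums (norm (blinfun_apply D x))\<^sup>2" for x
    by (rule parseval_sums) (rule ran)
  have De: "(\<Sum>p<n. (norm (blinfun_apply D (e p)))\<^sup>2) \<le> \<epsilon>\<^sup>2" for n
  proof (rule LIMSEQ_le_const2)
    show "(\<lambda>m. \<Sum>p<n. \<Sum>q<m. (blinfun_apply D (e p) \<bullet> e q)\<^sup>2) \<longlonglongrightarrow> (\<Sum>p<n. (norm (blinfun_apply D (e p)))\<^sup>2)"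
      using parseval unfolding sums_def by (intro tendsto_sum)
    \<comment> \<open>Letting only the columns grow gives rectangles, which are enlarged to the
      squares covered by the hypothesis.\<close>
    have "(\<Sum>p<n. \<Sum>q<m. (blinfun_apply D (e p) \<bullet> e q)\<^sup>2) \<le> \<epsilon>\<^sup>2" for m
    proof -
      have "(\<Sum>p<n. \<Sum>q<m. (blinfun_apply D (e p) \<bullet> e q)\<^sup>2)
          \<le> (\<Sum>p<n. \<Sum>q<max n m. (blinfun_apply D (e p) \<bullet> e q)\<^sup>2)"
        by (intro sum_mono sum_mono2) auto
      also have "\<dots> \<le> (\<Sum>p<max n m. \<Sum>q<max n m. (blinfun_apply D (e p) \<bullet> e q)\<^sup>2)"
        by (intro sum_mono2) (auto intro: sum_nonneg)
      also have "\<dots> \<le> \<epsilon>\<^sup>2" by (rule le)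
      finally show ?thesis .
    qed
    then show "\<exists>N. \<forall>m\<ge>N. (\<Sum>p<n. \<Sum>q<m. (blinfun_apply D (e p) \<bullet> e q)\<^sup>2) \<le> \<epsilon>\<^sup>2"
      by blast
  qed
  have fin: "(\<Sum>f\<in>F. (norm (blinfun_apply D f))\<^sup>2) \<le> \<epsilon>\<^sup>2" if F: "finite F" "F \<subseteq> some_onb" for F
  proof (rule LIMSEQ_le_const2)
    show "(\<lambda>n. \<Sum>f\<in>F. \<Sum>i<n. (blinfun_apply D f \<bullet> e i)\<^sup>2) \<longlonglongrightarrow> (\<Sum>f\<in>F. (norm (blinfun_apply D f))\<^sup>2)"
      using parseval unfolding sums_def by (intro tendsto_sum)
    have "(\<Sum>f\<in>F. \<Sum>i<n. (blinfun_apply D f \<bullet> e i)\<^sup>2) \<le> \<epsilon>\<^sup>2" for n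
    proof -
      have "(\<Sum>f\<in>F. \<Sum>i<n. (blinfun_apply D f \<bullet> e i)\<^sup>2) = (\<Sum>i<n. \<Sum>f\<in>F. (blinfun_apply D (e i) \<bullet> f)\<^sup>2)"
      proof -
        have "blinfun_apply D f \<bullet> e i = blinfun_apply D (e i) \<bullet> f" for f i
          using sym[of f "e i"] by (simp add: inner_commute)
        then show ?thesis
          by (subst sum.swap) simp
      qed
      also have "\<dots> \<le> (\<Sum>i<n. (norm (blinfun_apply D (e i)))\<^sup>2)"
        by (intro sum_mono Bessel_inequality F finite_some_onb_subset[OF F(2)])
      also have "\<dots> \<le> \<epsilon>\<^sup>2" by (rule De)
      finally show ?thesis .
    qed
    then show "\<exists>N. \<forall>n\<ge>N. (\<Sum>f\<in>F. \<Sum>i<n. (blinfun_apply D f \<bullet> e i)\<^sup>2) \<le> \<epsilon>\<^sup>2"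
      by blast
  qed
  have sm: "(\<lambda>f. (norm (blinfun_apply D f))\<^sup>2) summable_on some_onb"
    using fin by (intro nonneg_bdd_above_summable_on bdd_aboveI2) auto
  then have "(\<Sum>\<^sub>\<infinity>f\<in>some_onb. (norm (blinfun_apply D f))\<^sup>2) \<le> \<epsilon>\<^sup>2"
    using fin by (intro infsum_le_finite_sums)
  then have "sqrt (\<Sum>\<^sub>\<infinity>f\<in>some_onb. (norm (blinfun_apply D f))\<^sup>2) \<le> \<epsilon>"
    using \<epsilon> real_sqrt_le_mono by fastforce
  then show ?thesis
    using sm by (simp add: hs_norm_def)
qed

context
  fixes w :: "nat \<Rightarrow> real" and T :: real
  assumes w: "\<And>i. 0 \<le> w i" "\<And>i. w i \<le> 1" and T: "\<And>n. (\<Sum>i<n. w i) \<le> T"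
begin

lemma bounded_weights: "bounded (range w)"
  unfolding bounded_iff using w by (intro exI[of _ 1]) auto

lemma weights_quadratic_form_sums:
  "(\<lambda>i. w i * (f \<bullet> e i)\<^sup>2) sums (blinfun_apply (diag_op 0 w) f \<bullet> f)"
  using diag_op_sums[OF bounded_weights, of 0 f f] by (simp add: power2_eq_square mult.assoc)

text \<open>The infinite sum of a family that is not summable is 0 by convention, so
  \<open>op_trace\<close> is informative only after this. Finite parts are bounded by exchanging
  sums and using Bessel's inequality.\<close>

lemma weights_trace_summable: "(\<lambda>f. blinfun_apply (diag_op 0 w) f \<bullet> f) summable_on some_onb"
proof (intro nonneg_bdd_above_summable_on bdd_aboveI2)
  show "0 \<le> blinfun_apply (diag_op 0 w) f \<bullet> f" for f
    using positive_diag_op[OF bounded_weights, of 0] w unfolding positive_op_def by blast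
  fix F :: "'h set" assume "F \<in> {F. F \<subseteq> some_onb \<and> finite F}"
  then have F: "finite F" "F \<subseteq> some_onb" by auto
  show "(\<Sum>f\<in>F. blinfun_apply (diag_op 0 w) f \<bullet> f) \<le> T"
  proof (rule LIMSEQ_le_const2)
    show "(\<lambda>n. \<Sum>f\<in>F. \<Sum>i<n. w i * (f \<bullet> e i)\<^sup>2) \<longlonglongrightarrow> (\<Sum>f\<in>F. blinfun_apply (diag_op 0 w) f \<bullet> f)"
      using weights_quadratic_form_sums unfolding sums_def by (intro tendsto_sum)
    have "(\<Sum>f\<in>F. \<Sum>i<n. w i * (f \<bullet> e i)\<^sup>2) \<le> T" for n
    proof -
      have "(\<Sum>f\<in>F. \<Sum>i<n. w i * (f \<bullet> e i)\<^sup>2) = (\<Sum>i<n. w i * (\<Sum>f\<in>F. (e i \<bullet> f)\<^sup>2))"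
        by (subst sum.swap) (simp add: sum_distrib_left inner_commute)
      also have "\<dots> \<le> (\<Sum>i<n. w i * (norm (e i))\<^sup>2)"
        using w by (intro sum_mono mult_left_mono Bessel_inequality F finite_some_onb_subset[OF F(2)])
      also have "\<dots> \<le> T"
        using T by (simp add: norm_e)
      finally show ?thesis .
    qed
    then show "\<exists>N. \<forall>n\<ge>N. (\<Sum>f\<in>F. \<Sum>i<n. w i * (f \<bullet> e i)\<^sup>2) \<le> T"
      by blast
  qed
qed

text \<open>By Parseval in \<open>some_onb\<close>, each rank-one piece has trace equal to its
  weight, and finitely many pieces lie below the whole quadratic form.\<close>

lemma sum_weights_le_trace: "(\<Sum>i<n. w i) \<le> op_trace (diag_op 0 w)"
proof -
  have "((\<lambda>f. \<Sum>i<n. w i * ((e i \<bullet> f) * (e i \<bullet> f))) has_sum (\<Sum>i<n. w i * (e i \<bullet> e i))) some_onb"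
    by (intro has_sum_finite_sum has_sum_cmult_right orthonormal_basis_has_sum orthonormal_basis_some_onb) auto
  moreover have "((\<lambda>f. blinfun_apply (diag_op 0 w) f \<bullet> f) has_sum op_trace (diag_op 0 w)) some_onb"
    unfolding op_trace_def using weights_trace_summable by (rule has_sum_infsum)
  moreover have "(\<Sum>i<n. w i * ((e i \<bullet> f) * (e i \<bullet> f))) \<le> blinfun_apply (diag_op 0 w) f \<bullet> f" for f
  proof -
    have "(\<Sum>i<n. w i * (f \<bullet> e i)\<^sup>2) \<le> blinfun_apply (diag_op 0 w) f \<bullet> f"
      using sums_unique[OF weights_quadratic_form_sums] sums_summable[OF weights_quadratic_form_sums] w
      by (auto intro!: sum_le_suminf)
    then show ?thesis
      by (simp add: inner_commute power2_eq_square)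
  qed
  ultimately have "(\<Sum>i<n. w i * (e i \<bullet> e i)) \<le> op_trace (diag_op 0 w)"
    by (rule has_sum_mono)
  then show ?thesis
    by (simp add: inner_e)
qed

text \<open>Weights in \<open>[0, 1]\<close> satisfy \<open>w i * w i \<le> w i\<close>, so the
  trace dominates the squared Hilbert-Schmidt norm.\<close>

lemma weights_norm_summable: "(\<lambda>f. (norm (blinfun_apply (diag_op 0 w) f))\<^sup>2) summable_on some_onb"
proof (rule summable_on_comparison_test[OF weights_trace_summable])
  fix f :: 'h
  have sq: "(\<lambda>i. w i * w i * (f \<bullet> e i)\<^sup>2) sums (norm (blinfun_apply (diag_op 0 w) f))\<^sup>2"
  proof -
    have "(norm (blinfun_apply (diag_op 0 w) f))\<^sup>2 = blinfun_apply (diag_op 0 w o\<^sub>L diag_op 0 w) f \<bullet> f"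
      unfolding power2_norm_eq_inner
      using diag_op_self_adjoint[OF bounded_weights, of 0 "blinfun_apply (diag_op 0 w) f" f] by simp
    then show ?thesis
      using diag_op_sums[OF bounded_range_mult[OF bounded_weights bounded_weights], of 0 f f]
      by (simp add: diag_op_compose[OF bounded_weights bounded_weights] power2_eq_square mult.assoc)
  qed
  have "w i * w i * (f \<bullet> e i)\<^sup>2 \<le> w i * (f \<bullet> e i)\<^sup>2" for i
    using w by (intro mult_right_mono) (auto intro: mult_left_le)
  from sums_le[OF this sq weights_quadratic_form_sums]
  show "(norm (blinfun_apply (diag_op 0 w) f))\<^sup>2 \<le> blinfun_apply (diag_op 0 w) f \<bullet> f" .
qed simp

end

end

section \<open>The covariance operator of a bounded continuous kernel\<close>

locale bounded_kernel_space = prob_space P for P :: "'x::second_countable_topology measure" +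
  fixes fn :: "'h::{real_inner,banach} \<Rightarrow> 'x \<Rightarrow> real" and K :: "'x \<Rightarrow> 'x \<Rightarrow> real" and \<kappa> :: real
  assumes sets_P: "sets P = sets borel"
    and rkhs: "rkhs fn K"
    and cont_K: "continuous_on UNIV (\<lambda>(x, y). K x y)"
    and K_le: "K x x \<le> \<kappa>"
begin

abbreviation k :: "'x \<Rightarrow> 'h" where
  "k \<equiv> kernel_at fn K"

lemma fn_eq: "fn f x = f \<bullet> k x"
  and fn_k: "fn (k x) y = K y x"
proof -
  obtain h where h: "fn h = (\<lambda>y. K y x)" "\<And>f. fn f x = f \<bullet> h"
    using rkhs unfolding rkhs_def by blast
  have "inj fn"
    using rkhs by (simp add: rkhs_def)
  then have "k x = h"
    unfolding kernel_at_def h(1)[symmetric] by simp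
  with h show "fn f x = f \<bullet> k x" "fn (k x) y = K y x"
    by simp_all
qed

lemma inner_k: "k x \<bullet> k y = K y x"
  by (simp flip: fn_eq fn_k)

lemma norm_k_le: "norm (k x) \<le> sqrt \<kappa>"
  using K_le[of x] by (simp add: norm_eq_sqrt_inner inner_k)

lemma kappa_nonneg: "0 \<le> \<kappa>"
  using order_trans[OF norm_ge_zero norm_k_le] by simp

text \<open>The squared distance of \<open>k y\<close> and \<open>k x\<close> is a combination of
  kernel values, so continuity of \<open>K\<close> becomes norm continuity.\<close>

lemma continuous_on_k: "continuous_on UNIV k"
  unfolding continuous_on_def
proof
  fix x :: 'x
  have K_cont: "continuous_on UNIV (\<lambda>y. K (f y) (g y))" if "continuous_on UNIV f" "continuous_on UNIV g" for f g :: "'x \<Rightarrow> 'x"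
    using continuous_on_compose2[OF cont_K continuous_on_Pair[OF that]] by simp
  have "((\<lambda>y. (norm (k y - k x))\<^sup>2) \<longlongrightarrow> (norm (k x - k x))\<^sup>2) (at x within UNIV)"
  proof -
    have "(norm (k y - k x))\<^sup>2 = K y y - 2 * K y x + K x x" for y
      unfolding power2_norm_eq_inner
      by (simp add: inner_diff_left inner_diff_right inner_commute[of "k y" "k x"]) (simp add: inner_k)
    moreover have "continuous_on UNIV (\<lambda>y. K y y - 2 * K y x + K x x)"
      by (intro continuous_intros K_cont)
    ultimately have "continuous_on UNIV (\<lambda>y. (norm (k y - k x))\<^sup>2)"
      by simp
    then show ?thesis
      unfolding continuous_on_def by blast
  qed
  then have "((\<lambda>y. sqrt ((norm (k y - k x))\<^sup>2)) \<longlongrightarrow> sqrt 0) (at x within UNIV)"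
    by (intro tendsto_real_sqrt) simp
  then have "((\<lambda>y. k y - k x) \<longlongrightarrow> 0) (at x within UNIV)"
    by (simp add: tendsto_norm_zero_iff)
  then show "(k \<longlongrightarrow> k x) (at x within UNIV)"
    by (simp add: LIM_zero_iff)
qed

lemma measurable_inner_k [measurable]: "(\<lambda>x. f \<bullet> k x) \<in> borel_measurable P"
proof -
  have "(\<lambda>x. f \<bullet> k x) \<in> borel_measurable borel"
    by (intro borel_measurable_continuous_onI continuous_intros continuous_on_k)
  then show ?thesis
    using sets_P by (simp cong: measurable_cong_sets)
qed

text \<open>Second countability enters: the product of the Borel algebras is the Borel algebra of
  the product, so continuity suffices.\<close>

lemma measurable_blinfun_k_k:
  "(\<lambda>z. blinfun_apply A (k (fst z)) \<bullet> k (snd z)) \<in> borel_measurable (P \<Otimes>\<^sub>M P)"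
proof -
  have "continuous_on UNIV (\<lambda>z :: 'x \<times> 'x. blinfun_apply A (k (fst z)) \<bullet> k (snd z))"
    by (intro continuous_intros continuous_on_compose2[OF continuous_on_k]) auto
  then have "(\<lambda>z :: 'x \<times> 'x. blinfun_apply A (k (fst z)) \<bullet> k (snd z)) \<in> borel_measurable (borel \<Otimes>\<^sub>M borel)"
    unfolding borel_prod by (rule borel_measurable_continuous_onI)
  moreover have "sets (P \<Otimes>\<^sub>M P) = sets (borel \<Otimes>\<^sub>M borel)"
    by (intro sets_pair_measure_cong sets_P)
  ultimately show ?thesis
    by (simp cong: measurable_cong_sets)
qed

lemma abs_inner_k_le: "\<bar>f \<bullet> k x\<bar> \<le> norm f * sqrt \<kappa>"
  using Cauchy_Schwarz_ineq2[of f "k x"] mult_left_mono[OF norm_k_le norm_ge_zero, of f x] by linarith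

lemma integrable_inner_k [simp]: "integrable P (\<lambda>x. f \<bullet> k x)"
  by (rule integrable_const_bound[where B="norm f * sqrt \<kappa>"]) (auto intro: abs_inner_k_le)

abbreviation cen :: "'h \<Rightarrow> 'x \<Rightarrow> real" where
  "cen \<equiv> centred P fn"

lemma cen_eq: "cen f x = f \<bullet> k x - (\<integral>y. f \<bullet> k y \<partial>P)"
  by (simp add: centred_def fn_eq)

lemma cen_diff_eq: "cen f x - cen f y = f \<bullet> (k x - k y)"
  by (simp add: cen_eq inner_diff_right)

lemma measurable_cen [measurable]: "cen f \<in> borel_measurable P"
  unfolding cen_eq by measurable

lemma cen_add: "cen (f + g) x = cen f x + cen g x"
  by (simp add: cen_eq inner_add_left)

lemma cen_scaleR: "cen (r *\<^sub>R f) x = r * cen f x"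
  by (simp add: cen_eq algebra_simps)

lemma abs_cen_le: "\<bar>cen f x\<bar> \<le> 2 * sqrt \<kappa> * norm f"
proof -
  have "\<bar>\<integral>y. f \<bullet> k y \<partial>P\<bar> \<le> (\<integral>y. norm f * sqrt \<kappa> \<partial>P)"
    by (rule order_trans[OF integral_abs_bound integral_mono]) (auto intro: abs_inner_k_le)
  then have "\<bar>\<integral>y. f \<bullet> k y \<partial>P\<bar> \<le> norm f * sqrt \<kappa>"
    by (simp add: prob_space)
  moreover have "2 * sqrt \<kappa> * norm f = norm f * sqrt \<kappa> + norm f * sqrt \<kappa>"
    by simp
  ultimately show ?thesis
    using abs_inner_k_le[of f x] unfolding cen_eq by linarith
qed

lemma integrable_cen: "integrable P (cen f)"
  unfolding cen_eq by simp

lemma integral_cen: "(\<integral>x. cen f x \<partial>P) = 0"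
  unfolding cen_eq by (simp add: prob_space)

lemma L2_spaceD:
  assumes "g \<in> L2_space P"
  shows "g \<in> borel_measurable P" "integrable P (\<lambda>x. (g x)\<^sup>2)"
  using assms by (auto simp: L2_space_def)

lemma integrable_L2_mult:
  assumes "g \<in> L2_space P" "h \<in> L2_space P"
  shows "integrable P (\<lambda>x. g x * h x)"
proof (rule Bochner_Integration.integrable_bound)
  note [measurable] = L2_spaceD(1)[OF assms(1)] L2_spaceD(1)[OF assms(2)]
  show "integrable P (\<lambda>x. (g x)\<^sup>2 + (h x)\<^sup>2)"
    using assms by (intro Bochner_Integration.integrable_add L2_spaceD)
  show "(\<lambda>x. g x * h x) \<in> borel_measurable P"
    by measurable
  have "\<bar>a * b\<bar> \<le> a\<^sup>2 + b\<^sup>2" for a b :: real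
  proof -
    have "2 * (\<bar>a\<bar> * \<bar>b\<bar>) \<le> a\<^sup>2 + b\<^sup>2"
      using sum_squares_bound[of "\<bar>a\<bar>" "\<bar>b\<bar>"] by (simp add: mult.assoc)
    moreover have "0 \<le> \<bar>a\<bar> * \<bar>b\<bar>"
      by simp
    ultimately show ?thesis
      unfolding abs_mult by linarith
  qed
  then show "AE x in P. norm (g x * h x) \<le> norm ((g x)\<^sup>2 + (h x)\<^sup>2)"
    by simp
qed

lemma cen_L2: "cen f \<in> L2_space P"
proof -
  have "(cen f x)\<^sup>2 \<le> (2 * sqrt \<kappa> * norm f)\<^sup>2" for x
    using power_mono[OF abs_cen_le abs_ge_zero, of f x 2] by simp
  then have "integrable P (\<lambda>x. (cen f x)\<^sup>2)"
    by (intro integrable_const_bound[where B="(2 * sqrt \<kappa> * norm f)\<^sup>2"]) auto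
  then show ?thesis
    by (simp add: L2_space_def)
qed

lemma const_L2: "(\<lambda>_. 1) \<in> L2_space P"
  by (simp add: L2_space_def)

lemma integrable_L2: "g \<in> L2_space P \<Longrightarrow> integrable P g"
  using integrable_L2_mult[OF _ const_L2] by simp

abbreviation adj :: "('x \<Rightarrow> real) \<Rightarrow> 'h" where
  "adj \<equiv> centred_adj P fn"

text \<open>Riesz applies because \<open>cen f\<close> is uniformly bounded by a multiple of
  \<open>norm f\<close> and \<open>g\<close> is integrable under a probability measure.\<close>

lemma inner_adj:
  assumes g: "g \<in> L2_space P"
  shows "f \<bullet> adj g = (\<integral>x. cen f x * g x \<partial>P)"
proof -
  have "bounded_linear (\<lambda>f. L2_inner P (cen f) g)"
  proof (rule bounded_linear_intro)
    note int = integrable_L2_mult[OF cen_L2 g]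
    show "L2_inner P (cen (f + h)) g = L2_inner P (cen f) g + L2_inner P (cen h) g" for f h
      using int by (simp add: L2_inner_def cen_add algebra_simps)
    show "L2_inner P (cen (r *\<^sub>R f)) g = r *\<^sub>R L2_inner P (cen f) g" for r f
      by (simp add: L2_inner_def cen_scaleR mult.assoc)
    show "norm (L2_inner P (cen f) g) \<le> norm f * (2 * sqrt \<kappa> * (\<integral>x. \<bar>g x\<bar> \<partial>P))" for f
    proof -
      have "norm (L2_inner P (cen f) g) \<le> (\<integral>x. norm (cen f x * g x) \<partial>P)"
        unfolding L2_inner_def by (rule integral_norm_bound)
      also have "\<dots> \<le> (\<integral>x. (2 * sqrt \<kappa> * norm f) * \<bar>g x\<bar> \<partial>P)"
        using integrable_L2[OF g]
        by (intro integral_mono integrable_norm int) (auto simp: abs_mult intro!: mult_right_mono abs_cen_le)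
      finally show ?thesis
        by (simp add: ac_simps)
    qed
  qed
  from theI'[OF Riesz_representation[OF this]]
  show ?thesis
    by (simp add: centred_adj_def L2_inner_def)
qed

abbreviation \<Sigma> :: "'h \<Rightarrow>\<^sub>L 'h" where
  "\<Sigma> \<equiv> cov_op P fn"

text \<open>\<open>Blinfun\<close> can be evaluated only at a bounded linear map. The bound
  \<open>4 * \<kappa>\<close> comes from using \<open>abs_cen_le\<close> for both factors.\<close>

lemma cov_apply: "blinfun_apply \<Sigma> f = adj (cen f)"
  unfolding cov_op_def
proof (subst bounded_linear_Blinfun_apply)
  show "bounded_linear (\<lambda>f. adj (cen f))"
  proof (rule bounded_linear_intro)
    note int = integrable_L2_mult[OF cen_L2 cen_L2]
    show "adj (cen (f + g)) = adj (cen f) + adj (cen g)" for f g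
    proof (subst vector_eq_rdot[symmetric], intro allI)
      fix u
      show "adj (cen (f + g)) \<bullet> u = (adj (cen f) + adj (cen g)) \<bullet> u"
        using int by (simp add: inner_add_left inner_adj[OF cen_L2] inner_commute[of _ u] cen_add algebra_simps)
    qed
    show "adj (cen (r *\<^sub>R f)) = r *\<^sub>R adj (cen f)" for r f
    proof (subst vector_eq_rdot[symmetric], intro allI)
      fix u
      show "adj (cen (r *\<^sub>R f)) \<bullet> u = (r *\<^sub>R adj (cen f)) \<bullet> u"
        by (simp add: inner_adj[OF cen_L2] inner_commute[of _ u] cen_scaleR mult.left_commute)
    qed
    show "norm (adj (cen f)) \<le> norm f * (4 * \<kappa>)" for f
    proof -
      let ?u = "adj (cen f)"
      have "(norm ?u)\<^sup>2 = (\<integral>x. cen ?u x * cen f x \<partial>P)"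
        by (simp add: power2_norm_eq_inner inner_adj[OF cen_L2])
      also have "\<dots> \<le> (\<integral>x. (2 * sqrt \<kappa> * norm ?u) * (2 * sqrt \<kappa> * norm f) \<partial>P)"
      proof (intro integral_mono int)
        fix x
        have "cen ?u x * cen f x \<le> \<bar>cen ?u x\<bar> * \<bar>cen f x\<bar>"
          by (metis abs_ge_self abs_mult)
        also have "\<dots> \<le> (2 * sqrt \<kappa> * norm ?u) * (2 * sqrt \<kappa> * norm f)"
          using kappa_nonneg by (intro mult_mono abs_cen_le) auto
        finally show "cen ?u x * cen f x \<le> (2 * sqrt \<kappa> * norm ?u) * (2 * sqrt \<kappa> * norm f)" .
      qed simp
      also have "\<dots> = norm ?u * (norm f * (4 * \<kappa>))"
        using kappa_nonneg by (simp add: prob_space)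
      finally have "norm ?u * norm ?u \<le> norm ?u * (norm f * (4 * \<kappa>))"
        by (simp add: power2_eq_square)
      then show ?thesis
        using kappa_nonneg by (cases "?u = 0") auto
    qed
  qed
qed simp

lemma inner_cov: "f \<bullet> blinfun_apply \<Sigma> g = (\<integral>x. cen f x * cen g x \<partial>P)"
  by (simp add: cov_apply inner_adj[OF cen_L2])

lemma cov_self_adjoint: "blinfun_apply \<Sigma> f \<bullet> g = f \<bullet> blinfun_apply \<Sigma> g"
  by (subst inner_commute) (simp add: inner_cov mult.commute)

lemma AE_eq_0_if_integral_square:
  assumes "g \<in> L2_space P" "(\<integral>x. (g x)\<^sup>2 \<partial>P) = 0"
  shows "AE x in P. g x = 0"
  using integral_nonneg_eq_0_iff_AE[OF L2_spaceD(2)[OF assms(1)]] assms(2) by simp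

lemma L2_diff_scale:
  assumes "g \<in> L2_space P" "h \<in> L2_space P"
  shows "(\<lambda>x. g x - r * h x) \<in> L2_space P"
proof -
  note [measurable] = L2_spaceD(1)[OF assms(1)] L2_spaceD(1)[OF assms(2)]
  have "(g x - r * h x)\<^sup>2 = (g x)\<^sup>2 - 2 * r * (g x * h x) + r\<^sup>2 * (h x)\<^sup>2" for x
    by (simp add: power2_eq_square algebra_simps)
  then show ?thesis
    using L2_spaceD(2)[OF assms(1)] L2_spaceD(2)[OF assms(2)] integrable_L2_mult[OF assms]
    by (simp add: L2_space_def)
qed

section \<open>The topological support of the distribution\<close>

definition supp :: "'x set" where
  "supp = {x. \<forall>U. open U \<longrightarrow> x \<in> U \<longrightarrow> emeasure P U \<noteq> 0}"

text \<open>The complement of the support is covered by null sets of a countable basis.\<close>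

lemma AE_supp: "AE x in P. x \<in> supp"
proof -
  obtain \<B> :: "'x set set" where \<B>: "countable \<B>" "topological_basis \<B>"
    using ex_countable_basis by blast
  let ?N = "\<Union>U\<in>{U \<in> \<B>. emeasure P U = 0}. U"
  have "?N \<in> null_sets P"
    using \<B> sets_P by (intro null_sets_UN') (auto simp: null_sets_def topological_basis_open)
  moreover have "x \<in> ?N" if x: "x \<notin> supp" for x
  proof -
    obtain U where U: "open U" "x \<in> U" "emeasure P U = 0"
      using x by (auto simp: supp_def)
    then obtain V where V: "V \<in> \<B>" "x \<in> V" "V \<subseteq> U"
      using topological_basisE[OF \<B>(2)] by blast
    have "emeasure P V \<le> emeasure P U"
      using V(3) U(1) sets_P by (intro emeasure_mono) auto
    with U(3) V show ?thesis by auto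
  qed
  ultimately show ?thesis
    by (intro AE_I'[of ?N]) auto
qed

text \<open>The set where the continuous function \<open>cen f\<close> is nonzero is open and null,
  hence misses the support. Vanishing of \<open>cen f\<close> only makes \<open>f\<close> constant
  there, which is why differences of kernel sections appear.\<close>

lemma inner_k_diff_eq_0_if_cen_AE_0:
  assumes f: "AE x in P. cen f x = 0" and x: "x \<in> supp" and y: "y \<in> supp"
  shows "f \<bullet> (k x - k y) = 0"
proof -
  have "cen f z = 0" if "z \<in> supp" for z
  proof (rule ccontr)
    assume z: "cen f z \<noteq> 0"
    let ?U = "{z. cen f z \<noteq> 0}"
    have "continuous_on UNIV (cen f)"
      unfolding cen_eq by (intro continuous_intros continuous_on_k)
    then have "open ?U"
      by (intro open_Collect_neq) auto
    moreover have "emeasure P ?U = 0"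
      using f \<open>open ?U\<close> sets_P sets_eq_imp_space_eq[OF sets_P]
      by (subst (asm) AE_iff_measurable[of ?U]) auto
    ultimately show False
      using that z by (auto simp: supp_def)
  qed
  then show ?thesis
    using x y cen_diff_eq[of f x y] by simp
qed

end

section \<open>Spectral form of the covariance operator\<close>

locale kernel_eigen_system = bounded_kernel_space P fn K \<kappa>
  for P :: "'x::second_countable_topology measure" and fn :: "'h::{real_inner,banach} \<Rightarrow> 'x \<Rightarrow> real"
    and K \<kappa> +
  fixes l :: "nat \<Rightarrow> real" and \<psi> :: "nat \<Rightarrow> 'x \<Rightarrow> real" and lam :: real
  assumes eigen: "eigen_decomp P fn l \<psi>" and lam: "0 < lam"
begin

lemma l_pos: "0 < l i"
  using eigen by (simp add: eigen_decomp_def)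

lemma psi_L2: "\<psi> i \<in> L2_space P"
  using eigen by (simp add: eigen_decomp_def)

lemma psi_orthonormal: "(\<integral>x. \<psi> i x * \<psi> j x \<partial>P) = (if i = j then 1 else 0)"
  using eigen by (simp add: eigen_decomp_def L2_inner_def)

lemma eigen_expansion:
  "g \<in> L2_space P \<Longrightarrow>
    (\<lambda>n. \<integral>x. (cen (adj g) x - (\<Sum>i<n. l i * (\<integral>x. \<psi> i x * g x \<partial>P) * \<psi> i x))\<^sup>2 \<partial>P) \<longlonglongrightarrow> 0"
  using eigen by (simp add: eigen_decomp_def L2_inner_def integral_op_def)

text \<open>Applied to \<open>\<psi> j\<close>, the partial sums of the expansion no longer change
  once \<open>n > j\<close>, so a limit statement becomes an equality almost everywhere.\<close>

lemma cen_adj_psi: "AE x in P. cen (adj (\<psi> j)) x = l j * \<psi> j x"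
proof -
  have "(\<Sum>i<n. l i * (\<integral>x. \<psi> i x * \<psi> j x \<partial>P) * \<psi> i x) = l j * \<psi> j x" if "j < n" for n x
    using that by (simp add: psi_orthonormal if_distrib[of "\<lambda>c. _ * c"] if_distrib[of "\<lambda>c. c * _"] cong: if_cong)
  then have "eventually (\<lambda>n. (\<integral>x. (cen (adj (\<psi> j)) x - (\<Sum>i<n. l i * (\<integral>x. \<psi> i x * \<psi> j x \<partial>P) * \<psi> i x))\<^sup>2 \<partial>P)
      = (\<integral>x. (cen (adj (\<psi> j)) x - l j * \<psi> j x)\<^sup>2 \<partial>P)) sequentially"
    by (intro eventually_mono[OF eventually_gt_at_top[of j]]) simp
  then have "(\<integral>x. (cen (adj (\<psi> j)) x - l j * \<psi> j x)\<^sup>2 \<partial>P) = 0"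
    using LIMSEQ_unique[OF tendsto_eventually eigen_expansion[OF psi_L2, of j]] by simp
  then have "AE x in P. cen (adj (\<psi> j)) x - l j * \<psi> j x = 0"
    by (intro AE_eq_0_if_integral_square L2_diff_scale cen_L2 psi_L2)
  then show ?thesis
    by eventually_elim simp
qed

text \<open>The squared norm of \<open>adj (\<psi> i)\<close> is \<open>l i\<close>, hence the
  normalising factor.\<close>

definition e :: "nat \<Rightarrow> 'h" where
  "e i = (1 / sqrt (l i)) *\<^sub>R adj (\<psi> i)"

lemma inner_e_eq: "f \<bullet> e i = (\<integral>x. cen f x * \<psi> i x \<partial>P) / sqrt (l i)"
  by (simp add: e_def inner_adj[OF psi_L2])

lemma cen_e: "AE x in P. cen (e i) x = sqrt (l i) * \<psi> i x"
proof -
  have "l i / sqrt (l i) = sqrt (l i)"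
    using l_pos[of i] by (simp add: real_div_sqrt)
  then have "1 / sqrt (l i) * (l i * y) = sqrt (l i) * y" for y
    by (metis mult.assoc mult.commute mult.right_neutral times_divide_eq_right)
  with cen_adj_psi[of i] show ?thesis
    unfolding e_def cen_scaleR by (elim AE_mp) (auto intro!: AE_I2)
qed

lemma integral_cen_e:
  assumes [measurable]: "g \<in> borel_measurable P"
  shows "(\<integral>x. cen (e i) x * g x \<partial>P) = sqrt (l i) * (\<integral>x. \<psi> i x * g x \<partial>P)"
proof -
  note [measurable] = L2_spaceD(1)[OF psi_L2]
  have "(\<integral>x. cen (e i) x * g x \<partial>P) = (\<integral>x. sqrt (l i) * (\<psi> i x * g x) \<partial>P)"
    using cen_e[of i] by (intro integral_cong_AE) (auto elim!: AE_mp simp: mult.assoc)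
  then show ?thesis by simp
qed

sublocale orthonormal_seq e
proof
  show "e i \<bullet> e j = (if i = j then 1 else 0)" for i j
    using l_pos[of i] l_pos[of j] L2_spaceD(1)[OF psi_L2]
    by (simp add: inner_e_eq[of "e i"] integral_cen_e psi_orthonormal)
qed

lemma inner_cov_e: "f \<bullet> blinfun_apply \<Sigma> (e j) = l j * (f \<bullet> e j)"
proof -
  have "f \<bullet> blinfun_apply \<Sigma> (e j) = (\<integral>x. cen (e j) x * cen f x \<partial>P)"
    by (simp add: inner_cov mult.commute)
  also have "\<dots> = sqrt (l j) * (\<integral>x. cen f x * \<psi> j x \<partial>P)"
    by (subst integral_cen_e) (simp_all add: mult.commute)
  also have "\<dots> = l j * (f \<bullet> e j)"
    using l_pos[of j] by (simp add: inner_e_eq field_simps)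
  finally show ?thesis .
qed

text \<open>If \<open>f\<close> is orthogonal to all \<open>e i\<close>, then \<open>cen f\<close>
  is orthogonal to all \<open>\<psi> i\<close>, and the expansion makes
  \<open>cen (\<Sigma> f)\<close> vanish almost everywhere. The squared norm of
  \<open>\<Sigma> f\<close> is the integral of \<open>cen f * cen (\<Sigma> f)\<close>, which is
  therefore 0.\<close>

lemma cov_orthogonal:
  assumes f: "\<And>i. f \<bullet> e i = 0"
  shows "blinfun_apply \<Sigma> f = 0"
proof -
  have "(\<integral>x. \<psi> i x * cen f x \<partial>P) = 0" for i
    using f[of i] l_pos[of i] by (simp add: inner_e_eq mult.commute)
  then have "(\<lambda>n::nat. \<integral>x. (cen (adj (cen f)) x)\<^sup>2 \<partial>P) \<longlonglongrightarrow> 0"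
    using eigen_expansion[OF cen_L2, of f] by simp
  then have "(\<integral>x. (cen (adj (cen f)) x)\<^sup>2 \<partial>P) = 0"
    by (simp add: LIMSEQ_const_iff)
  then have AE0: "AE x in P. cen (blinfun_apply \<Sigma> f) x = 0"
    unfolding cov_apply by (intro AE_eq_0_if_integral_square cen_L2)
  have "f \<bullet> blinfun_apply \<Sigma> (blinfun_apply \<Sigma> f) = (\<integral>x. 0 \<partial>P)"
    unfolding inner_cov using AE0 by (intro integral_cong_AE) (auto elim!: AE_mp)
  then have "blinfun_apply \<Sigma> f \<bullet> blinfun_apply \<Sigma> f = 0"
    by (simp add: cov_self_adjoint)
  then show ?thesis by simp
qed

text \<open>The variance of \<open>f\<close> is its quadratic form under \<open>\<Sigma>\<close>,
  which is 0 on the complement of the \<open>e i\<close>.\<close>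

lemma inner_k_diff_orthogonal:
  assumes f: "\<And>i. f \<bullet> e i = 0" and "x \<in> supp" "y \<in> supp"
  shows "f \<bullet> (k x - k y) = 0"
proof -
  have "(\<integral>x. (cen f x)\<^sup>2 \<partial>P) = f \<bullet> blinfun_apply \<Sigma> f"
    by (simp add: inner_cov power2_eq_square)
  then have "AE x in P. cen f x = 0"
    using cov_orthogonal[OF f] by (intro AE_eq_0_if_integral_square cen_L2) simp
  then show ?thesis
    using assms(2,3) by (rule inner_k_diff_eq_0_if_cen_AE_0)
qed

lemma l_le: "l i \<le> l 0"
  using eigen by (simp add: eigen_decomp_def decseq_def)

lemma bounded_l: "bounded (range l)"
  unfolding bounded_iff using l_le l_pos by (intro exI[of _ "l 0"]) (auto simp: abs_of_pos)

lemma cov_eq: "\<Sigma> = diag_op 0 l"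
  by (rule diag_op_eqI[OF bounded_l]) (simp_all add: cov_self_adjoint inner_cov_e cov_orthogonal)

abbreviation R :: "'h \<Rightarrow>\<^sub>L 'h" where
  "R \<equiv> cov_inv_sqrt P fn lam"

definition w :: "nat \<Rightarrow> real" where
  "w i = l i / (l i + lam)"

lemma l_lam_pos: "0 < l i + lam"
  using l_pos[of i] lam by simp

lemma bounded_inv: "bounded (range (\<lambda>i. inverse (l i + lam)))"
  using l_lam_pos l_pos lam
  by (intro bounded_range_if_le[where \<beta>="inverse lam"]) (auto intro!: le_imp_inverse_le less_imp_le)

lemma bounded_inv_sqrt: "bounded (range (\<lambda>i. sqrt (inverse (l i + lam))))"
  using l_lam_pos l_pos lam
  by (intro bounded_range_if_le[where \<beta>="sqrt (inverse lam)"])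
    (auto intro!: le_imp_inverse_le real_sqrt_le_mono less_imp_le simp del: real_sqrt_inverse)

text \<open>On the complement of the \<open>e i\<close> the regularised operator is
  \<open>lam\<close>, so its inverse root there is \<open>sqrt (inverse lam)\<close>. All diagonal
  values are at least \<open>lam\<close>, which bounds the inverses.\<close>

lemma R_eq: "R = diag_op (sqrt (inverse lam)) (\<lambda>i. sqrt (inverse (l i + lam)))"
proof -
  have b: "bounded (range (\<lambda>i. l i + lam))"
    using l_le l_lam_pos by (intro bounded_range_if_le[where \<beta>="l 0 + lam"]) (auto intro: less_imp_le)
  have "\<Sigma> + lam *\<^sub>R id_blinfun = diag_op lam (\<lambda>i. l i + lam)"
    unfolding cov_eq
    by (rule diag_op_eqI[OF b])
      (simp_all add: blinfun.add_left blinfun.scaleR_left inner_add_left inner_diag_op_e[OF bounded_l]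
        inner_diag_op_orthogonal[OF bounded_l] algebra_simps)
  then show ?thesis
    unfolding cov_inv_sqrt_def
    using op_inverse_diag_op[OF b bounded_inv] op_sqrt_diag_op[OF bounded_inv] lam l_lam_pos
    by (simp add: less_imp_neq[symmetric])
qed

lemma R_self_adjoint: "blinfun_apply R u \<bullet> v = u \<bullet> blinfun_apply R v"
  unfolding R_eq by (rule diag_op_self_adjoint[OF bounded_inv_sqrt])

lemma inner_R_e: "u \<bullet> blinfun_apply R (e p) = (u \<bullet> e p) / sqrt (l p + lam)"
  unfolding R_self_adjoint[symmetric] unfolding R_eq inner_diag_op_e[OF bounded_inv_sqrt]
  by (simp add: real_sqrt_inverse divide_inverse mult.commute)

lemma inner_R_orthogonal:
  "(\<And>i. g \<bullet> e i = 0) \<Longrightarrow> blinfun_apply R u \<bullet> g = sqrt (inverse lam) * (u \<bullet> g)"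
  unfolding R_eq by (rule inner_diag_op_orthogonal[OF bounded_inv_sqrt])

lemma w_pos: "0 < w i"
  using l_pos l_lam_pos by (simp add: w_def)

lemma w_nonneg: "0 \<le> w i"
  using w_pos less_imp_le by blast

lemma w_le_1: "w i \<le> 1"
  using l_lam_pos[of i] lam by (simp add: w_def)

lemma bounded_w: "bounded (range w)"
  using w_nonneg w_le_1 by (rule bounded_range_if_le)

lemma whitened_cov_eq: "R o\<^sub>L \<Sigma> o\<^sub>L R = diag_op 0 w"
proof -
  have "sqrt (inverse (l i + lam)) * l i * sqrt (inverse (l i + lam)) = w i" for i
  proof -
    have "sqrt (inverse (l i + lam)) * l i * sqrt (inverse (l i + lam))
        = l i * (sqrt (inverse (l i + lam)) * sqrt (inverse (l i + lam)))"
      by (simp only: ac_simps)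
    also have "\<dots> = w i"
      using l_lam_pos[of i] by (subst real_sqrt_mult_self) (simp add: w_def divide_inverse)
    finally show ?thesis .
  qed
  then show ?thesis
    unfolding R_eq cov_eq
    by (simp add: diag_op_compose bounded_inv_sqrt bounded_l bounded_range_mult del: real_sqrt_inverse)
qed

lemma N1_eq: "N1 P fn lam = op_trace (diag_op 0 w)"
  by (simp add: N1_def whitened_cov_eq)

end

section \<open>Concentration of the whitened covariance\<close>

lemma (in prob_space) integral_square_diff_mean_le:
  fixes h :: "'a \<Rightarrow> real"
  assumes h: "integrable M h" "integrable M (\<lambda>z. (h z)\<^sup>2)" and b: "expectation h = b"
  shows "integrable M (\<lambda>z. (h z - b)\<^sup>2)"
    and "expectation (\<lambda>z. (h z - b)\<^sup>2) \<le> expectation (\<lambda>z. (h z)\<^sup>2)"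
proof -
  have eq: "(h z - b)\<^sup>2 = (h z)\<^sup>2 - 2 * b * h z + b\<^sup>2" for z
    by (simp add: power2_eq_square algebra_simps)
  show "integrable M (\<lambda>z. (h z - b)\<^sup>2)"
    unfolding eq using h by simp
  have "expectation (\<lambda>z. (h z - b)\<^sup>2) = expectation (\<lambda>z. (h z)\<^sup>2) - b\<^sup>2"
    unfolding eq using h by (simp add: prob_space b power2_eq_square)
  then show "expectation (\<lambda>z. (h z - b)\<^sup>2) \<le> expectation (\<lambda>z. (h z)\<^sup>2)"
    by simp
qed

context kernel_eigen_system
begin

text \<open>For \<open>z = (x, y)\<close>, the numbers \<open>c p z\<close> are the coordinates of the whitened difference \<open>d\<close> of \<open>k x\<close> and \<open>k y\<close>;
  \<open>H n z\<close> and \<open>\<xi> (p, q) z\<close> below are the Hilbert-Schmidt norm of the truncation of \<open>d \<otimes> d / 2\<close> to the first \<open>n\<close>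
  coordinates and the centred entries of \<open>d \<otimes> d / 2\<close>.\<close>

definition c :: "nat \<Rightarrow> 'x \<times> 'x \<Rightarrow> real" where
  "c p z = (k (fst z) - k (snd z)) \<bullet> e p / sqrt (l p + lam)"

lemma c_eq: "c p z = (cen (e p) (fst z) - cen (e p) (snd z)) / sqrt (l p + lam)"
  by (simp add: c_def cen_diff_eq inner_commute)

lemma measurable_c [measurable]: "c p \<in> borel_measurable (P \<Otimes>\<^sub>M P)"
  unfolding c_eq by measurable

definition H :: "nat \<Rightarrow> 'x \<times> 'x \<Rightarrow> real" where
  "H n z = (\<Sum>p<n. (c p z)\<^sup>2) / 2"

text \<open>A difference of kernel sections has squared norm at most \<open>4 * \<kappa>\<close>,
  whitening divides each squared coordinate by at least \<open>lam\<close>, and Bessel's inequality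
  makes the bound uniform in \<open>n\<close>.\<close>

lemma H_le_kappa: "H n z \<le> 2 * \<kappa> / lam"
proof -
  define d where "d = k (fst z) - k (snd z)"
  have "norm d \<le> 2 * sqrt \<kappa>"
    using norm_triangle_ineq4[of "k (fst z)" "k (snd z)"] norm_k_le[of "fst z"] norm_k_le[of "snd z"]
    unfolding d_def by linarith
  then have d: "(norm d)\<^sup>2 \<le> 4 * \<kappa>"
    using power_mono[of "norm d" "2 * sqrt \<kappa>" 2] kappa_nonneg by (simp add: power_mult_distrib)
  have "(c p z)\<^sup>2 \<le> (d \<bullet> e p)\<^sup>2 / lam" for p
    unfolding c_def d_def[symmetric] power_divide using l_lam_pos[of p] l_pos[of p] lam
    by (simp add: divide_left_mono)
  then have "(\<Sum>p<n. (c p z)\<^sup>2) \<le> (\<Sum>p<n. (d \<bullet> e p)\<^sup>2 / lam)"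
    by (rule sum_mono)
  also have "\<dots> = (\<Sum>p<n. (d \<bullet> e p)\<^sup>2) / lam"
    by (simp add: sum_divide_distrib)
  also have "\<dots> \<le> 4 * \<kappa> / lam"
    using d sum_inner_e_le[of "{..<n}" d] lam by (intro divide_right_mono) auto
  finally show ?thesis
    by (simp add: H_def)
qed

lemma abs_c_le: "\<bar>c p z\<bar> \<le> sqrt (4 * \<kappa> / lam)"
proof -
  have "(c p z)\<^sup>2 \<le> (\<Sum>p<Suc p. (c p z)\<^sup>2)"
    by (simp add: sum_nonneg)
  also have "\<dots> \<le> 4 * \<kappa> / lam"
    using H_le_kappa[of "Suc p" z] by (simp add: H_def)
  finally have "sqrt ((c p z)\<^sup>2) \<le> sqrt (4 * \<kappa> / lam)"
    by (rule real_sqrt_le_mono)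
  then show ?thesis by simp
qed

sublocale PP: pair_prob_space P P
  by unfold_locales

lemma integrable_c_mult: "integrable (P \<Otimes>\<^sub>M P) (\<lambda>z. c p z * c q z)"
proof (rule PP.integrable_const_bound[where B="sqrt (4 * \<kappa> / lam) * sqrt (4 * \<kappa> / lam)"])
  show "AE z in P \<Otimes>\<^sub>M P. norm (c p z * c q z) \<le> sqrt (4 * \<kappa> / lam) * sqrt (4 * \<kappa> / lam)"
    unfolding real_norm_def abs_mult using kappa_nonneg lam by (intro AE_I2 mult_mono abs_c_le) auto
qed measurable

text \<open>For independent \<open>x\<close> and \<open>y\<close>, half the product of the
  differences of two functions has their covariance as mean. This is the origin of the factor 1/2 in
  the empirical covariance.\<close>

lemma integral_c_mult: "(\<integral>z. c p z * c q z / 2 \<partial>(P \<Otimes>\<^sub>M P)) = (if p = q then w p else 0)"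
proof -
  let ?a = "cen (e p)" and ?b = "cen (e q)"
  let ?r = "sqrt (l p + lam) * sqrt (l q + lam)"
  have ab: "(\<integral>x. ?a x * ?b x \<partial>P) = (if p = q then l p else 0)"
    using inner_cov_e[of "e p" q] by (simp add: inner_cov inner_e)
  note int = integrable_L2_mult[OF cen_L2[of "e p"] cen_L2[of "e q"]] integrable_cen integral_cen
  have inner: "(\<integral>y. c p (x, y) * c q (x, y) \<partial>P) = (?a x * ?b x + (\<integral>y. ?a y * ?b y \<partial>P)) / ?r" for x
  proof -
    have "c p (x, y) * c q (x, y) = (?a x * ?b x - ?a x * ?b y - ?b x * ?a y + ?a y * ?b y) / ?r" for y
      by (simp add: c_eq algebra_simps)
    then show ?thesis
      using int by (simp add: prob_space)
  qed
  have "(\<integral>z. c p z * c q z \<partial>(P \<Otimes>\<^sub>M P)) = (\<integral>x. (\<integral>y. c p (x, y) * c q (x, y) \<partial>P) \<partial>P)"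
    by (rule PP.integral_fst'[OF integrable_c_mult, symmetric])
  also have "\<dots> = 2 * (\<integral>x. ?a x * ?b x \<partial>P) / ?r"
    unfolding inner using int by (simp add: prob_space)
  also have "\<dots> = 2 * (if p = q then w p else 0)"
    using l_lam_pos[of p] l_lam_pos[of q] by (simp add: ab w_def)
  finally show ?thesis by simp
qed

lemma integral_H: "(\<integral>z. H n z \<partial>(P \<Otimes>\<^sub>M P)) = (\<Sum>p<n. w p)"
proof -
  have "(\<integral>z. H n z \<partial>(P \<Otimes>\<^sub>M P)) = (\<Sum>p<n. \<integral>z. c p z * c p z / 2 \<partial>(P \<Otimes>\<^sub>M P))"
    unfolding H_def using integrable_c_mult
    by (simp add: power2_eq_square sum_divide_distrib del: integral_divide_zero)
  then show ?thesis
    unfolding integral_c_mult by simp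
qed

lemma integrable_H: "integrable (P \<Otimes>\<^sub>M P) (H n)"
  unfolding H_def power2_eq_square using integrable_c_mult by simp

text \<open>The sum of the weights is the mean of \<open>H n\<close>, so a uniform bound on
  \<open>H n\<close> passes to it. With \<open>H_le_kappa\<close> this also supplies the summability
  behind the trace.\<close>

lemma sum_w_le:
  assumes "\<And>z. H n z \<le> M"
  shows "(\<Sum>p<n. w p) \<le> M"
proof -
  have "(\<Sum>p<n. w p) \<le> (\<integral>z. M \<partial>(P \<Otimes>\<^sub>M P))"
    unfolding integral_H[symmetric] using assms integrable_H by (intro integral_mono) auto
  then show ?thesis
    by (simp add: PP.prob_space)
qed

lemma sum_w_le_N1: "(\<Sum>p<n. w p) \<le> N1 P fn lam"
  unfolding N1_eq using w_nonneg w_le_1 sum_w_le[OF H_le_kappa] by (rule sum_weights_le_trace)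

lemma N1_pos: "0 < N1 P fn lam"
  using sum_w_le_N1[of 1] w_pos[of 0] by simp

definition \<xi> :: "nat \<times> nat \<Rightarrow> 'x \<times> 'x \<Rightarrow> real" where
  "\<xi> a z = c (fst a) z * c (snd a) z / 2 - (if fst a = snd a then w (fst a) else 0)"

lemma measurable_xi [measurable]: "\<xi> a \<in> borel_measurable (P \<Otimes>\<^sub>M P)"
  unfolding \<xi>_def by measurable

lemma integral_xi: "integral\<^sup>L (P \<Otimes>\<^sub>M P) (\<xi> a) = 0"
  unfolding \<xi>_def using integrable_c_mult integral_c_mult by (simp add: PP.prob_space)

text \<open>A rank-one operator \<open>d \<otimes> d\<close> has Hilbert-Schmidt norm equal to the
  squared norm of \<open>d\<close>.\<close>

lemma sum_square_c:
  "(\<Sum>a\<in>{..<n} \<times> {..<n}. (c (fst a) z * c (snd a) z / 2)\<^sup>2) = (H n z)\<^sup>2"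
proof -
  have "(\<Sum>a\<in>{..<n} \<times> {..<n}. (c (fst a) z * c (snd a) z / 2)\<^sup>2)
      = (\<Sum>p<n. \<Sum>q<n. ((c p z)\<^sup>2 / 2) * ((c q z)\<^sup>2 / 2))"
    by (simp add: sum.cartesian_product case_prod_unfold power2_eq_square ac_simps)
  also have "\<dots> = (H n z)\<^sup>2"
    by (simp add: H_def power2_eq_square sum_product sum_divide_distrib)
  finally show ?thesis .
qed

lemma H_nonneg: "0 \<le> H n z"
  by (simp add: H_def sum_nonneg)

text \<open>One \<open>M\<close> bounds the uncentred matrix. The other bounds its mean, a diagonal
  matrix whose Euclidean norm is at most its trace.\<close>

lemma L2_set_xi_le:
  assumes M: "\<And>z. H n z \<le> M"
  shows "L2_set (\<lambda>a. \<xi> a z) ({..<n} \<times> {..<n}) \<le> 2 * M"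
proof -
  let ?A = "{..<n} \<times> {..<n}"
  let ?w = "\<lambda>a::nat \<times> nat. if fst a = snd a then w (fst a) else 0"
  have "L2_set (\<lambda>a. \<xi> a z) ?A = L2_set (\<lambda>a. c (fst a) z * c (snd a) z / 2 + (- ?w a)) ?A"
    by (simp add: \<xi>_def)
  also have "\<dots> \<le> L2_set (\<lambda>a. c (fst a) z * c (snd a) z / 2) ?A + L2_set (\<lambda>a. - ?w a) ?A"
    by (rule L2_set_triangle_ineq)
  also have "L2_set (\<lambda>a. c (fst a) z * c (snd a) z / 2) ?A = H n z"
    unfolding L2_set_def sum_square_c using H_nonneg by simp
  also have "L2_set (\<lambda>a. - ?w a) ?A = L2_set ?w ?A"
    by (simp add: L2_set_def)
  also have "\<dots> \<le> (\<Sum>a\<in>?A. ?w a)"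
    using w_nonneg by (intro L2_set_le_sum) auto
  also have "\<dots> = (\<Sum>p<n. w p)"
    unfolding sum.cartesian_product' by simp
  finally show ?thesis
    using M[of z] sum_w_le[OF M] by linarith
qed

text \<open>Centring each entry only lowers its second moment. Then
  \<open>H\<^sup>2 \<le> M * H\<close>, and the mean of \<open>H\<close> is a partial trace.\<close>

lemma integral_sum_square_xi_le:
  assumes M: "\<And>z. H n z \<le> M"
  shows "(\<integral>z. (\<Sum>a\<in>{..<n} \<times> {..<n}. (\<xi> a z)\<^sup>2) \<partial>(P \<Otimes>\<^sub>M P)) \<le> M * N1 P fn lam"
proof -
  let ?A = "{..<n} \<times> {..<n}"
  let ?h = "\<lambda>a z. c (fst a) z * c (snd a) z / 2"
  have int_h: "integrable (P \<Otimes>\<^sub>M P) (?h a)" for a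
    using integrable_c_mult by simp
  have int_h2: "integrable (P \<Otimes>\<^sub>M P) (\<lambda>z. (?h a z)\<^sup>2)" for a
  proof (rule PP.integrable_const_bound[where B="(sqrt (4 * \<kappa> / lam) * sqrt (4 * \<kappa> / lam) / 2)\<^sup>2"])
    have "\<bar>?h a z\<bar> \<le> sqrt (4 * \<kappa> / lam) * sqrt (4 * \<kappa> / lam) / 2" for z
    proof -
      have "\<bar>c (fst a) z\<bar> * \<bar>c (snd a) z\<bar> \<le> sqrt (4 * \<kappa> / lam) * sqrt (4 * \<kappa> / lam)"
        using kappa_nonneg lam by (intro mult_mono abs_c_le) auto
      then show ?thesis by (simp add: abs_mult)
    qed
    from power_mono[OF this abs_ge_zero, where n=2]
    show "AE z in P \<Otimes>\<^sub>M P. norm ((?h a z)\<^sup>2) \<le> (sqrt (4 * \<kappa> / lam) * sqrt (4 * \<kappa> / lam) / 2)\<^sup>2"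
      by (intro AE_I2) (simp only: real_norm_def power_abs)
  qed measurable
  have "integrable (P \<Otimes>\<^sub>M P) (\<lambda>z. (\<xi> a z)\<^sup>2)"
    "(\<integral>z. (\<xi> a z)\<^sup>2 \<partial>(P \<Otimes>\<^sub>M P)) \<le> (\<integral>z. (?h a z)\<^sup>2 \<partial>(P \<Otimes>\<^sub>M P))" for a
    unfolding \<xi>_def using PP.integral_square_diff_mean_le[OF int_h int_h2 integral_c_mult, of "a"] by auto
  then have "(\<integral>z. (\<Sum>a\<in>?A. (\<xi> a z)\<^sup>2) \<partial>(P \<Otimes>\<^sub>M P)) \<le> (\<Sum>a\<in>?A. \<integral>z. (?h a z)\<^sup>2 \<partial>(P \<Otimes>\<^sub>M P))"
    by (simp add: sum_mono)
  also have "\<dots> = (\<integral>z. (H n z)\<^sup>2 \<partial>(P \<Otimes>\<^sub>M P))"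
    unfolding sum_square_c[symmetric] using int_h2 by (intro Bochner_Integration.integral_sum[symmetric]) auto
  also have "\<dots> \<le> (\<integral>z. M * H n z \<partial>(P \<Otimes>\<^sub>M P))"
  proof (rule integral_mono)
    show "integrable (P \<Otimes>\<^sub>M P) (\<lambda>z. (H n z)\<^sup>2)"
      unfolding sum_square_c[symmetric] using int_h2 by (intro Bochner_Integration.integrable_sum) auto
    show "(H n z)\<^sup>2 \<le> M * H n z" for z
      unfolding power2_eq_square using M H_nonneg by (rule mult_right_mono)
  qed (use integrable_H in simp)
  also have "\<dots> = M * (\<Sum>p<n. w p)"
    by (simp add: integral_H)
  also have "\<dots> \<le> M * N1 P fn lam"
    using order_trans[OF H_nonneg M] by (intro mult_left_mono sum_w_le_N1)
  finally show ?thesis .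
qed

end

text \<open>Writing \<open>\<epsilon> = x + y\<close> for the two summands of the radius,
  \<open>x\<close> pays for the range term and \<open>y\<close> for the variance term:
  \<open>m * x \<ge> 4 * M * L\<close> and \<open>m * y\<^sup>2 \<ge> 2 * M * N * L\<close>. With
  \<open>m \<ge> s / 3\<close> these would hold with 12 and 6 in place of 16 and 8.\<close>

lemma Bernstein_exponent_ge:
  fixes M N L L\<^sub>1 L\<^sub>2 :: real and m s :: nat
  assumes M: "0 < M" and N: "0 < N" and L: "0 \<le> L" "L \<le> L\<^sub>1" "L \<le> L\<^sub>2"
    and s: "0 < s" "s \<le> 3 * m"
    and \<epsilon>: "\<epsilon> = 16 * M * L\<^sub>1 / real s + sqrt (8 * M * N * L\<^sub>2 / real s)"
  shows "L \<le> real m * \<epsilon>\<^sup>2 / (2 * (M * N + 2 * M * \<epsilon>))"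
proof -
  define x y where "x = 16 * M * L\<^sub>1 / real s" and "y = sqrt (8 * M * N * L\<^sub>2 / real s)"
  have xy: "0 \<le> x" "0 \<le> y" and e: "\<epsilon> = x + y"
    using M N L s by (auto simp: x_def y_def \<epsilon>)
  have ms: "1 / 3 \<le> real m / real s"
    using s by (simp add: field_simps)
  have "4 * M * L \<le> (16 * M * L\<^sub>1) * (1 / 3)"
    using M L mult_left_mono[OF L(2), of M] by simp
  also have "\<dots> \<le> (16 * M * L\<^sub>1) * (real m / real s)"
    using M L ms by (intro mult_left_mono) auto
  also have "\<dots> = real m * x"
    by (simp add: x_def)
  finally have mx: "4 * M * L \<le> real m * x" .
  have "2 * M * N * L \<le> (8 * M * N * L\<^sub>2) * (1 / 3)"
    using M N L mult_left_mono[OF L(3), of "M * N"] by simp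
  also have "\<dots> \<le> (8 * M * N * L\<^sub>2) * (real m / real s)"
    using M N L ms by (intro mult_left_mono) auto
  also have "\<dots> = real m * y\<^sup>2"
    using M N L by (simp add: y_def)
  finally have my: "2 * M * N * L \<le> real m * y\<^sup>2" .
  have "L * (2 * (M * N + 2 * M * \<epsilon>)) = 2 * M * N * L + 4 * M * L * \<epsilon>"
    by (simp add: algebra_simps)
  also have "\<dots> \<le> real m * y\<^sup>2 + real m * x * \<epsilon>"
    using mx my xy by (intro add_mono mult_right_mono) (auto simp: e)
  also have "\<dots> \<le> real m * \<epsilon>\<^sup>2"
  proof -
    have "0 \<le> real m * (x * y)"
      using xy by simp
    then show ?thesis
      by (simp add: e power2_eq_square algebra_simps)
  qed
  finally show ?thesis
    using M N xy by (simp add: e pos_le_divide_eq add_pos_nonneg)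
qed

section \<open>The whitened error and its concentration\<close>

context kernel_eigen_system
begin

abbreviation D :: "nat \<Rightarrow> (nat \<Rightarrow> 'x) \<Rightarrow> 'h \<Rightarrow>\<^sub>L 'h" where
  "D s Y \<equiv> whitened_error P fn K lam s Y"

lemma D_apply:
  "blinfun_apply (D s Y) f = blinfun_apply R (blinfun_apply (emp_cov fn K s Y) (blinfun_apply R f))
    - blinfun_apply (diag_op 0 w) f"
  by (simp add: whitened_error_def blinfun.diff_left blinfun.diff_right flip: whitened_cov_eq)

lemma emp_cov_apply:
  "blinfun_apply (emp_cov fn K s Y) f = (1 / (2 * real s * (real s - 1))) *\<^sub>R
    (\<Sum>i<s. \<Sum>j\<in>{..<s} - {i}. ((k (Y i) - k (Y j)) \<bullet> f) *\<^sub>R (k (Y i) - k (Y j)))"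
  by (simp add: emp_cov_def blinfun.scaleR_left blinfun.sum_left rank_one.rep_eq)

lemma inner_emp_cov:
  "blinfun_apply (emp_cov fn K s Y) f \<bullet> g = (1 / (2 * real s * (real s - 1))) *
    (\<Sum>i<s. \<Sum>j\<in>{..<s} - {i}. ((k (Y i) - k (Y j)) \<bullet> f) * ((k (Y i) - k (Y j)) \<bullet> g))"
  by (simp add: emp_cov_apply inner_sum_left)

lemma inner_D:
  "blinfun_apply (D s Y) f \<bullet> g = blinfun_apply (emp_cov fn K s Y) (blinfun_apply R f) \<bullet> blinfun_apply R g
    - blinfun_apply (diag_op 0 w) f \<bullet> g"
  by (simp add: D_apply inner_diff_left R_self_adjoint)

lemma D_self_adjoint: "blinfun_apply (D s Y) f \<bullet> g = f \<bullet> blinfun_apply (D s Y) g"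
proof -
  have "blinfun_apply (D s Y) f \<bullet> g = blinfun_apply (D s Y) g \<bullet> f"
    unfolding inner_D inner_emp_cov
    using diag_op_self_adjoint[OF bounded_w, of 0 f g] by (simp add: inner_commute mult.commute)
  then show ?thesis
    by (simp add: inner_commute)
qed

text \<open>The 1/2 of \<open>emp_cov\<close> goes into the kernel, and the mean is distributed over
  the \<open>s * (s - 1)\<close> ordered pairs, so each entry is a U-statistic of a centred
  kernel.\<close>

lemma inner_D_e:
  assumes s: "2 \<le> s"
  shows "blinfun_apply (D s Y) (e p) \<bullet> e q
    = (\<Sum>i<s. \<Sum>j\<in>{..<s} - {i}. \<xi> (p, q) (Y i, Y j)) / (real s * (real s - 1))"
proof -
  let ?w = "if p = q then w p else 0"
  have "(\<Sum>i<s. \<Sum>j\<in>{..<s} - {i}. \<xi> (p, q) (Y i, Y j))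
      = (\<Sum>i<s. \<Sum>j\<in>{..<s} - {i}. c p (Y i, Y j) * c q (Y i, Y j) / 2) - real s * (real s - 1) * ?w"
  proof -
    have "(\<Sum>i<s. \<Sum>j\<in>{..<s} - {i}. ?w) = real s * (real s - 1) * ?w"
      using s by (simp add: of_nat_diff)
    then show ?thesis
      by (simp add: \<xi>_def sum_subtractf)
  qed
  moreover have "blinfun_apply (emp_cov fn K s Y) (blinfun_apply R (e p)) \<bullet> blinfun_apply R (e q)
      = (\<Sum>i<s. \<Sum>j\<in>{..<s} - {i}. c p (Y i, Y j) * c q (Y i, Y j) / 2) / (real s * (real s - 1))"
    unfolding inner_emp_cov inner_R_e
    by (simp add: c_def sum_divide_distrib[symmetric] sum_distrib_left[symmetric])
  moreover have "blinfun_apply (diag_op 0 w) (e p) \<bullet> e q = ?w"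
    by (simp add: inner_diag_op_e[OF bounded_w] inner_e)
  ultimately show ?thesis
    using s unfolding inner_D by (simp add: diff_divide_distrib)
qed

text \<open>\<open>R\<close> is a scalar on the complement of the \<open>e i\<close>, so it cannot
  move the range of the empirical covariance out of their closed span.\<close>

lemma D_orthogonal:
  assumes Y: "\<And>i. i < s \<Longrightarrow> Y i \<in> supp" and g: "\<And>i. g \<bullet> e i = 0"
  shows "blinfun_apply (D s Y) f \<bullet> g = 0"
proof -
  have "(k (Y i) - k (Y j)) \<bullet> g = 0" if "i < s" "j < s" for i j
    using inner_k_diff_orthogonal[OF g Y[OF that(1)] Y[OF that(2)]] by (simp add: inner_commute)
  then have "blinfun_apply (emp_cov fn K s Y) (blinfun_apply R f) \<bullet> g = 0"
    unfolding inner_emp_cov by simp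
  then show ?thesis
    by (simp add: D_apply inner_diff_left inner_R_orthogonal[OF g] inner_diag_op_orthogonal[OF bounded_w g])
qed

text \<open>A non-measurable event has \<open>measure\<close> 0, so measurability is needed for every sample, also outside the
  support of \<open>P\<close>, where the entries in the \<open>e i\<close> do not determine the norm. Parseval's identity in \<open>some_onb\<close>
  gives a closed formula.\<close>

lemma hs_norm_D_measurable:
  "(\<lambda>Y. hs_norm (D s Y)) \<in> borel_measurable (\<Pi>\<^sub>M i\<in>{..<s}. P)"
proof -
  define A where "A = Sigma {..<s} (\<lambda>i. {..<s} - {i})"
  define r where "r = 1 / (2 * real s * (real s - 1))"
  define d where "d Y a = k (Y (fst a)) - k (Y (snd a))" for Y :: "nat \<Rightarrow> 'x" and a
  let ?W = "diag_op 0 w"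
  let ?v = "\<lambda>Y a. blinfun_apply R (d Y a)"
  have A: "finite A"
    by (simp add: A_def)
  obtain T where T: "((\<lambda>f. (norm (blinfun_apply ?W f))\<^sup>2) has_sum T) some_onb"
    using weights_norm_summable[OF w_nonneg w_le_1 sum_w_le[OF H_le_kappa]] by (auto simp: summable_on_def)
  define F where "F Y = r\<^sup>2 * (\<Sum>a\<in>A. \<Sum>b\<in>A. (?v Y a \<bullet> ?v Y b) * (?v Y a \<bullet> ?v Y b))
      - 2 * r * (\<Sum>a\<in>A. ?v Y a \<bullet> blinfun_apply ?W (?v Y a)) + T" for Y
  have "hs_norm (D s Y) = ereal (sqrt (F Y))" for Y
  proof (rule hs_norm_eq_if_has_sum)
    have "blinfun_apply (D s Y) f = r *\<^sub>R (\<Sum>a\<in>A. (?v Y a \<bullet> f) *\<^sub>R ?v Y a) - blinfun_apply ?W f" for f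
      unfolding D_apply emp_cov_apply r_def
      by (simp add: blinfun.scaleR_right blinfun.sum_right R_self_adjoint A_def d_def sum.Sigma case_prod_unfold)
    then show "((\<lambda>f. (norm (blinfun_apply (D s Y) f))\<^sup>2) has_sum F Y) some_onb"
      unfolding F_def
      using norm_rank_one_sum_minus_has_sum[OF A diag_op_self_adjoint[OF bounded_w] T, of r "?v Y"] by simp
  qed
  moreover have "F \<in> borel_measurable (\<Pi>\<^sub>M i\<in>{..<s}. P)"
  proof -
    have kk: "(\<lambda>Y. blinfun_apply B (k (Y i)) \<bullet> k (Y j)) \<in> borel_measurable (\<Pi>\<^sub>M i\<in>{..<s}. P)"
      if "i < s" "j < s" for B :: "'h \<Rightarrow>\<^sub>L 'h" and i j
    proof -
      have "(\<lambda>Y. (Y i, Y j)) \<in> (\<Pi>\<^sub>M i\<in>{..<s}. P) \<rightarrow>\<^sub>M P \<Otimes>\<^sub>M P"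
        using that by (intro measurable_Pair measurable_component_singleton) auto
      from measurable_compose[OF this measurable_blinfun_k_k[of B]] show ?thesis
        by simp
    qed
    have dd: "(\<lambda>Y. blinfun_apply B (d Y a) \<bullet> d Y b) \<in> borel_measurable (\<Pi>\<^sub>M i\<in>{..<s}. P)"
      if "a \<in> A" "b \<in> A" for B :: "'h \<Rightarrow>\<^sub>L 'h" and a b
    proof -
      have "fst a < s" "snd a < s" "fst b < s" "snd b < s"
        using that by (auto simp: A_def)
      then show ?thesis
        unfolding d_def blinfun.diff_right inner_diff_left inner_diff_right
        by (intro borel_measurable_diff kk)
    qed
    \<comment> \<open>Both whitening factors are moved to one side to reach the form
      \<open>B (k x) \<bullet> k y\<close>, whose measurability is known.\<close>
    have vv: "?v Y a \<bullet> ?v Y b = blinfun_apply (R o\<^sub>L R) (d Y a) \<bullet> d Y b" for Y a b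
      by (simp add: R_self_adjoint)
    have vWv: "?v Y a \<bullet> blinfun_apply ?W (?v Y a) = blinfun_apply (R o\<^sub>L ?W o\<^sub>L R) (d Y a) \<bullet> d Y a" for Y a
      using diag_op_self_adjoint[OF bounded_w, of 0 "?v Y a" "?v Y a"] by (simp add: R_self_adjoint)
    show ?thesis
      unfolding F_def vv vWv
      by (intro borel_measurable_add borel_measurable_diff borel_measurable_times borel_measurable_const
        borel_measurable_sum dd)
  qed
  ultimately show ?thesis
    by simp
qed

text \<open>The failure events \<open>E n\<close> of the truncations increase with \<open>n\<close>
  and share one bound, so continuity from below bounds their union without any union bound.\<close>

lemma whitened_error_concentration:
  assumes M: "\<And>n z. H n z \<le> M" and s: "2 \<le> s" and \<delta>: "0 < \<delta>" "\<delta> < 1 / 2"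
  shows "1 - 2 * \<delta> \<le> measure (\<Pi>\<^sub>M i\<in>{..<s}. P) {Y \<in> space (\<Pi>\<^sub>M i\<in>{..<s}. P).
    hs_norm (D s Y) \<le> ereal (16 * M * ln (3 / \<delta>) / real s + sqrt (8 * M * N1 P fn lam * ln (2 / \<delta>) / real s))}"
proof -
  let ?P = "\<Pi>\<^sub>M i\<in>{..<s}. P"
  interpret S: prob_space ?P
    by (intro prob_space_PiM prob_space_axioms)
  define \<epsilon> where "\<epsilon> = 16 * M * ln (3 / \<delta>) / real s + sqrt (8 * M * N1 P fn lam * ln (2 / \<delta>) / real s)"
  have M_pos: "0 < M"
    using sum_w_le[of 1 M] M w_pos[of 0] by fastforce
  \<comment> \<open>An exponent of \<open>ln (1 / \<delta>)\<close> already turns the tail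
    \<open>2 * exp\<close> into \<open>2 * \<delta>\<close>; both logarithms in the radius dominate
    it.\<close>
  have ln: "0 \<le> ln (1 / \<delta>)" "ln (1 / \<delta>) \<le> ln (3 / \<delta>)" "ln (1 / \<delta>) \<le> ln (2 / \<delta>)"
    using \<delta> by (auto simp: divide_right_mono)
  have \<epsilon>: "0 \<le> \<epsilon>"
    using M_pos N1_pos ln by (auto simp: \<epsilon>_def intro!: add_nonneg_nonneg)
  let ?A = "\<lambda>n::nat. {..<n} \<times> {..<n}"
  let ?u = "\<lambda>Y a. (\<Sum>i<s. \<Sum>j\<in>{..<s} - {i}. \<xi> a (Y i, Y j)) / (real s * (real s - 1))"
  define E where "E n = {Y \<in> space ?P. \<epsilon> < L2_set (?u Y) (?A n)}" for n
  have E_le: "measure ?P (E n) \<le> 2 * \<delta>" for n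
  proof -
    have "measure ?P (E n) \<le> 2 * exp (- (real (s div 2) * \<epsilon>\<^sup>2 / (2 * (M * N1 P fn lam + 2 * M * \<epsilon>))))"
      unfolding E_def using s \<epsilon> M_pos N1_pos
      by (intro U_statistic_Bernstein measurable_xi integral_xi L2_set_xi_le M integral_sum_square_xi_le) auto
    also have "\<dots> \<le> 2 * exp (- ln (1 / \<delta>))"
    proof -
      \<comment> \<open>The extreme case is \<open>s = 3\<close>, where a single pair is
        available.\<close>
      have "s \<le> 3 * (s div 2)"
        using s by presburger
      then have "ln (1 / \<delta>) \<le> real (s div 2) * \<epsilon>\<^sup>2 / (2 * (M * N1 P fn lam + 2 * M * \<epsilon>))"
        using M_pos N1_pos s by (intro Bernstein_exponent_ge[OF _ _ ln _ _ \<epsilon>_def]) auto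
      then show ?thesis
        by simp
    qed
    also have "\<dots> = 2 * \<delta>"
      using \<delta> by (simp add: exp_minus)
    finally show ?thesis .
  qed
  have u_meas: "(\<lambda>Y. L2_set (?u Y) (?A n)) \<in> borel_measurable ?P" for n
  proof -
    have "(\<lambda>Y. \<xi> a (Y i, Y j)) \<in> borel_measurable ?P" if "i < s" "j < s" for a i j
      using that by (intro measurable_compose[OF _ measurable_xi] measurable_Pair measurable_component_singleton) auto
    then show ?thesis
      by (intro borel_measurable_L2_set borel_measurable_divide borel_measurable_sum borel_measurable_const) auto
  qed
  have E_sets: "E n \<in> sets ?P" for n
    unfolding E_def using u_meas[of n] by measurable
  have "incseq E"
  proof (rule incseq_SucI)
    fix n
    have "L2_set (?u Y) (?A n) \<le> L2_set (?u Y) (?A (Suc n))" for Y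
      unfolding L2_set_def by (intro real_sqrt_le_mono sum_mono2) auto
    then show "E n \<subseteq> E (Suc n)"
      unfolding E_def by (auto intro: less_le_trans)
  qed
  then have "(\<lambda>n. measure ?P (E n)) \<longlonglongrightarrow> measure ?P (\<Union>n. E n)"
    using E_sets by (intro S.finite_Lim_measure_incseq) auto
  then have "measure ?P (\<Union>n. E n) \<le> 2 * \<delta>"
    using E_le by (intro LIMSEQ_le_const2) auto
  then have "1 - 2 * \<delta> \<le> measure ?P (space ?P - (\<Union>n. E n))"
    using E_sets by (subst S.prob_compl) auto
  \<comment> \<open>Outside the support the truncations do not control the component orthogonal to
    the \<open>e i\<close>. The inclusion is thus only almost sure, and comparing measures requires
    the larger event to be measurable.\<close>
  also have "\<dots> \<le> measure ?P {Y \<in> space ?P. hs_norm (D s Y) \<le> ereal \<epsilon>}"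
  proof (rule S.finite_measure_mono_AE)
    show "{Y \<in> space ?P. hs_norm (D s Y) \<le> ereal \<epsilon>} \<in> sets ?P"
      using hs_norm_D_measurable[of s] by measurable
    have "AE Y in ?P. \<forall>i\<in>{..<s}. Y i \<in> supp"
      using AE_supp prob_space_axioms by (intro AE_finite_allI AE_PiM_component) auto
    then show "AE Y in ?P. Y \<in> space ?P - (\<Union>n. E n) \<longrightarrow> Y \<in> {Y \<in> space ?P. hs_norm (D s Y) \<le> ereal \<epsilon>}"
    proof (eventually_elim, intro impI)
      fix Y assume supp: "\<forall>i\<in>{..<s}. Y i \<in> supp" and Y: "Y \<in> space ?P - (\<Union>n. E n)"
      have "hs_norm (D s Y) \<le> ereal \<epsilon>"
      proof (rule hs_norm_le_if_truncations_le[OF D_self_adjoint D_orthogonal _ \<epsilon>])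
        fix n
        have "L2_set (?u Y) (?A n) \<le> \<epsilon>"
          using Y by (auto simp: E_def not_less)
        then have "(L2_set (?u Y) (?A n))\<^sup>2 \<le> \<epsilon>\<^sup>2"
          by (intro power_mono) auto
        then have "(\<Sum>a\<in>?A n. (?u Y a)\<^sup>2) \<le> \<epsilon>\<^sup>2"
          by (simp add: L2_set_def sum_nonneg)
        then show "(\<Sum>p<n. \<Sum>q<n. (blinfun_apply (D s Y) (e p) \<bullet> e q)\<^sup>2) \<le> \<epsilon>\<^sup>2"
          unfolding inner_D_e[OF s] sum.cartesian_product' .
      qed (use supp in auto)
      with Y show "Y \<in> {Y \<in> space ?P. hs_norm (D s Y) \<le> ereal \<epsilon>}"
        by simp
    qed
  qed
  finally show ?thesis
    unfolding \<epsilon>_def .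
qed

lemma e_eq_eig_fun: "e i = sqrt (l i) *\<^sub>R eig_fun P fn l \<psi> i"
proof -
  have "sqrt (l i) * inverse (l i) = 1 / sqrt (l i)"
    using l_pos[of i] by (simp add: field_simps)
  then show ?thesis
    by (simp add: e_def eig_fun_def)
qed

text \<open>In terms of the eigenfunctions, \<open>c p\<close> squared is \<open>w p\<close> times a
  squared difference of values, at most \<open>4 * C\<^sup>2\<close>. Summing the weights gives
  \<open>N1\<close> where the general bound has \<open>1 / lam\<close>.\<close>

lemma H_le_sup:
  assumes C: "\<And>i x. \<bar>fn (eig_fun P fn l \<psi> i) x\<bar> \<le> C"
  shows "H n z \<le> 2 * C\<^sup>2 * N1 P fn lam"
proof -
  have "(c p z)\<^sup>2 \<le> w p * (4 * C\<^sup>2)" for p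
  proof -
    let ?\<phi> = "fn (eig_fun P fn l \<psi> p)"
    have "\<bar>?\<phi> (fst z) - ?\<phi> (snd z)\<bar> \<le> 2 * C"
      using C[of p "fst z"] C[of p "snd z"] by linarith
    then have "(?\<phi> (fst z) - ?\<phi> (snd z))\<^sup>2 \<le> 4 * C\<^sup>2"
      using power_mono[of "\<bar>?\<phi> (fst z) - ?\<phi> (snd z)\<bar>" "2 * C" 2] by (simp add: power_mult_distrib)
    moreover have "(c p z)\<^sup>2 = w p * (?\<phi> (fst z) - ?\<phi> (snd z))\<^sup>2"
    proof -
      have "(k (fst z) - k (snd z)) \<bullet> e p = sqrt (l p) * (?\<phi> (fst z) - ?\<phi> (snd z))"
        by (simp add: e_eq_eig_fun fn_eq inner_diff_right inner_commute[of _ "eig_fun P fn l \<psi> p"])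
      then show ?thesis
        unfolding c_def using l_pos[of p] l_lam_pos[of p] by (simp add: w_def power_divide power_mult_distrib)
    qed
    ultimately show ?thesis
      using w_nonneg[of p] by (simp add: mult_left_mono)
  qed
  then have "(\<Sum>p<n. (c p z)\<^sup>2) \<le> (\<Sum>p<n. w p * (4 * C\<^sup>2))"
    by (rule sum_mono)
  also have "\<dots> = (\<Sum>p<n. w p) * (4 * C\<^sup>2)"
    by (simp add: sum_distrib_right)
  also have "\<dots> \<le> N1 P fn lam * (4 * C\<^sup>2)"
    by (intro mult_right_mono sum_w_le_N1) simp
  finally show ?thesis
    by (simp add: H_def ac_simps)
qed

end

theorem lemmaA4:
  fixes P0 :: "'x::second_countable_topology measure"
    and fn :: "'h::{real_inner,banach} \<Rightarrow> 'x \<Rightarrow> real"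
    and K :: "'x \<Rightarrow> 'x \<Rightarrow> real"
    and l :: "nat \<Rightarrow> real" and \<psi> :: "nat \<Rightarrow> 'x \<Rightarrow> real"
    and \<kappa> lam \<delta> C :: real and s :: nat
  assumes "prob_space P0" and "sets P0 = sets borel"
    and "rkhs fn K"
    and "continuous_on UNIV (\<lambda>(x, y). K x y)"
    and "\<And>x. K x x \<le> \<kappa>"
    and "eigen_decomp P0 fn l \<psi>"
    and "0 < lam" and "2 \<le> s" and "0 < \<delta>" and "\<delta> < 1 / 2"
  shows "measure (\<Pi>\<^sub>M i\<in>{..<s}. P0)
           {Y \<in> space (\<Pi>\<^sub>M i\<in>{..<s}. P0).
              hs_norm (whitened_error P0 fn K lam s Y)
              \<le> ereal (32 * \<kappa> * ln (3 / \<delta>) / (lam * real s)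
                       + sqrt (16 * \<kappa> * N1 P0 fn lam * ln (2 / \<delta>) / (lam * real s)))}
           \<ge> 1 - 2 * \<delta>
       \<and> ((SUP i. SUP x. ereal \<bar>fn (eig_fun P0 fn l \<psi> i) x\<bar>) = ereal C \<longrightarrow>
         measure (\<Pi>\<^sub>M i\<in>{..<s}. P0)
           {Y \<in> space (\<Pi>\<^sub>M i\<in>{..<s}. P0).
              hs_norm (whitened_error P0 fn K lam s Y)
              \<le> ereal (32 * C\<^sup>2 * N1 P0 fn lam * ln (3 / \<delta>) / real s
                       + sqrt (16 * C\<^sup>2 * (N1 P0 fn lam)\<^sup>2 * ln (2 / \<delta>) / real s))}
           \<ge> 1 - 2 * \<delta>)"
proof -
  interpret kernel_eigen_system P0 fn K \<kappa> l \<psi> lam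
    using assms by (intro kernel_eigen_system.intro bounded_kernel_space.intro
      bounded_kernel_space_axioms.intro kernel_eigen_system_axioms.intro) auto
  note conc = whitened_error_concentration[OF _ \<open>2 \<le> s\<close> \<open>0 < \<delta>\<close> \<open>\<delta> < 1 / 2\<close>]
  show ?thesis
  proof (intro conjI impI)
    \<comment> \<open>Here \<open>M = 2 * \<kappa> / lam\<close>, which turns the constants 16 and 8
      into 32 and 16.\<close>
    show "1 - 2 * \<delta> \<le> measure (\<Pi>\<^sub>M i\<in>{..<s}. P0) {Y \<in> space (\<Pi>\<^sub>M i\<in>{..<s}. P0).
        hs_norm (D s Y) \<le> ereal (32 * \<kappa> * ln (3 / \<delta>) / (lam * real s)
          + sqrt (16 * \<kappa> * N1 P0 fn lam * ln (2 / \<delta>) / (lam * real s)))}"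
      using conc[OF H_le_kappa] by simp
    \<comment> \<open>The supremum is taken in \<open>ereal\<close>, so its equality with a real
      \<open>C\<close> expresses finiteness and yields the pointwise bound.\<close>
    assume sup: "(SUP i. SUP x. ereal \<bar>fn (eig_fun P0 fn l \<psi> i) x\<bar>) = ereal C"
    have "\<bar>fn (eig_fun P0 fn l \<psi> i) x\<bar> \<le> C" for i x
    proof -
      have "ereal \<bar>fn (eig_fun P0 fn l \<psi> i) x\<bar> \<le> (SUP i. SUP x. ereal \<bar>fn (eig_fun P0 fn l \<psi> i) x\<bar>)"
        by (intro SUP_upper2[of i] SUP_upper2[of x]) auto
      then show ?thesis
        unfolding sup by simp
    qed
    then show "1 - 2 * \<delta> \<le> measure (\<Pi>\<^sub>M i\<in>{..<s}. P0) {Y \<in> space (\<Pi>\<^sub>M i\<in>{..<s}. P0).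
        hs_norm (D s Y) \<le> ereal (32 * C\<^sup>2 * N1 P0 fn lam * ln (3 / \<delta>) / real s
          + sqrt (16 * C\<^sup>2 * (N1 P0 fn lam)\<^sup>2 * ln (2 / \<delta>) / real s))}"
      using conc[OF H_le_sup] by (simp add: power2_eq_square mult.assoc)
  qed
qed

end
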